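(* Let $E$ be an arbitrary directed graph, $K$ a field, and $L=L_K(E)$ the Leavitt path algebra. The following are equivalent: (1) every proper ideal of $L$ is strongly prime; (2) all the proper ideals of $L$ are graded strongly primitive and form a chain under set inclusion; (3) the graph $E$ satisfies Condition (K), the admissible pairs $(H,S)$ form a chain under the partial ordering of the admissible pairs, and for each admissible pair $(H,S)$ with $H\neq E^0$, $E\backslash(H,S)$ is downward directed and satisfies the strong CSP.
   Context: A directed graph $E=(E^0,E^1,r,s)$ consists of sets $E^0$ (vertices), $E^1$ (edges) and maps $r,s:E^1\to E^0$; no finiteness or countability is assumed. A vertex is regular if it emits a nonempty finite set of edges, and an infinite emitter if it emits infinitely many. $L_K(E)$ is the (not necessarily unital) $K$-algebra generated by pairwise orthogonal idempotents $v\in E^0$ and elements $e,e^*$ ($e\in E^1$) subject to: $s(e)e=e=er(e)$; $r(e)e^*=e^*=e^*s(e)$; $e^*e=r(e)$ and $e^*f=0$ for edges $e\neq f$; $v=\sum_{s(e)=v}ee^*$ for every regular vertex $v$. It is $\mathbb Z$-graded by $\deg v=0$, $\deg e=1$, $\deg e^*=-1$. "Ideal" means two-sided ideal. A proper ideal $P$ of a ring $R$ is strongly prime if for every family of ideals $(A_i)_{i\in X}$ of $R$ ($X$ an arbitrary nonempty index set), $\bigcap_{i\in X}A_i\subseteq P$ implies $A_i\subseteq P$ for some $i\in X$. An ideal $P$ is (right) primitive if $R/P$ has a faithful simple right module. Write $u\ge v$ if there is a path (possibly of length $0$) from $u$ to $v$. A graph is downward directed if for all vertices $u,v$ there is a vertex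 $w$ with $u\ge w$, $v\ge w$. $H\subseteq E^0$ is hereditary if $v\in H$, $v\ge w$ imply $w\in H$; it is saturated if a regular vertex $v$ with $r(s^{-1}(v))\subseteq H$ lies in $H$. For $H$ hereditary saturated, $B_H$ is the set of infinite emitters $w\in E^0\backslash H$ with $0<|s^{-1}(w)\cap r^{-1}(E^0\backslash H)|<\infty$, and for $v\in B_H$, $v^H=v-\sum_{s(e)=v,\,r(e)\notin H}ee^*$. An admissible pair is $(H,S)$ with $H$ hereditary saturated and $S\subseteq B_H$; the partial ordering is $(H_1,S_1)\le(H_2,S_2)$ iff $H_1\subseteq H_2$ and $S_1\subseteq H_2\cup S_2$. $I(H,S)$ is the ideal generated by $H\cup\{v^H:v\in S\}$ (these are exactly the graded ideals). For an ideal $I$, $gr(I)=I(H,S)$ with $H=I\cap E^0$, $S=\{v\in B_H:v^H\in I\}$. The quotient graph $E\backslash(H,S)$ has vertices $(E^0\backslash H)\cup\{v':v\in B_H\backslash S\}$ and edges $\{e\in E^1:r(e)\notin H\}\cup\{e':e\in E^1,\ r(e)\in B_H\backslash S\}$, with $s(e')=s(e)$, $r(e')=r(e)'$. A graph $F$ satisfies the strong CSP if there is a non-empty countable set $C\subseteq F^0$ such that every $u\in F^0$ satisfies $u\ge v$ for some $v\in C$, and $C$ is contained in every non-empty hereditary saturated subset of $F^0$. A primitive ideal $P$ of $L_K(E)$ with $gr(P)=I(H,S)$ is strongly primitive if $E\backslash(H,S)$ satisfies the strong CSP. A closed path $e_1\cdots e_n$ ($n\ge 1$, $r(e_n)=s(e_1)$),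 based at $s(e_1)$, is simple if $s(e_i)\ne s(e_1)$ for $i=2,\dots,n$. $E$ satisfies Condition (K) if any vertex that is the base of a simple closed path $c$ is also the base of another simple closed path $c'\ne c$. *)

theory Defs
  imports
    "HOL-Algebra.QuotRing"
    "HOL-Algebra.Module"
    "HOL-Library.Poly_Mapping"
    "HOL-Library.Countable_Set"
    "Graph_Theory.Digraph"
    "Graph_Theory.Arc_Walk"
begin

section \<open>Rings without identity\<close>

text \<open>
  The ring records of HOL-Algebra are used for rings that need not have an identity; the field
  \<^term>\<open>one R\<close> is then meaningless, and no definition below reads it, except that
  \<^const>\<open>FactRing\<close> copies it into the (equally meaningless) field of the quotient. The locale
  \<^locale>\<open>ideal\<close> assumes a ring with identity, so ideals are defined afresh.
\<close>

definition rng_ideal :: "'a set \<Rightarrow> ('a, 'm) ring_scheme \<Rightarrow> bool" where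
  "rng_ideal I R \<longleftrightarrow> additive_subgroup I R \<and>
     (\<forall>a\<in>I. \<forall>x\<in>carrier R. x \<otimes>\<^bsub>R\<^esub> a \<in> I \<and> a \<otimes>\<^bsub>R\<^esub> x \<in> I)"

definition proper_ideal :: "'a set \<Rightarrow> ('a, 'm) ring_scheme \<Rightarrow> bool" where
  "proper_ideal I R \<longleftrightarrow> rng_ideal I R \<and> I \<noteq> carrier R"

definition strongly_prime :: "'a set \<Rightarrow> ('a, 'm) ring_scheme \<Rightarrow> bool" where
  "strongly_prime P R \<longleftrightarrow> proper_ideal P R \<and>
     (\<forall>\<A>. \<A> \<noteq> {} \<longrightarrow> (\<forall>A\<in>\<A>. rng_ideal A R) \<longrightarrow> \<Inter>\<A> \<subseteq> P \<longrightarrow> (\<exists>A\<in>\<A>. A \<subseteq> P))"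

text \<open>
  Right modules reuse the record \<^typ>\<open>('a, 'b) module\<close>: the term \<open>a \<odot>\<^bsub>M\<^esub> m\<close> stands for
  the right action $m \cdot a$.
\<close>

definition right_module :: "('a, 'm) ring_scheme \<Rightarrow> ('a, 'b) module \<Rightarrow> bool" where
  "right_module R M \<longleftrightarrow> abelian_group M \<and>
     (\<forall>a\<in>carrier R. \<forall>m\<in>carrier M. a \<odot>\<^bsub>M\<^esub> m \<in> carrier M) \<and>
     (\<forall>a\<in>carrier R. \<forall>m\<in>carrier M. \<forall>n\<in>carrier M.
        a \<odot>\<^bsub>M\<^esub> (m \<oplus>\<^bsub>M\<^esub> n) = a \<odot>\<^bsub>M\<^esub> m \<oplus>\<^bsub>M\<^esub> a \<odot>\<^bsub>M\<^esub> n) \<and>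
     (\<forall>a\<in>carrier R. \<forall>b\<in>carrier R. \<forall>m\<in>carrier M.
        (a \<oplus>\<^bsub>R\<^esub> b) \<odot>\<^bsub>M\<^esub> m = a \<odot>\<^bsub>M\<^esub> m \<oplus>\<^bsub>M\<^esub> b \<odot>\<^bsub>M\<^esub> m) \<and>
     (\<forall>a\<in>carrier R. \<forall>b\<in>carrier R. \<forall>m\<in>carrier M.
        (a \<otimes>\<^bsub>R\<^esub> b) \<odot>\<^bsub>M\<^esub> m = b \<odot>\<^bsub>M\<^esub> (a \<odot>\<^bsub>M\<^esub> m))"

text \<open>Over a ring without identity, simplicity of $M$ includes $MR \neq 0$.\<close>

definition simple_right_module :: "('a, 'm) ring_scheme \<Rightarrow> ('a, 'b) module \<Rightarrow> bool" where
  "simple_right_module R M \<longleftrightarrow> right_module R M \<and>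
     (\<exists>a\<in>carrier R. \<exists>m\<in>carrier M. a \<odot>\<^bsub>M\<^esub> m \<noteq> \<zero>\<^bsub>M\<^esub>) \<and>
     (\<forall>N. additive_subgroup N M \<longrightarrow> (\<forall>a\<in>carrier R. \<forall>n\<in>N. a \<odot>\<^bsub>M\<^esub> n \<in> N) \<longrightarrow>
        N = {\<zero>\<^bsub>M\<^esub>} \<or> N = carrier M)"

definition faithful_right_module :: "('a, 'm) ring_scheme \<Rightarrow> ('a, 'b) module \<Rightarrow> bool" where
  "faithful_right_module R M \<longleftrightarrow> right_module R M \<and>
     (\<forall>a\<in>carrier R. (\<forall>m\<in>carrier M. a \<odot>\<^bsub>M\<^esub> m = \<zero>\<^bsub>M\<^esub>) \<longrightarrow> a = \<zero>\<^bsub>R\<^esub>)"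

text \<open>
  Quantifying over modules whose elements have type \<^typ>\<open>'a set\<close> is no restriction: a simple right
  $R/P$-module is isomorphic to $R/\rho$ for a right ideal $\rho \supseteq P$ of $R$, and the
  elements of $R/\rho$ are cosets of $\rho$, that is, sets of elements of $R$.
\<close>

definition primitive_ideal :: "'a set \<Rightarrow> ('a, 'm) ring_scheme \<Rightarrow> bool" where
  "primitive_ideal P R \<longleftrightarrow> rng_ideal P R \<and>
     (\<exists>M :: ('a set, 'a set) module.
        simple_right_module (R Quot P) M \<and> faithful_right_module (R Quot P) M)"


section \<open>Directed graphs\<close>

definition regular_vertex :: "('v, 'e) pre_digraph \<Rightarrow> 'v \<Rightarrow> bool" where
  "regular_vertex E v \<longleftrightarrow> v \<in> verts E \<and> finite (out_arcs E v) \<and> out_arcs E v \<noteq> {}"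

definition infinite_emitter :: "('v, 'e) pre_digraph \<Rightarrow> 'v \<Rightarrow> bool" where
  "infinite_emitter E v \<longleftrightarrow> v \<in> verts E \<and> infinite (out_arcs E v)"

definition downward_directed :: "('v, 'e) pre_digraph \<Rightarrow> bool" where
  "downward_directed E \<longleftrightarrow>
     (\<forall>u\<in>verts E. \<forall>v\<in>verts E. \<exists>w\<in>verts E. u \<rightarrow>\<^sup>*\<^bsub>E\<^esub> w \<and> v \<rightarrow>\<^sup>*\<^bsub>E\<^esub> w)"

definition hereditary :: "('v, 'e) pre_digraph \<Rightarrow> 'v set \<Rightarrow> bool" where
  "hereditary E H \<longleftrightarrow> H \<subseteq> verts E \<and> (\<forall>v\<in>H. \<forall>w. v \<rightarrow>\<^sup>*\<^bsub>E\<^esub> w \<longrightarrow> w \<in> H)"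

definition saturated :: "('v, 'e) pre_digraph \<Rightarrow> 'v set \<Rightarrow> bool" where
  "saturated E H \<longleftrightarrow> (\<forall>v. regular_vertex E v \<longrightarrow> head E ` out_arcs E v \<subseteq> H \<longrightarrow> v \<in> H)"

definition breaking_vertices :: "('v, 'e) pre_digraph \<Rightarrow> 'v set \<Rightarrow> 'v set" where
  "breaking_vertices E H = {w \<in> verts E - H. infinite_emitter E w \<and>
     finite {e \<in> out_arcs E w. head E e \<notin> H} \<and> {e \<in> out_arcs E w. head E e \<notin> H} \<noteq> {}}"

definition admissible_pair :: "('v, 'e) pre_digraph \<Rightarrow> 'v set \<times> 'v set \<Rightarrow> bool" where
  "admissible_pair E = (\<lambda>(H, S). hereditary E H \<and> saturated E H \<and> S \<subseteq> breaking_vertices E H)"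

definition admissible_le :: "'v set \<times> 'v set \<Rightarrow> 'v set \<times> 'v set \<Rightarrow> bool" where
  "admissible_le = (\<lambda>(H1, S1) (H2, S2). H1 \<subseteq> H2 \<and> S1 \<subseteq> H2 \<union> S2)"

text \<open>In the quotient graph, \<^const>\<open>Inl\<close> marks the old vertices and edges and \<^const>\<open>Inr\<close>
  the primed copies.\<close>

definition quotient_graph ::
    "('v, 'e) pre_digraph \<Rightarrow> 'v set \<times> 'v set \<Rightarrow> ('v + 'v, 'e + 'e) pre_digraph" where
  "quotient_graph E = (\<lambda>(H, S).
     \<lparr> verts = Inl ` (verts E - H) \<union> Inr ` (breaking_vertices E H - S),
       arcs = Inl ` {e \<in> arcs E. head E e \<notin> H} \<union>
              Inr ` {e \<in> arcs E. head E e \<in> breaking_vertices E H - S},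
       tail = (\<lambda>x. case x of Inl e \<Rightarrow> Inl (tail E e) | Inr e \<Rightarrow> Inl (tail E e)),
       head = (\<lambda>x. case x of Inl e \<Rightarrow> Inl (head E e) | Inr e \<Rightarrow> Inr (head E e)) \<rparr>)"

definition strong_CSP :: "('v, 'e) pre_digraph \<Rightarrow> bool" where
  "strong_CSP F \<longleftrightarrow> (\<exists>C. C \<subseteq> verts F \<and> C \<noteq> {} \<and> countable C \<and>
     (\<forall>u\<in>verts F. \<exists>v\<in>C. u \<rightarrow>\<^sup>*\<^bsub>F\<^esub> v) \<and>
     (\<forall>H. H \<noteq> {} \<longrightarrow> hereditary F H \<longrightarrow> saturated F H \<longrightarrow> C \<subseteq> H))"

definition simple_closed_path :: "('v, 'e) pre_digraph \<Rightarrow> 'v \<Rightarrow> 'e list \<Rightarrow> bool" where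
  "simple_closed_path E v c \<longleftrightarrow>
     pre_digraph.awalk E v c v \<and> c \<noteq> [] \<and> (\<forall>e\<in>set (tl c). tail E e \<noteq> v)"

definition condition_K :: "('v, 'e) pre_digraph \<Rightarrow> bool" where
  "condition_K E \<longleftrightarrow>
     (\<forall>v c. simple_closed_path E v c \<longrightarrow> (\<exists>c'. c' \<noteq> c \<and> simple_closed_path E v c'))"


section \<open>Free algebras without identity\<close>

text \<open>
  \<^const>\<open>Poly_Mapping.single\<close> and the convolution product of \<^typ>\<open>'a \<Rightarrow>\<^sub>0 'b\<close> need an additively
  written monoid of exponents; here it is the free monoid, so \<open>+\<close> is concatenation and \<open>0\<close> is
  the empty word.
\<close>

datatype 'g free_word = Word (letters: "'g list")

instantiation free_word :: (type) monoid_add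
begin

definition zero_free_word :: "'a free_word" where
  "0 = Word []"

definition plus_free_word :: "'a free_word \<Rightarrow> 'a free_word \<Rightarrow> 'a free_word" where
  "u + w = Word (letters u @ letters w)"

instance
  by standard (simp_all add: zero_free_word_def plus_free_word_def)

end

text \<open>The elements are the linear combinations of nonempty words in \<open>X\<close>.\<close>

definition free_rng :: "'g set \<Rightarrow> ('g free_word \<Rightarrow>\<^sub>0 'k::field) ring" where
  "free_rng X = \<lparr> carrier = {p. \<forall>w\<in>Poly_Mapping.keys p. letters w \<noteq> [] \<and> set (letters w) \<subseteq> X},
     mult = (*), one = undefined, zero = 0, add = (+) \<rparr>"

definition monom_word :: "'g list \<Rightarrow> 'g free_word \<Rightarrow>\<^sub>0 'k::field" where
  "monom_word w = Poly_Mapping.single (Word w) 1"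

definition scale :: "'k::field \<Rightarrow> ('g free_word \<Rightarrow>\<^sub>0 'k) \<Rightarrow> ('g free_word \<Rightarrow>\<^sub>0 'k)" where
  "scale c p = Poly_Mapping.single 0 c * p"


section \<open>Leavitt path algebras\<close>

datatype ('v, 'e) lpa_gen = Vertex 'v | Edge 'e | Ghost 'e

definition lpa_gens :: "('v, 'e) pre_digraph \<Rightarrow> ('v, 'e) lpa_gen set" where
  "lpa_gens E = Vertex ` verts E \<union> Edge ` arcs E \<union> Ghost ` arcs E"

type_synonym ('v, 'e, 'k) lpa_free = "('v, 'e) lpa_gen free_word \<Rightarrow>\<^sub>0 'k"

definition lpa_relators :: "('v, 'e) pre_digraph \<Rightarrow> ('v, 'e, 'k::field) lpa_free set" where
  "lpa_relators E =
     {monom_word [Vertex v, Vertex v] - monom_word [Vertex v] | v. v \<in> verts E} \<union>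
     {monom_word [Vertex v, Vertex w] | v w. v \<in> verts E \<and> w \<in> verts E \<and> v \<noteq> w} \<union>
     {monom_word [Vertex (tail E e), Edge e] - monom_word [Edge e] | e. e \<in> arcs E} \<union>
     {monom_word [Edge e, Vertex (head E e)] - monom_word [Edge e] | e. e \<in> arcs E} \<union>
     {monom_word [Vertex (head E e), Ghost e] - monom_word [Ghost e] | e. e \<in> arcs E} \<union>
     {monom_word [Ghost e, Vertex (tail E e)] - monom_word [Ghost e] | e. e \<in> arcs E} \<union>
     {monom_word [Ghost e, Edge e] - monom_word [Vertex (head E e)] | e. e \<in> arcs E} \<union>
     {monom_word [Ghost e, Edge f] | e f. e \<in> arcs E \<and> f \<in> arcs E \<and> e \<noteq> f} \<union>
     {monom_word [Vertex v] - (\<Sum>e\<in>out_arcs E v. monom_word [Edge e, Ghost e]) | v.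
        regular_vertex E v}"

text \<open>
  The scalar multiples of the relators are needed because a ring ideal of an algebra without
  identity need not be a subspace.
\<close>

definition lpa_kernel :: "('v, 'e) pre_digraph \<Rightarrow> ('v, 'e, 'k::field) lpa_free set" where
  "lpa_kernel E = \<Inter>{J. rng_ideal J (free_rng (lpa_gens E)) \<and>
     (\<forall>c. \<forall>p\<in>lpa_relators E. scale c p \<in> J)}"

text \<open>The first argument only fixes the field of coefficients.\<close>

definition lpa :: "'k::field itself \<Rightarrow> ('v, 'e) pre_digraph \<Rightarrow> ('v, 'e, 'k) lpa_free set ring" where
  "lpa K E = free_rng (lpa_gens E) Quot lpa_kernel E"

definition lpa_class ::
    "('v, 'e) pre_digraph \<Rightarrow> ('v, 'e, 'k::field) lpa_free \<Rightarrow> ('v, 'e, 'k) lpa_free set" where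
  "lpa_class E p = lpa_kernel E +>\<^bsub>free_rng (lpa_gens E)\<^esub> p"

fun gen_degree :: "('v, 'e) lpa_gen \<Rightarrow> int" where
  "gen_degree (Vertex v) = 0"
| "gen_degree (Edge e) = 1"
| "gen_degree (Ghost e) = - 1"

definition lpa_component ::
    "'k::field itself \<Rightarrow> ('v, 'e) pre_digraph \<Rightarrow> int \<Rightarrow> ('v, 'e, 'k) lpa_free set set" where
  "lpa_component K E n = lpa_class E ` {p \<in> carrier (free_rng (lpa_gens E)).
     \<forall>w\<in>Poly_Mapping.keys p. sum_list (map gen_degree (letters w)) = n}"

definition graded_ideal ::
    "'k::field itself \<Rightarrow> ('v, 'e) pre_digraph \<Rightarrow> ('v, 'e, 'k) lpa_free set set \<Rightarrow> bool" where
  "graded_ideal K E I \<longleftrightarrow> rng_ideal I (lpa K E) \<and>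
     (\<forall>a\<in>I. \<exists>N f. finite N \<and> (\<forall>n\<in>N. f n \<in> I \<inter> lpa_component K E n) \<and>
        a = finsum (lpa K E) f N)"

definition lpa_vertex ::
    "'k::field itself \<Rightarrow> ('v, 'e) pre_digraph \<Rightarrow> 'v \<Rightarrow> ('v, 'e, 'k) lpa_free set" where
  "lpa_vertex K E v = lpa_class E (monom_word [Vertex v])"

text \<open>The element $v^H$ for a breaking vertex $v$ of $H$.\<close>

definition lpa_breaking_elt ::
    "'k::field itself \<Rightarrow> ('v, 'e) pre_digraph \<Rightarrow> 'v set \<Rightarrow> 'v \<Rightarrow> ('v, 'e, 'k) lpa_free set" where
  "lpa_breaking_elt K E H v = lpa_class E (monom_word [Vertex v] -
     (\<Sum>e\<in>{e \<in> out_arcs E v. head E e \<notin> H}. monom_word [Edge e, Ghost e]))"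

text \<open>
  The graded part $gr(I)$ of $I$ is by definition the ideal generated by \<open>H\<close> and the $v^H$,
  \<open>v \<in> S\<close>, for the pair \<open>(H, S)\<close> below. Only the pair is needed here.
\<close>

definition gr_pair ::
    "'k::field itself \<Rightarrow> ('v, 'e) pre_digraph \<Rightarrow> ('v, 'e, 'k) lpa_free set set \<Rightarrow> 'v set \<times> 'v set" where
  "gr_pair K E I = (let H = {v \<in> verts E. lpa_vertex K E v \<in> I}
     in (H, {v \<in> breaking_vertices E H. lpa_breaking_elt K E H v \<in> I}))"

definition strongly_primitive ::
    "'k::field itself \<Rightarrow> ('v, 'e) pre_digraph \<Rightarrow> ('v, 'e, 'k) lpa_free set set \<Rightarrow> bool" where
  "strongly_primitive K E P \<longleftrightarrow> primitive_ideal P (lpa K E) \<and>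
     strong_CSP (quotient_graph E (gr_pair K E P))"

end

theory Submission
  imports Defs "HOL-Library.Product_Plus" "HOL-Library.Sublist"
begin

text \<open>
  Ideals of $L_K(E)$ are handled as the ideals of the free algebra that contain the relations.
  Under Condition (K) such an ideal \<open>I\<close> is determined by the pair \<open>(H, S)\<close> of its vertices and its
  elements $v^H$: a path $q = c^m c'$ made of two distinct simple closed paths at \<open>v\<close> satisfies
  \<open>q\<^sup>* \<delta> q = 0\<close> for every short nontrivial closed path \<open>\<delta>\<close>, which isolates single terms of linear
  combinations of paths. Hence all ideals are graded and their inclusions are those of the pairs.
  The strong CSP amounts to a vertex common to all nonempty hereditary saturated sets of the quotient
  graph, that is, to an idempotent outside \<open>P\<close> that lies in every ideal properly containing \<open>P\<close>; such
  an idempotent gives both strong primeness and a faithful simple module. Conversely, modules of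
  functions on branching systems realize every admissible pair as the pair of an ideal, and if
  Condition (K) fails, they give two incomparable ideals.
\<close>

section \<open>Ideals of rings without identity\<close>

text \<open>L_K(E) is given by generators and relations, without a normal form. That an element lies
  in an ideal is shown by computing with words modulo the ideal; that a constructed ideal omits an
  element is shown by a module on which the element acts nontrivially. Hence the branching systems,
  once for an arbitrary admissible pair and once for a vertex with a single simple closed path. Two
  nested ideals with the same pair are compared by induction on the length of the ghost parts of an
  element x. Multiplying by an edge on the right shortens them, but x w can be recovered from the
  products x e only at a regular vertex w, where w is the sum of its e e*. At other vertices the
  elements w - \<Sum> e e* over finite sets of edges (\<open>corner\<close>) take over: they
  annihilate the finitely many ghost edges that end x and leave a combination of paths, to which the
  separating pairs apply. This is where the elements v^H enter.\<close>

locale nonunital_ring = abelian_group R for R (structure) +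
  assumes m_closed [simp]: "x \<in> carrier R \<Longrightarrow> y \<in> carrier R \<Longrightarrow> x \<otimes> y \<in> carrier R"
    and m_assoc: "x \<in> carrier R \<Longrightarrow> y \<in> carrier R \<Longrightarrow> z \<in> carrier R \<Longrightarrow> x \<otimes> y \<otimes> z = x \<otimes> (y \<otimes> z)"
    and l_distr: "x \<in> carrier R \<Longrightarrow> y \<in> carrier R \<Longrightarrow> z \<in> carrier R \<Longrightarrow> (x \<oplus> y) \<otimes> z = x \<otimes> z \<oplus> y \<otimes> z"
    and r_distr: "x \<in> carrier R \<Longrightarrow> y \<in> carrier R \<Longrightarrow> z \<in> carrier R \<Longrightarrow> z \<otimes> (x \<oplus> y) = z \<otimes> x \<oplus> z \<otimes> y"
begin

lemma r_null [simp]: "x \<in> carrier R \<Longrightarrow> x \<otimes> \<zero> = \<zero>"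
  by (metis add.l_cancel_one' m_closed r_distr r_zero zero_closed)

lemma l_null [simp]: "x \<in> carrier R \<Longrightarrow> \<zero> \<otimes> x = \<zero>"
  by (metis add.l_cancel_one' m_closed l_distr r_zero zero_closed)

lemma r_minus: "x \<in> carrier R \<Longrightarrow> y \<in> carrier R \<Longrightarrow> x \<otimes> (\<ominus> y) = \<ominus> (x \<otimes> y)"
  by (metis a_inv_closed l_neg m_closed minus_equality r_distr r_null)

lemma l_minus: "x \<in> carrier R \<Longrightarrow> y \<in> carrier R \<Longrightarrow> (\<ominus> x) \<otimes> y = \<ominus> (x \<otimes> y)"
  by (metis a_inv_closed l_neg m_closed minus_equality l_distr l_null)

lemma a_inv_zero [simp]: "\<ominus> \<zero> = \<zero>"
  by (rule minus_equality) auto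

lemma abelian_subgroup_if_additive: "additive_subgroup I R \<Longrightarrow> abelian_subgroup I R"
  using abelian_subgroupI3 abelian_group_axioms by blast

lemma ideal_abelian_subgroup: "rng_ideal I R \<Longrightarrow> abelian_subgroup I R"
  by (simp add: rng_ideal_def abelian_subgroup_if_additive)

lemma ideal_subset: "rng_ideal I R \<Longrightarrow> I \<subseteq> carrier R"
  by (simp add: rng_ideal_def additive_subgroup.a_subset)

lemma coset_eq_iff:
  assumes "additive_subgroup I R" "x \<in> carrier R" "y \<in> carrier R"
  shows "I +> x = I +> y \<longleftrightarrow> x \<ominus> y \<in> I"
proof -
  interpret abelian_subgroup I R
    by (rule abelian_subgroup_if_additive) fact
  have "I +> x = I +> y \<longleftrightarrow> x \<in> I +> y"
    using a_repr_independence'[OF _ assms(3)] a_rcos_self[OF assms(2)] by metis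
  also have "\<dots> \<longleftrightarrow> x \<oplus> \<ominus> y \<in> I"
    by (rule a_rcos_module[OF assms(3,2)])
  finally show ?thesis by (simp add: a_minus_def)
qed

lemma coset_add:
  assumes "additive_subgroup I R" "x \<in> carrier R" "y \<in> carrier R"
  shows "(I +> x) <+> (I +> y) = I +> (x \<oplus> y)"
  using abelian_subgroup.a_rcos_sum[OF abelian_subgroup_if_additive] assms by blast

text \<open>\<open>rcoset_mult\<close> is a union over all representatives, so the point is that the
  coset of the product does not depend on them: x'y' - xy = (x' - x) y' + x (y' - y).\<close>

lemma coset_mult:
  assumes "rng_ideal I R" "x \<in> carrier R" "y \<in> carrier R"
  shows "[mod I:] (I +> x) \<Otimes> (I +> y) = I +> (x \<otimes> y)"
proof -
  interpret abelian_subgroup I R by (rule ideal_abelian_subgroup) fact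
  have sub: "additive_subgroup I R" by (rule is_additive_subgroup)
  have "I +> (x' \<otimes> y') = I +> (x \<otimes> y)" if "x' \<in> I +> x" "y' \<in> I +> y" for x' y'
  proof -
    have x': "x' \<in> carrier R" and y': "y' \<in> carrier R"
      using that a_elemrcos_carrier assms by blast+
    have "x' \<oplus> \<ominus> x \<in> I" "y' \<oplus> \<ominus> y \<in> I"
      using that a_rcos_module x' y' assms by blast+
    then have "(x' \<oplus> \<ominus> x) \<otimes> y' \<oplus> x \<otimes> (y' \<oplus> \<ominus> y) \<in> I"
      using assms x' y' by (simp add: rng_ideal_def additive_subgroup.a_closed)
    also have "(x' \<oplus> \<ominus> x) \<otimes> y' \<oplus> x \<otimes> (y' \<oplus> \<ominus> y) = x' \<otimes> y' \<ominus> x \<otimes> y"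
      using assms x' y' by (simp add: l_distr r_distr l_minus r_minus a_minus_def a_assoc r_neg1)
    finally show ?thesis
      using coset_eq_iff[OF sub] x' y' assms by simp
  qed
  moreover have "x \<in> I +> x" "y \<in> I +> y" using a_rcos_self assms by blast+
  ultimately show ?thesis unfolding rcoset_mult_def by blast
qed

lemma carrier_FactRing: "carrier (R Quot I) = (+>) I ` carrier R"
  by (auto simp: FactRing_def A_RCOSETS_def' a_r_coset_def')

lemma zero_coset: "rng_ideal I R \<Longrightarrow> I +> \<zero> = I"
  using ideal_subset by simp

lemma FactRing_zero: "rng_ideal I R \<Longrightarrow> \<zero>\<^bsub>R Quot I\<^esub> = I +> \<zero>"
  by (simp add: zero_coset FactRing_def del: a_coset_add_zero)

lemma FactRing_simps':
  assumes "rng_ideal I R" "x \<in> carrier R" "y \<in> carrier R"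
  shows "(I +> x) \<oplus>\<^bsub>R Quot I\<^esub> (I +> y) = I +> (x \<oplus> y)"
    "(I +> x) \<otimes>\<^bsub>R Quot I\<^esub> (I +> y) = I +> (x \<otimes> y)"
  using assms coset_add coset_mult zero_coset by (simp_all add: FactRing_def rng_ideal_def)

lemma FactRing_abelian_group:
  assumes "additive_subgroup I R"
  shows "abelian_group (R Quot I)"
proof -
  have "add_monoid (R Quot I) = R A_Mod I"
    by (simp add: FactRing_def A_FactGroup_def' A_RCOSETS_def)
  then have "comm_group (add_monoid (R Quot I))"
    using abelian_subgroup.a_factorgroup_is_comm_group[OF abelian_subgroup_if_additive[OF assms]] by simp
  then show ?thesis
    by (intro abelian_group.intro abelian_monoid.intro abelian_group_axioms.intro)
      (simp_all add: comm_group.axioms(1))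
qed

lemma FactRing_nonunital:
  assumes "rng_ideal I R"
  shows "nonunital_ring (R Quot I)"
proof -
  interpret Q: abelian_group "R Quot I"
    using assms FactRing_abelian_group by (simp add: rng_ideal_def)
  show ?thesis
    by unfold_locales
      (auto simp: carrier_FactRing FactRing_simps'[OF assms] m_assoc l_distr r_distr)
qed

lemma FactRing_minus:
  assumes "rng_ideal I R" "x \<in> carrier R"
  shows "\<ominus>\<^bsub>R Quot I\<^esub> (I +> x) = I +> (\<ominus> x)"
proof -
  interpret Q: nonunital_ring "R Quot I" using assms FactRing_nonunital by blast
  show ?thesis
    by (rule Q.minus_equality)
      (use assms in \<open>auto simp: FactRing_zero FactRing_simps' carrier_FactRing l_neg\<close>)
qed

lemma additive_subgroupI':
  assumes "I \<subseteq> carrier R" "\<zero> \<in> I" "\<And>x y. x \<in> I \<Longrightarrow> y \<in> I \<Longrightarrow> x \<oplus> y \<in> I"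
    "\<And>x. x \<in> I \<Longrightarrow> \<ominus> x \<in> I"
  shows "additive_subgroup I R"
  by (intro additive_subgroup.intro add.subgroupI) (use assms in \<open>auto simp: a_inv_def\<close>)

lemma rng_idealI:
  assumes "I \<subseteq> carrier R" "\<zero> \<in> I" "\<And>x y. x \<in> I \<Longrightarrow> y \<in> I \<Longrightarrow> x \<oplus> y \<in> I"
    "\<And>x. x \<in> I \<Longrightarrow> \<ominus> x \<in> I"
    "\<And>a x. a \<in> I \<Longrightarrow> x \<in> carrier R \<Longrightarrow> x \<otimes> a \<in> I"
    "\<And>a x. a \<in> I \<Longrightarrow> x \<in> carrier R \<Longrightarrow> a \<otimes> x \<in> I"
  shows "rng_ideal I R"
  using assms additive_subgroupI'[of I] by (simp add: rng_ideal_def)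

lemma rng_idealD:
  assumes "rng_ideal I R"
  shows "\<zero> \<in> I" "\<And>x y. x \<in> I \<Longrightarrow> y \<in> I \<Longrightarrow> x \<oplus> y \<in> I" "\<And>x. x \<in> I \<Longrightarrow> \<ominus> x \<in> I"
    "\<And>a x. a \<in> I \<Longrightarrow> x \<in> carrier R \<Longrightarrow> x \<otimes> a \<in> I"
    "\<And>a x. a \<in> I \<Longrightarrow> x \<in> carrier R \<Longrightarrow> a \<otimes> x \<in> I"
    "\<And>x. x \<in> I \<Longrightarrow> x \<in> carrier R"
proof -
  interpret abelian_subgroup I R using assms by (rule ideal_abelian_subgroup)
  show "\<zero> \<in> I" "\<And>x y. x \<in> I \<Longrightarrow> y \<in> I \<Longrightarrow> x \<oplus> y \<in> I" "\<And>x. x \<in> I \<Longrightarrow> \<ominus> x \<in> I"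
    "\<And>a x. a \<in> I \<Longrightarrow> x \<in> carrier R \<Longrightarrow> x \<otimes> a \<in> I"
    "\<And>a x. a \<in> I \<Longrightarrow> x \<in> carrier R \<Longrightarrow> a \<otimes> x \<in> I"
    "\<And>x. x \<in> I \<Longrightarrow> x \<in> carrier R"
    using assms by (auto simp: rng_ideal_def)
qed

text \<open>Together with \<open>coset_image_ideal\<close> this is the correspondence between the
  ideals of R/I and those of R above I, through which ideals of the Leavitt path algebra become
  ideals of the free algebra.\<close>

lemma coset_preimage_ideal:
  assumes I: "rng_ideal I R" and J: "rng_ideal J (R Quot I)"
  shows "rng_ideal {x \<in> carrier R. I +> x \<in> J} R"
    and "I \<subseteq> {x \<in> carrier R. I +> x \<in> J}"
    and "(+>) I ` {x \<in> carrier R. I +> x \<in> J} = J"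
proof -
  interpret Q: nonunital_ring "R Quot I" using I FactRing_nonunital by blast
  have zero: "I +> \<zero> \<in> J" using Q.rng_idealD(1)[OF J] FactRing_zero[OF I] by simp
  note [simp] = FactRing_simps'[OF I, symmetric] FactRing_minus[OF I, symmetric]
  show "rng_ideal {x \<in> carrier R. I +> x \<in> J} R"
    by (rule rng_idealI)
      (use zero Q.rng_idealD(2-)[OF J] in \<open>auto simp: carrier_FactRing simp del: a_coset_add_zero\<close>)
  show "I \<subseteq> {x \<in> carrier R. I +> x \<in> J}"
  proof
    fix x assume "x \<in> I"
    moreover from this have "x \<in> carrier R" using rng_idealD(6)[OF I] by blast
    moreover from calculation have "I +> x = I +> \<zero>"
      using coset_eq_iff[of I x \<zero>] I by (simp add: rng_ideal_def a_minus_def)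
    ultimately show "x \<in> {x \<in> carrier R. I +> x \<in> J}"
      using zero by (auto simp del: a_coset_add_zero)
  qed
  show "(+>) I ` {x \<in> carrier R. I +> x \<in> J} = J"
    using Q.rng_idealD(6)[OF J] by (auto simp: carrier_FactRing)
qed

lemma coset_image_ideal:
  assumes I: "rng_ideal I R" and J: "rng_ideal J R" and "I \<subseteq> J"
  shows "rng_ideal ((+>) I ` J) (R Quot I)"
    and "{x \<in> carrier R. I +> x \<in> (+>) I ` J} = J"
proof -
  interpret Q: nonunital_ring "R Quot I" using I FactRing_nonunital by blast
  note Jd = rng_idealD[OF J]
  show "rng_ideal ((+>) I ` J) (R Quot I)"
    by (rule Q.rng_idealI)
      (use Jd in \<open>auto simp: carrier_FactRing FactRing_zero[OF I] FactRing_simps'[OF I] FactRing_minus[OF I]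
        simp del: a_coset_add_zero\<close>)
  have "x \<in> J" if "x \<in> carrier R" "I +> x = I +> y" "y \<in> J" for x y
  proof -
    have "x \<ominus> y \<in> J"
      using that coset_eq_iff[of I x y] I \<open>I \<subseteq> J\<close> Jd(6) by (auto simp: rng_ideal_def)
    then have "x \<ominus> y \<oplus> y \<in> J" using Jd that by blast
    then show ?thesis using that Jd(6) by (simp add: a_minus_def a_assoc l_neg)
  qed
  then show "{x \<in> carrier R. I +> x \<in> (+>) I ` J} = J"
    using Jd(6) by auto
qed

subsection \<open>Primitive ideals\<close>

definition right_ideal :: "'a set \<Rightarrow> bool" where
  "right_ideal N \<longleftrightarrow> additive_subgroup N R \<and> (\<forall>n\<in>N. \<forall>x\<in>carrier R. n \<otimes> x \<in> N)"

lemma right_idealI: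
  assumes "I \<subseteq> carrier R" "\<zero> \<in> I" "\<And>x y. x \<in> I \<Longrightarrow> y \<in> I \<Longrightarrow> x \<oplus> y \<in> I"
    "\<And>x. x \<in> I \<Longrightarrow> \<ominus> x \<in> I" "\<And>a x. a \<in> I \<Longrightarrow> x \<in> carrier R \<Longrightarrow> a \<otimes> x \<in> I"
  shows "right_ideal I"
  using assms additive_subgroupI'[of I] by (simp add: right_ideal_def)

lemma right_idealD:
  assumes "right_ideal I"
  shows "\<zero> \<in> I" "\<And>x y. x \<in> I \<Longrightarrow> y \<in> I \<Longrightarrow> x \<oplus> y \<in> I" "\<And>x. x \<in> I \<Longrightarrow> \<ominus> x \<in> I"
    "\<And>a x. a \<in> I \<Longrightarrow> x \<in> carrier R \<Longrightarrow> a \<otimes> x \<in> I"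
    "\<And>x. x \<in> I \<Longrightarrow> x \<in> carrier R"
proof -
  interpret abelian_subgroup I R
    using assms abelian_subgroup_if_additive by (simp add: right_ideal_def)
  show "\<zero> \<in> I" "\<And>x y. x \<in> I \<Longrightarrow> y \<in> I \<Longrightarrow> x \<oplus> y \<in> I" "\<And>x. x \<in> I \<Longrightarrow> \<ominus> x \<in> I"
    "\<And>a x. a \<in> I \<Longrightarrow> x \<in> carrier R \<Longrightarrow> a \<otimes> x \<in> I"
    "\<And>x. x \<in> I \<Longrightarrow> x \<in> carrier R"
    using assms by (auto simp: right_ideal_def)
qed

text \<open>The group R/M, made a right module over R/P: \<open>A\<close> is a coset of P and
  \<open>B\<close> one of M, and the union collapses to the single coset M + ba once P is an ideal
  inside the right ideal M. The element type is the one over which \<open>primitive_ideal\<close>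
  quantifies.\<close>

definition coset_module :: "'a set \<Rightarrow> ('a set, 'a set) module" where
  "coset_module M = \<lparr>carrier = carrier (R Quot M), mult = undefined, one = undefined,
     zero = \<zero>\<^bsub>R Quot M\<^esub>, add = (\<oplus>\<^bsub>R Quot M\<^esub>), smult = (\<lambda>A B. \<Union>a\<in>A. \<Union>b\<in>B. M +> (b \<otimes> a))\<rparr>"

context
  fixes M P
  assumes M: "right_ideal M" and P: "rng_ideal P R" and PM: "P \<subseteq> M"
begin

lemma coset_module_simps:
  assumes "x \<in> carrier R" "y \<in> carrier R"
  shows "(M +> x) \<oplus>\<^bsub>coset_module M\<^esub> (M +> y) = M +> (x \<oplus> y)"
    "(P +> x) \<odot>\<^bsub>coset_module M\<^esub> (M +> y) = M +> (y \<otimes> x)"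
    "\<zero>\<^bsub>coset_module M\<^esub> = M +> \<zero>"
    "carrier (coset_module M) = (+>) M ` carrier R"
proof -
  have sub: "additive_subgroup M R" using M by (simp add: right_ideal_def)
  interpret M: abelian_subgroup M R by (rule abelian_subgroup_if_additive) fact
  interpret P: abelian_subgroup P R by (rule ideal_abelian_subgroup) fact
  show "(M +> x) \<oplus>\<^bsub>coset_module M\<^esub> (M +> y) = M +> (x \<oplus> y)"
    using sub assms by (simp add: coset_module_def FactRing_def coset_add)
  show "\<zero>\<^bsub>coset_module M\<^esub> = M +> \<zero>"
    using M.a_subset by (simp add: coset_module_def FactRing_def)
  show "carrier (coset_module M) = (+>) M ` carrier R"
    by (simp add: coset_module_def carrier_FactRing)
  have "M +> (y' \<otimes> x') = M +> (y \<otimes> x)" if "x' \<in> P +> x" "y' \<in> M +> y" for x' y'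
  proof -
    have x': "x' \<in> carrier R" and y': "y' \<in> carrier R"
      using that M.a_elemrcos_carrier P.a_elemrcos_carrier assms by blast+
    have "x' \<oplus> \<ominus> x \<in> P" "y' \<oplus> \<ominus> y \<in> M"
      using that M.a_rcos_module P.a_rcos_module x' y' assms by blast+
    \<comment> \<open>The two halves of well-definedness: the first uses that M is a right ideal,
      the second that P absorbs factors on the left and lies in M.\<close>
    then have "(y' \<oplus> \<ominus> y) \<otimes> x' \<in> M" "y \<otimes> (x' \<oplus> \<ominus> x) \<in> M"
      using right_idealD(4)[OF M _ x'] rng_idealD(4)[OF P _ assms(2)] PM by auto
    then have "(y' \<oplus> \<ominus> y) \<otimes> x' \<oplus> y \<otimes> (x' \<oplus> \<ominus> x) \<in> M"
      by (rule right_idealD(2)[OF M])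
    also have "(y' \<oplus> \<ominus> y) \<otimes> x' \<oplus> y \<otimes> (x' \<oplus> \<ominus> x) = y' \<otimes> x' \<ominus> y \<otimes> x"
      using assms x' y' by (simp add: l_distr r_distr l_minus r_minus a_minus_def a_assoc r_neg1)
    finally show ?thesis
      using coset_eq_iff[OF sub] x' y' assms by simp
  qed
  moreover have "x \<in> P +> x" "y \<in> M +> y" using M.a_rcos_self P.a_rcos_self assms by blast+
  ultimately show "(P +> x) \<odot>\<^bsub>coset_module M\<^esub> (M +> y) = M +> (y \<otimes> x)"
    unfolding coset_module_def module.select_convs by blast
qed

lemma right_module_coset_module: "right_module (R Quot P) (coset_module M)"
proof -
  interpret Q: abelian_group "R Quot M"
    using M FactRing_abelian_group by (simp add: right_ideal_def)
  have "\<exists>y\<in>carrier (R Quot M). y \<oplus>\<^bsub>R Quot M\<^esub> x = \<zero>\<^bsub>R Quot M\<^esub>" if "x \<in> carrier (R Quot M)" for x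
    using that Q.l_neg Q.a_inv_closed by blast
  then have "abelian_group (coset_module M)"
    by (intro abelian_groupI) (simp_all add: coset_module_def Q.a_ac)
  then show ?thesis
    unfolding right_module_def
    by (simp add: coset_module_simps carrier_FactRing FactRing_simps'[OF P] r_distr l_distr m_assoc)
qed

end

text \<open>The module is \<open>R/M\<close> for a right ideal \<open>M\<close> that contains \<open>P\<close> and all \<open>x - \<epsilon>x\<close> and is maximal
  among those avoiding \<open>\<epsilon>\<close>: every larger right ideal contains \<open>\<epsilon>\<close>, hence all \<open>\<epsilon>x\<close>.\<close>

lemma primitive_idealI:
  assumes P: "rng_ideal P R" and \<epsilon>: "\<epsilon> \<in> carrier R" "\<epsilon> \<notin> P" "\<epsilon> \<otimes> \<epsilon> \<ominus> \<epsilon> \<in> P"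
    and least: "\<And>A. rng_ideal A R \<Longrightarrow> P \<subseteq> A \<Longrightarrow> A \<noteq> P \<Longrightarrow> \<epsilon> \<in> A"
  shows "primitive_ideal P R"
proof -
  note Pd = rng_idealD[OF P]
  define \<C> where "\<C> = {N. right_ideal N \<and> P \<subseteq> N \<and> (\<forall>x\<in>carrier R. x \<ominus> \<epsilon> \<otimes> x \<in> N) \<and> \<epsilon> \<notin> N}"
  have cancel: "a \<in> N" if "right_ideal N" "b \<ominus> a \<in> N" "b \<in> N" "a \<in> carrier R" for a b N
  proof -
    note Nd = right_idealD[OF that(1)]
    have "\<ominus> (b \<ominus> a) \<oplus> b \<in> N" using that Nd by blast
    moreover have "\<ominus> (b \<ominus> a) \<oplus> b = a"
      using that Nd(5) by (simp add: a_minus_def minus_add a_assoc a_lcomm[of "\<ominus> b" a b] l_neg)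
    ultimately show ?thesis by simp
  qed
  have cancel': "a \<in> N" if "right_ideal N" "a \<ominus> b \<in> N" "b \<in> N" "a \<in> carrier R" for a b N
  proof -
    note Nd = right_idealD[OF that(1)]
    have "(a \<ominus> b) \<oplus> b \<in> N" using that Nd by blast
    moreover have "(a \<ominus> b) \<oplus> b = a"
      using that Nd(5) by (simp add: a_minus_def a_assoc l_neg)
    ultimately show ?thesis by simp
  qed
  have PR: "right_ideal P" by (rule right_idealI) (use Pd in auto)
  \<comment> \<open>The family is not empty: modulo P this is the right annihilator of \<epsilon>.
    It contains all x - \<epsilon>x and avoids \<epsilon> because \<epsilon> is idempotent modulo P
    and not in P.\<close>
  have "{x \<in> carrier R. \<epsilon> \<otimes> x \<in> P} \<in> \<C>"
  proof -
    have "\<epsilon> \<otimes> (x \<ominus> \<epsilon> \<otimes> x) \<in> P" if "x \<in> carrier R" for x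
    proof -
      have "\<ominus> ((\<epsilon> \<otimes> \<epsilon> \<ominus> \<epsilon>) \<otimes> x) \<in> P"
        using Pd(3)[OF Pd(5)[OF \<epsilon>(3) that]] .
      also have "\<ominus> ((\<epsilon> \<otimes> \<epsilon> \<ominus> \<epsilon>) \<otimes> x) = \<epsilon> \<otimes> (x \<ominus> \<epsilon> \<otimes> x)"
        using that \<epsilon> by (simp add: a_minus_def l_distr r_distr l_minus r_minus m_assoc minus_add a_comm)
      finally show ?thesis .
    qed
    moreover have "\<epsilon> \<otimes> \<epsilon> \<notin> P" using cancel[OF PR] \<epsilon> by blast
    moreover have "right_ideal {x \<in> carrier R. \<epsilon> \<otimes> x \<in> P}"
      by (rule right_idealI) (use Pd \<epsilon> in \<open>auto simp: r_distr r_minus m_assoc[symmetric]\<close>)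
    ultimately show ?thesis using \<epsilon> Pd by (auto simp: \<C>_def)
  qed
  moreover have "\<Union>\<D> \<in> \<C>" if "\<D> \<noteq> {}" "subset.chain \<C> \<D>" for \<D>
  proof -
    have sub: "N \<in> \<C>" if "N \<in> \<D>" for N using \<open>subset.chain \<C> \<D>\<close> that by (auto simp: subset.chain_def)
    have sub': "right_ideal N" if "N \<in> \<D>" for N using sub[OF that] by (simp add: \<C>_def)
    have chain: "N \<subseteq> N' \<or> N' \<subseteq> N" if "N \<in> \<D>" "N' \<in> \<D>" for N N'
      using \<open>subset.chain \<C> \<D>\<close> that by (auto simp: subset.chain_def)
    have "right_ideal (\<Union>\<D>)"
    proof (rule right_idealI)
      show "\<Union>\<D> \<subseteq> carrier R" using right_idealD(5)[OF sub'] by blast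
      show "\<zero> \<in> \<Union>\<D>" using \<open>\<D> \<noteq> {}\<close> right_idealD(1)[OF sub'] by blast
      show "x \<oplus> y \<in> \<Union>\<D>" if xy: "x \<in> \<Union>\<D>" "y \<in> \<Union>\<D>" for x y
      proof -
        obtain N where "N \<in> \<D>" "x \<in> N" "y \<in> N" using xy chain by blast
        then show ?thesis using right_idealD(2)[OF sub'] by blast
      qed
      show "\<ominus> x \<in> \<Union>\<D>" if "x \<in> \<Union>\<D>" for x
        using that right_idealD(3)[OF sub'] by blast
      show "a \<otimes> x \<in> \<Union>\<D>" if "a \<in> \<Union>\<D>" "x \<in> carrier R" for a x
        using that right_idealD(4)[OF sub'] by blast
    qed
    then show ?thesis using \<open>\<D> \<noteq> {}\<close> sub unfolding \<C>_def by blast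
  qed
  ultimately obtain M where "M \<in> \<C>" and max: "\<And>N. N \<in> \<C> \<Longrightarrow> M \<subseteq> N \<Longrightarrow> N = M"
    using subset_Zorn_nonempty[of \<C>] by blast
  then have M: "right_ideal M" "P \<subseteq> M" "\<And>x. x \<in> carrier R \<Longrightarrow> x \<ominus> \<epsilon> \<otimes> x \<in> M" "\<epsilon> \<notin> M"
    by (auto simp: \<C>_def)
  note Md = right_idealD[OF M(1)]
  note simps = coset_module_simps[OF M(1) P M(2)]
  \<comment> \<open>Otherwise \<epsilon> = (\<epsilon> - \<epsilon>\<epsilon>) +
    \<epsilon>\<epsilon> would lie in M. So \<epsilon> acts nontrivially on its own coset, from
    which both the nontriviality of the module and its faithfulness follow.\<close>
  have \<epsilon>\<epsilon>: "\<epsilon> \<otimes> \<epsilon> \<notin> M" using cancel'[OF M(1)] M \<epsilon> by blast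
  have subM: "additive_subgroup M R" using M by (simp add: right_ideal_def)
  have zero_iff: "M +> x = M +> \<zero> \<longleftrightarrow> x \<in> M" if "x \<in> carrier R" for x
    using coset_eq_iff[OF subM that zero_closed] that by (simp add: a_minus_def)
  let ?M = "coset_module M"
  have mod: "right_module (R Quot P) ?M"
    using right_module_coset_module M P by blast
  have "simple_right_module (R Quot P) ?M"
    unfolding simple_right_module_def
  proof (intro conjI allI impI mod)
    have "(P +> \<epsilon>) \<odot>\<^bsub>?M\<^esub> (M +> \<epsilon>) \<noteq> \<zero>\<^bsub>?M\<^esub>"
      using \<epsilon>\<epsilon> \<epsilon> zero_iff simps by simp
    then show "\<exists>a\<in>carrier (R Quot P). \<exists>m\<in>carrier ?M. a \<odot>\<^bsub>?M\<^esub> m \<noteq> \<zero>\<^bsub>?M\<^esub>"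
      using \<epsilon> simps(4)[OF \<epsilon>(1) \<epsilon>(1)] unfolding carrier_FactRing by blast
  next
    fix N assume N: "additive_subgroup N ?M" and "\<forall>a\<in>carrier (R Quot P). \<forall>n\<in>N. a \<odot>\<^bsub>?M\<^esub> n \<in> N"
    then have act: "\<And>x n. x \<in> carrier R \<Longrightarrow> n \<in> N \<Longrightarrow> (P +> x) \<odot>\<^bsub>?M\<^esub> n \<in> N"
      unfolding carrier_FactRing by blast
    interpret MG: abelian_group ?M using mod by (simp add: right_module_def)
    interpret N: additive_subgroup N ?M by fact
    define N' where "N' = {x \<in> carrier R. M +> x \<in> N}"
    have N: "N = (+>) M ` N'"
      using N.a_subset simps(4)[OF \<epsilon>(1) \<epsilon>(1)] by (auto simp: N'_def)
    have zN: "M +> \<zero> \<in> N" using N.zero_closed simps(3)[OF \<epsilon>(1) \<epsilon>(1)] by simp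
    have "M +> x \<in> N" if "x \<in> M" for x using zero_iff[OF Md(5)[OF that]] that zN by metis
    then have "M \<subseteq> N'" using Md(5) by (auto simp: N'_def)
    have N': "right_ideal N'"
    proof (rule right_idealI)
      show "N' \<subseteq> carrier R" "\<zero> \<in> N'" using zN by (auto simp: N'_def simp del: a_coset_add_zero)
      show add: "x \<oplus> y \<in> N'" if "x \<in> N'" "y \<in> N'" for x y
        using that N.a_closed[of "M +> x" "M +> y"] simps(1)[of x y] by (simp add: N'_def)
      show "a \<otimes> x \<in> N'" if "a \<in> N'" "x \<in> carrier R" for a x
        using that act[of x "M +> a"] simps(2) by (auto simp: N'_def)
      show "\<ominus> x \<in> N'" if x: "x \<in> N'" for x
      proof -
        have xc: "x \<in> carrier R" "M +> x \<in> N" using x by (auto simp: N'_def)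
        interpret N: abelian_subgroup N ?M
          using abelian_subgroupI3 N.is_additive_subgroup MG.abelian_group_axioms by blast
        have "\<ominus>\<^bsub>?M\<^esub> (M +> x) = M +> (\<ominus> x)"
          by (rule MG.minus_equality) (use xc in \<open>auto simp: simps l_neg simp del: a_coset_add_zero\<close>)
        moreover have "\<ominus>\<^bsub>?M\<^esub> (M +> x) \<in> N" using xc N.a_inv_closed by blast
        ultimately show ?thesis using xc by (simp add: N'_def)
      qed
    qed
    show "N = {\<zero>\<^bsub>?M\<^esub>} \<or> N = carrier ?M"
    proof (cases "\<epsilon> \<in> N'")
      case True
      have "N' = carrier R"
      proof (intro equalityI subsetI)
        fix x assume x: "x \<in> carrier R"
        have "\<epsilon> \<otimes> x \<in> N'" using right_idealD(4)[OF N' True x] .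
        then show "x \<in> N'" using cancel'[OF N'] M(3)[OF x] \<open>M \<subseteq> N'\<close> x by blast
      qed (simp add: N'_def)
      then show ?thesis using N simps(4)[OF \<epsilon>(1) \<epsilon>(1)] by simp
    next
      case False
      then have "N' = M"
        using max[of N'] N' M \<open>M \<subseteq> N'\<close> by (auto simp: \<C>_def)
      moreover have "M +> x = M +> \<zero>" if "x \<in> M" for x
        using zero_iff[OF Md(5)[OF that]] that by metis
      ultimately have "N = {M +> \<zero>}"
        using N Md(1) by (metis (no_types, lifting) image_constant image_cong)
      then show ?thesis using simps(3)[OF \<epsilon>(1) \<epsilon>(1)] by simp
    qed
  qed
  moreover have "faithful_right_module (R Quot P) ?M"
    unfolding faithful_right_module_def
  proof (intro conjI ballI impI mod)
    \<comment> \<open>A/P is the annihilator of the module. If A were larger than P, it would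
      contain \<epsilon> by \<open>least\<close>, against \<epsilon>\<epsilon> \<notin> M.\<close>
    define A where "A = {r \<in> carrier R. \<forall>s\<in>carrier R. s \<otimes> r \<in> M}"
    have "rng_ideal A R"
      by (rule rng_idealI) (use Md in \<open>auto simp: A_def r_distr r_minus m_assoc[symmetric]\<close>)
    moreover have "P \<subseteq> A" using Pd M by (auto simp: A_def)
    moreover have "\<epsilon> \<notin> A" using \<epsilon>\<epsilon> \<epsilon> by (auto simp: A_def)
    ultimately have "A = P" using least by blast
    fix a assume "a \<in> carrier (R Quot P)" and z: "\<forall>m\<in>carrier ?M. a \<odot>\<^bsub>?M\<^esub> m = \<zero>\<^bsub>?M\<^esub>"
    then obtain r where r: "r \<in> carrier R" "a = P +> r" by (auto simp: carrier_FactRing)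
    have "s \<otimes> r \<in> M" if "s \<in> carrier R" for s
      using z r that simps[OF r(1) that] zero_iff[of "s \<otimes> r"] by auto
    then have "r \<in> P" using r \<open>A = P\<close> by (auto simp: A_def)
    then have "P +> r = P +> \<zero>"
      using coset_eq_iff[of P r \<zero>] P r by (simp add: rng_ideal_def a_minus_def)
    then show "a = \<zero>\<^bsub>R Quot P\<^esub>" using r(2) FactRing_zero[OF P] by metis
  qed
  ultimately show ?thesis using P by (auto simp: primitive_ideal_def)
qed

end

section \<open>The free algebra and its ideals\<close>

text \<open>The free algebra with identity, in which the empty word is allowed. It supplies
  multipliers such as scalars, 1 and possibly empty products of edges; ideals containing the
  relations turn out to be stable under them (\<open>I_mult_unital\<close>).\<close>

definition unital_free :: "'g set \<Rightarrow> ('g free_word \<Rightarrow>\<^sub>0 'k::field) set" where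
  "unital_free X = {p. \<forall>w\<in>Poly_Mapping.keys p. set (letters w) \<subseteq> X}"

lemma carrier_free_rng:
  "carrier (free_rng X) = {p. \<forall>w\<in>Poly_Mapping.keys p. letters w \<noteq> [] \<and> set (letters w) \<subseteq> X}"
  by (simp add: free_rng_def)

lemma free_rng_simps [simp]:
  "\<zero>\<^bsub>free_rng X\<^esub> = 0" "x \<oplus>\<^bsub>free_rng X\<^esub> y = x + y" "x \<otimes>\<^bsub>free_rng X\<^esub> y = x * y"
  by (simp_all add: free_rng_def)

lemma letters_add [simp]: "letters (u + v) = letters u @ letters v"
  by (simp add: plus_free_word_def)

lemma letters_zero [simp]: "letters 0 = []"
  by (simp add: zero_free_word_def)

lemma unital_free_add: "p \<in> unital_free X \<Longrightarrow> q \<in> unital_free X \<Longrightarrow> p + q \<in> unital_free X"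
  using Poly_Mapping.keys_add[of p q] by (auto simp: unital_free_def)

lemma unital_free_uminus: "p \<in> unital_free X \<Longrightarrow> - p \<in> unital_free X"
  by (auto simp: unital_free_def in_keys_iff)

lemma unital_free_minus: "p \<in> unital_free X \<Longrightarrow> q \<in> unital_free X \<Longrightarrow> p - q \<in> unital_free X"
  using unital_free_add[of p X "- q"] unital_free_uminus[of q X] by simp

lemma unital_free_mult: "p \<in> unital_free X \<Longrightarrow> q \<in> unital_free X \<Longrightarrow> p * q \<in> unital_free X"
  using Poly_Mapping.keys_mult[of p q] by (fastforce simp: unital_free_def)

lemma unital_free_0: "0 \<in> unital_free X"
  by (simp add: unital_free_def)

lemma unital_free_sum: "(\<And>i. i \<in> A \<Longrightarrow> f i \<in> unital_free X) \<Longrightarrow> sum f A \<in> unital_free X"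
  by (induct A rule: infinite_finite_induct) (auto intro: unital_free_add unital_free_0)

lemma unital_free_monom: "set w \<subseteq> X \<Longrightarrow> monom_word w \<in> unital_free X"
  by (simp add: unital_free_def monom_word_def)

lemma unital_free_single_0: "Poly_Mapping.single 0 c \<in> unital_free X"
  by (simp add: unital_free_def)

lemma unital_free_scale: "p \<in> unital_free X \<Longrightarrow> scale c p \<in> unital_free X"
  by (simp add: scale_def unital_free_mult unital_free_single_0)

lemmas unital_free_closed = unital_free_add unital_free_uminus unital_free_minus unital_free_mult
  unital_free_0 unital_free_sum unital_free_monom unital_free_scale

lemma carrier_subset_unital: "p \<in> carrier (free_rng X) \<Longrightarrow> p \<in> unital_free X"
  by (simp add: carrier_free_rng unital_free_def)

lemma carrier_add: "p \<in> carrier (free_rng X) \<Longrightarrow> q \<in> carrier (free_rng X) \<Longrightarrow> p + q \<in> carrier (free_rng X)"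
  using Poly_Mapping.keys_add[of p q] by (auto simp: carrier_free_rng)

lemma carrier_uminus: "p \<in> carrier (free_rng X) \<Longrightarrow> - p \<in> carrier (free_rng X)"
  by (auto simp: carrier_free_rng in_keys_iff)

lemma carrier_minus: "p \<in> carrier (free_rng X) \<Longrightarrow> q \<in> carrier (free_rng X) \<Longrightarrow> p - q \<in> carrier (free_rng X)"
  using carrier_add[of p X "- q"] carrier_uminus[of q X] by simp

lemma carrier_mult_left:
  "p \<in> unital_free X \<Longrightarrow> q \<in> carrier (free_rng X) \<Longrightarrow> p * q \<in> carrier (free_rng X)"
  using Poly_Mapping.keys_mult[of p q] by (fastforce simp: unital_free_def carrier_free_rng)

lemma carrier_mult_right:
  "q \<in> unital_free X \<Longrightarrow> p \<in> carrier (free_rng X) \<Longrightarrow> p * q \<in> carrier (free_rng X)"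
  using Poly_Mapping.keys_mult[of p q] by (fastforce simp: unital_free_def carrier_free_rng)

lemma carrier_0: "0 \<in> carrier (free_rng X)"
  by (simp add: carrier_free_rng)

lemma carrier_sum: "(\<And>i. i \<in> A \<Longrightarrow> f i \<in> carrier (free_rng X)) \<Longrightarrow> sum f A \<in> carrier (free_rng X)"
  by (induct A rule: infinite_finite_induct) (auto intro: carrier_add carrier_0)

lemma carrier_monom: "set w \<subseteq> X \<Longrightarrow> w \<noteq> [] \<Longrightarrow> monom_word w \<in> carrier (free_rng X)"
  by (simp add: carrier_free_rng monom_word_def)

lemma carrier_scale: "p \<in> carrier (free_rng X) \<Longrightarrow> scale c p \<in> carrier (free_rng X)"
  by (simp add: scale_def carrier_mult_left unital_free_single_0)

lemmas carrier_closed = carrier_add carrier_uminus carrier_minus carrier_0 carrier_sum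
  carrier_monom carrier_scale

lemma free_rng_nonunital: "nonunital_ring (free_rng X)"
proof -
  have "abelian_group (free_rng X)"
  proof (rule abelian_groupI)
    fix x assume "x \<in> carrier (free_rng X)"
    then show "\<exists>y\<in>carrier (free_rng X). y \<oplus>\<^bsub>free_rng X\<^esub> x = \<zero>\<^bsub>free_rng X\<^esub>"
      by (intro bexI[of _ "- x"]) (auto intro: carrier_uminus)
  qed (auto intro: carrier_closed simp: add_ac)
  then show ?thesis
    by (intro nonunital_ring.intro nonunital_ring_axioms.intro)
      (auto simp: algebra_simps intro: carrier_mult_left carrier_subset_unital)
qed

lemma free_rng_a_inv:
  assumes "x \<in> carrier (free_rng X)"
  shows "\<ominus>\<^bsub>free_rng X\<^esub> x = - x"
proof -
  interpret nonunital_ring "free_rng X" by (rule free_rng_nonunital)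
  show ?thesis
    using minus_equality[of "- x" x] assms carrier_uminus[of x X] by simp
qed

lemma free_rng_ideal_iff:
  "rng_ideal I (free_rng X) \<longleftrightarrow> I \<subseteq> carrier (free_rng X) \<and> 0 \<in> I \<and>
     (\<forall>x\<in>I. \<forall>y\<in>I. x + y \<in> I) \<and> (\<forall>x\<in>I. - x \<in> I) \<and>
     (\<forall>a\<in>I. \<forall>x\<in>carrier (free_rng X). x * a \<in> I \<and> a * x \<in> I)"
proof -
  interpret nonunital_ring "free_rng X" by (rule free_rng_nonunital)
  show ?thesis
  proof
    assume I: "rng_ideal I (free_rng X)"
    have neg: "- x \<in> I" if "x \<in> I" for x
      using rng_idealD(3)[OF I that] free_rng_a_inv[OF rng_idealD(6)[OF I that]] by simp
    show "I \<subseteq> carrier (free_rng X) \<and> 0 \<in> I \<and>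
     (\<forall>x\<in>I. \<forall>y\<in>I. x + y \<in> I) \<and> (\<forall>x\<in>I. - x \<in> I) \<and>
     (\<forall>a\<in>I. \<forall>x\<in>carrier (free_rng X). x * a \<in> I \<and> a * x \<in> I)"
      using rng_idealD(1,2,4,5,6)[OF I] neg by auto
  next
    assume "I \<subseteq> carrier (free_rng X) \<and> 0 \<in> I \<and>
     (\<forall>x\<in>I. \<forall>y\<in>I. x + y \<in> I) \<and> (\<forall>x\<in>I. - x \<in> I) \<and>
     (\<forall>a\<in>I. \<forall>x\<in>carrier (free_rng X). x * a \<in> I \<and> a * x \<in> I)"
    then show "rng_ideal I (free_rng X)"
      by (intro rng_idealI) (auto simp: free_rng_a_inv)
  qed
qed

lemma free_rng_ideal_Inter:
  assumes "\<A> \<noteq> {}" "\<And>A. A \<in> \<A> \<Longrightarrow> rng_ideal A (free_rng X)"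
  shows "rng_ideal (\<Inter>\<A>) (free_rng X)"
proof -
  have "A \<subseteq> carrier (free_rng X)" "0 \<in> A" "x \<in> A \<Longrightarrow> y \<in> A \<Longrightarrow> x + y \<in> A" "x \<in> A \<Longrightarrow> - x \<in> A"
    "x \<in> A \<Longrightarrow> z \<in> carrier (free_rng X) \<Longrightarrow> z * x \<in> A \<and> x * z \<in> A" if "A \<in> \<A>" for A x y z
    using assms(2)[OF that] by (auto simp: free_rng_ideal_iff)
  note A = this
  have "\<Inter>\<A> \<subseteq> carrier (free_rng X)" using A(1) assms(1) by blast
  moreover have "0 \<in> \<Inter>\<A>" using A(2) by simp
  moreover have "\<forall>x\<in>\<Inter>\<A>. \<forall>y\<in>\<Inter>\<A>. x + y \<in> \<Inter>\<A>" using A(3) by simp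
  moreover have "\<forall>x\<in>\<Inter>\<A>. - x \<in> \<Inter>\<A>" using A(4) by simp
  moreover have "\<forall>a\<in>\<Inter>\<A>. \<forall>x\<in>carrier (free_rng X). x * a \<in> \<Inter>\<A> \<and> a * x \<in> \<Inter>\<A>"
    using A(5) by simp
  ultimately show ?thesis unfolding free_rng_ideal_iff by blast
qed

lemma scale_commute: "Poly_Mapping.single 0 c * p = p * Poly_Mapping.single 0 (c::'k::field)"
proof -
  have p: "p = (\<Sum>w\<in>Poly_Mapping.keys p. Poly_Mapping.single w (Poly_Mapping.lookup p w))"
    by (rule poly_mapping_eqI) (simp add: lookup_sum lookup_single when_def in_keys_iff)
  show ?thesis
    by (subst (1 2) p) (simp add: sum_distrib_left sum_distrib_right mult_single mult.commute)
qed

lemma scale_scale: "scale c (scale d p) = scale (c * d) p"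
  by (simp add: scale_def mult_single flip: mult.assoc)

lemma scale_mult_left: "scale c p * q = scale c (p * q)"
  by (simp add: scale_def mult.assoc)

lemma scale_mult_right: "p * scale c q = scale c (p * q)"
  by (simp add: scale_def mult.assoc scale_commute[symmetric] flip: mult.assoc)

lemma scale_add: "scale c (p + q) = scale c p + scale c q"
  by (simp add: scale_def distrib_left)

lemma scale_diff: "scale c (p - q) = scale c p - scale c q"
  by (simp add: scale_def right_diff_distrib)

lemma scale_uminus: "scale c (- p) = - scale c p"
  by (simp add: scale_def)

lemma scale_sum: "scale c (sum f A) = (\<Sum>i\<in>A. scale c (f i))"
  by (simp add: scale_def sum_distrib_left)

lemma scale_0 [simp]: "scale c 0 = 0" "scale 0 p = 0"
  by (simp_all add: scale_def)

lemma scale_1 [simp]: "scale 1 p = p"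
  by (simp add: scale_def)

lemma scale_add_left: "scale (c + d) p = scale c p + scale d p"
  by (simp add: scale_def single_add distrib_right)

lemma monom_word_mult: "monom_word u * monom_word v = monom_word (u @ v)"
  by (simp add: monom_word_def mult_single plus_free_word_def)

lemma monom_word_Nil: "monom_word [] = 1"
  by (simp add: monom_word_def zero_free_word_def[symmetric])

lemma single_conv_scale: "Poly_Mapping.single w c = scale c (monom_word (letters w))"
  by (simp add: scale_def monom_word_def mult_single)

lemma unital_free_expand:
  "p = (\<Sum>w\<in>Poly_Mapping.keys p. scale (Poly_Mapping.lookup p w) (monom_word (letters w)))"
proof -
  have "p = (\<Sum>w\<in>Poly_Mapping.keys p. Poly_Mapping.single w (Poly_Mapping.lookup p w))"
    by (rule poly_mapping_eqI) (simp add: lookup_sum lookup_single when_def in_keys_iff)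
  then show ?thesis by (simp add: single_conv_scale)
qed

lemma unital_free_induct [consumes 1, case_names zero add scale]:
  assumes "p \<in> unital_free X" "P 0" "\<And>p q. P p \<Longrightarrow> P q \<Longrightarrow> P (p + q)"
    and "\<And>c w. set w \<subseteq> X \<Longrightarrow> P (scale c (monom_word w))"
  shows "P p"
proof -
  have "P (\<Sum>w\<in>A. scale (f w) (monom_word (letters w)))"
    if "finite A" "\<And>w. w \<in> A \<Longrightarrow> set (letters w) \<subseteq> X" for A and f :: "'a free_word \<Rightarrow> 'b"
    using that by (induct A) (auto intro: assms)
  then show ?thesis
    using assms(1) by (subst unital_free_expand) (auto simp: unital_free_def)
qed

lemma carrier_induct [consumes 1, case_names zero add scale]:
  assumes "p \<in> carrier (free_rng X)" "P 0" "\<And>p q. P p \<Longrightarrow> P q \<Longrightarrow> P (p + q)"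
    and "\<And>c w. set w \<subseteq> X \<Longrightarrow> w \<noteq> [] \<Longrightarrow> P (scale c (monom_word w))"
  shows "P p"
proof -
  have "P (\<Sum>w\<in>A. scale (f w) (monom_word (letters w)))"
    if "finite A" "\<And>w. w \<in> A \<Longrightarrow> letters w \<noteq> [] \<and> set (letters w) \<subseteq> X" for A and f :: "'a free_word \<Rightarrow> 'b"
    using that by (induct A) (auto intro: assms)
  then show ?thesis
    using assms(1) by (subst unital_free_expand) (auto simp: carrier_free_rng)
qed

section \<open>Ideals of Leavitt path algebras\<close>

lemma lpa_gens_simps [simp]:
  "Vertex v \<in> lpa_gens E \<longleftrightarrow> v \<in> verts E"
  "Edge e \<in> lpa_gens E \<longleftrightarrow> e \<in> arcs E"
  "Ghost e \<in> lpa_gens E \<longleftrightarrow> e \<in> arcs E"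
  by (auto simp: lpa_gens_def)

abbreviation lpa_carrier :: "('v, 'e) pre_digraph \<Rightarrow> ('v, 'e, 'k::field) lpa_free set" where
  "lpa_carrier E \<equiv> carrier (free_rng (lpa_gens E))"

abbreviation lpa_unital :: "('v, 'e) pre_digraph \<Rightarrow> ('v, 'e, 'k::field) lpa_free set" where
  "lpa_unital E \<equiv> unital_free (lpa_gens E)"

lemma relators_carrier:
  assumes "wf_digraph E" "p \<in> lpa_relators E"
  shows "p \<in> lpa_carrier E"
proof -
  interpret wf_digraph E by fact
  show ?thesis
    using assms(2) unfolding lpa_relators_def
    by (auto intro!: carrier_closed simp: regular_vertex_def)
qed

lemma kernel_least:
  assumes "rng_ideal J (free_rng (lpa_gens E))" "\<And>c p. p \<in> lpa_relators E \<Longrightarrow> scale c p \<in> J"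
  shows "lpa_kernel E \<subseteq> J"
  using assms by (auto simp: lpa_kernel_def)

lemma kernel_relator: "p \<in> lpa_relators E \<Longrightarrow> scale c p \<in> lpa_kernel E"
  by (auto simp: lpa_kernel_def)

lemma kernel_ideal:
  fixes E :: "('v, 'e) pre_digraph"
  assumes "wf_digraph E"
  shows "rng_ideal (lpa_kernel E :: ('v, 'e, 'k::field) lpa_free set) (free_rng (lpa_gens E))"
proof -
  have "rng_ideal (lpa_carrier E :: ('v, 'e, 'k) lpa_free set) (free_rng (lpa_gens E))"
    by (auto simp: free_rng_ideal_iff intro: carrier_closed carrier_mult_left carrier_subset_unital)
  moreover have "\<forall>c. \<forall>p\<in>lpa_relators E. scale c p \<in> (lpa_carrier E :: ('v, 'e, 'k) lpa_free set)"
    using relators_carrier[OF assms] by (auto intro: carrier_scale)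
  ultimately show ?thesis
    unfolding lpa_kernel_def by (intro free_rng_ideal_Inter) auto
qed

text \<open>Minimality: the members of the kernel all of whose scalar multiples stay in it form an
  ideal that still contains every multiple of every relator.\<close>

lemma kernel_scale:
  fixes p :: "('v, 'e, 'k::field) lpa_free"
  assumes "wf_digraph E" "p \<in> lpa_kernel E"
  shows "scale c p \<in> lpa_kernel E"
proof -
  let ?K = "lpa_kernel E :: ('v, 'e, 'k) lpa_free set"
  have K: "rng_ideal ?K (free_rng (lpa_gens E))"
    by (rule kernel_ideal) fact
  have ksub: "?K \<subseteq> lpa_carrier E" and k0: "0 \<in> ?K"
    and kadd: "\<And>x y. x \<in> ?K \<Longrightarrow> y \<in> ?K \<Longrightarrow> x + y \<in> ?K"
    and kneg: "\<And>x. x \<in> ?K \<Longrightarrow> - x \<in> ?K"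
    using K[unfolded free_rng_ideal_iff] by simp_all
  have mult: "scale c (x * a) \<in> ?K \<and> scale c (a * x) \<in> ?K"
    if "\<forall>c. scale c a \<in> ?K" "x \<in> lpa_carrier E" for a x and c :: 'k
  proof -
    have "x * scale c a \<in> ?K" "scale c a * x \<in> ?K"
      using K that by (simp_all add: free_rng_ideal_iff)
    then show ?thesis by (simp only: scale_mult_left scale_mult_right)
  qed
  have "?K \<subseteq> {p \<in> ?K. \<forall>c. scale c p \<in> ?K}"
  proof (rule kernel_least)
    show "rng_ideal {p \<in> ?K. \<forall>c. scale c p \<in> ?K} (free_rng (lpa_gens E))"
      unfolding free_rng_ideal_iff
    proof (intro conjI ballI)
      fix a :: "('v, 'e, 'k) lpa_free" and x :: "('v, 'e, 'k) lpa_free"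
      assume "a \<in> {p \<in> ?K. \<forall>c. scale c p \<in> ?K}" "x \<in> lpa_carrier E"
      then show "x * a \<in> {p \<in> ?K. \<forall>c. scale c p \<in> ?K}"
        "a * x \<in> {p \<in> ?K. \<forall>c. scale c p \<in> ?K}"
        using mult[of a x] mult[of a x 1] by simp_all
    next
      show "{p \<in> ?K. \<forall>c. scale c p \<in> ?K} \<subseteq> lpa_carrier E"
        using ksub by blast
      show "0 \<in> {p \<in> ?K. \<forall>c. scale c p \<in> ?K}" using k0 by simp
      fix x y assume xy: "x \<in> {p \<in> ?K. \<forall>c. scale c p \<in> ?K}"
      show "- x \<in> {p \<in> ?K. \<forall>c. scale c p \<in> ?K}" using xy by (simp add: kneg scale_uminus)
      assume "y \<in> {p \<in> ?K. \<forall>c. scale c p \<in> ?K}"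
      then show "x + y \<in> {p \<in> ?K. \<forall>c. scale c p \<in> ?K}" using xy by (simp add: kadd scale_add)
    qed
    show "scale c p \<in> {p \<in> ?K. \<forall>c. scale c p \<in> ?K}" if "p \<in> lpa_relators E" for c p
      using that by (simp add: kernel_relator scale_scale)
  qed
  then show ?thesis using assms by blast
qed

locale lpa_ideal =
  fixes E :: "('v, 'e) pre_digraph" and I :: "('v, 'e, 'k::field) lpa_free set"
  assumes wf: "wf_digraph E"
    and ideal: "rng_ideal I (free_rng (lpa_gens E))"
    and kernel: "lpa_kernel E \<subseteq> I"

sublocale lpa_ideal \<subseteq> wf_digraph E by (rule wf)

lemma lpa_ideal_kernel: "wf_digraph E \<Longrightarrow> lpa_ideal E (lpa_kernel E)"
  by (simp add: lpa_ideal_def kernel_ideal)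

context lpa_ideal
begin

lemma I_closed:
  "0 \<in> I" "x \<in> I \<Longrightarrow> y \<in> I \<Longrightarrow> x + y \<in> I" "x \<in> I \<Longrightarrow> - x \<in> I" "x \<in> I \<Longrightarrow> x \<in> lpa_carrier E"
  using ideal by (auto simp: free_rng_ideal_iff)

lemma I_diff: "x \<in> I \<Longrightarrow> y \<in> I \<Longrightarrow> x - y \<in> I"
  using I_closed(2)[of x "- y"] I_closed(3)[of y] by simp

lemma I_mult: "x \<in> lpa_carrier E \<Longrightarrow> y \<in> I \<Longrightarrow> x * y \<in> I" "x \<in> lpa_carrier E \<Longrightarrow> y \<in> I \<Longrightarrow> y * x \<in> I"
  using ideal by (auto simp: free_rng_ideal_iff)

lemma I_sum: "(\<And>i. i \<in> A \<Longrightarrow> f i \<in> I) \<Longrightarrow> sum f A \<in> I"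
  by (induct A rule: infinite_finite_induct) (auto intro: I_closed)

definition cong (infix "\<approx>" 50) where "x \<approx> y \<longleftrightarrow> x - y \<in> I"

lemma cong_refl [simp]: "x \<approx> x"
  by (simp add: cong_def I_closed)

lemma cong_sym: "x \<approx> y \<Longrightarrow> y \<approx> x"
  using I_closed(3)[of "x - y"] by (simp add: cong_def)

lemma cong_trans [trans]: "x \<approx> y \<Longrightarrow> y \<approx> z \<Longrightarrow> x \<approx> z"
  using I_closed(2)[of "x - y" "y - z"] by (simp add: cong_def)

lemma cong_add: "x \<approx> y \<Longrightarrow> x' \<approx> y' \<Longrightarrow> x + x' \<approx> y + y'"
  using I_closed(2)[of "x - y" "x' - y'"] by (simp add: cong_def algebra_simps)

lemma cong_diff: "x \<approx> y \<Longrightarrow> x' \<approx> y' \<Longrightarrow> x - x' \<approx> y - y'"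
  using I_diff[of "x - y" "x' - y'"] by (simp add: cong_def algebra_simps)

lemma cong_sum: "(\<And>i. i \<in> A \<Longrightarrow> f i \<approx> g i) \<Longrightarrow> sum f A \<approx> sum g A"
  using I_sum[of A "\<lambda>i. f i - g i"] by (simp add: cong_def sum_subtractf)

lemma cong_0_iff: "x \<approx> 0 \<longleftrightarrow> x \<in> I"
  by (simp add: cong_def)

lemma cong_mem: "x \<approx> y \<Longrightarrow> y \<in> I \<Longrightarrow> x \<in> I"
  using I_closed(2)[of "x - y" y] by (simp add: cong_def)

lemma cong_mem_iff: "x \<approx> y \<Longrightarrow> x \<in> I \<longleftrightarrow> y \<in> I"
  using cong_mem cong_sym by blast

lemma relator_in: "p \<in> lpa_relators E \<Longrightarrow> p \<in> I"
  using kernel_relator[of p E 1] kernel by auto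

end

section \<open>Words and their end vertices\<close>

fun gen_source :: "('v, 'e) pre_digraph \<Rightarrow> ('v, 'e) lpa_gen \<Rightarrow> 'v" where
  "gen_source E (Vertex v) = v"
| "gen_source E (Edge e) = tail E e"
| "gen_source E (Ghost e) = head E e"

fun gen_target :: "('v, 'e) pre_digraph \<Rightarrow> ('v, 'e) lpa_gen \<Rightarrow> 'v" where
  "gen_target E (Vertex v) = v"
| "gen_target E (Edge e) = head E e"
| "gen_target E (Ghost e) = tail E e"

context lpa_ideal
begin

text \<open>With a ghost edge read as an edge with its ends exchanged and a vertex as a loop of
  length 0, this law and \<open>rel_target\<close> gather the idempotency of the vertices and all
  relations of vertices with edges and ghost edges.\<close>

lemma rel_source: "g \<in> lpa_gens E \<Longrightarrow> monom_word [Vertex (gen_source E g), g] \<approx> monom_word [g]"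
  unfolding cong_def by (rule relator_in) (auto simp: lpa_gens_def lpa_relators_def)

lemma rel_target: "g \<in> lpa_gens E \<Longrightarrow> monom_word [g, Vertex (gen_target E g)] \<approx> monom_word [g]"
  unfolding cong_def by (rule relator_in) (auto simp: lpa_gens_def lpa_relators_def)

lemma rel_orthogonal:
  "v \<in> verts E \<Longrightarrow> w \<in> verts E \<Longrightarrow> v \<noteq> w \<Longrightarrow> monom_word [Vertex v, Vertex w] \<in> I"
  by (rule relator_in) (auto simp: lpa_relators_def)

lemma rel_ghost_edge: "e \<in> arcs E \<Longrightarrow> monom_word [Ghost e, Edge e] \<approx> monom_word [Vertex (head E e)]"
  unfolding cong_def by (rule relator_in) (auto simp: lpa_relators_def)

lemma rel_ghost_edge_neq:
  "e \<in> arcs E \<Longrightarrow> f \<in> arcs E \<Longrightarrow> e \<noteq> f \<Longrightarrow> monom_word [Ghost e, Edge f] \<in> I"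
  by (rule relator_in) (auto simp: lpa_relators_def)

lemma rel_regular:
  "regular_vertex E v \<Longrightarrow> monom_word [Vertex v] \<approx> (\<Sum>e\<in>out_arcs E v. monom_word [Edge e, Ghost e])"
  unfolding cong_def by (rule relator_in, unfold lpa_relators_def, rule UnI2) blast

lemma gen_source_in: "g \<in> lpa_gens E \<Longrightarrow> gen_source E g \<in> verts E"
  by (auto simp: lpa_gens_def)

lemma gen_target_in: "g \<in> lpa_gens E \<Longrightarrow> gen_target E g \<in> verts E"
  by (auto simp: lpa_gens_def)

abbreviation (input) vtx :: "'v \<Rightarrow> ('v, 'e, 'k) lpa_free" where
  "vtx v \<equiv> monom_word [Vertex v]"

lemma I_mult_word:
  assumes "x \<in> I" "set a \<subseteq> lpa_gens E"
  shows "monom_word a * x \<in> I" "x * monom_word a \<in> I"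
  using assms I_mult[OF carrier_monom[of a]] by (cases "a = []"; simp add: monom_word_Nil)+

lemma word_in:
  assumes "monom_word u \<in> I" "set a \<subseteq> lpa_gens E" "set b \<subseteq> lpa_gens E"
  shows "monom_word (a @ u @ b) \<in> I"
  using I_mult_word(1)[OF I_mult_word(2)[OF assms(1,3)] assms(2)] by (simp add: monom_word_mult)

lemma word_cong:
  assumes "monom_word u \<approx> monom_word v" "set a \<subseteq> lpa_gens E" "set b \<subseteq> lpa_gens E"
  shows "monom_word (a @ u @ b) \<approx> monom_word (a @ v @ b)"
  using I_mult_word(1)[OF I_mult_word(2)[OF assms(1)[unfolded cong_def] assms(3)] assms(2)]
  by (simp add: cong_def algebra_simps monom_word_mult)

text \<open>If v differs from the source s of the word w, then v w = v s w by the first law, and v s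
  = 0.\<close>

lemma vertex_word:
  assumes "w \<noteq> []" "set w \<subseteq> lpa_gens E"
  shows "monom_word (Vertex (gen_source E (hd w)) # w) \<approx> monom_word w"
    and "v \<in> verts E \<Longrightarrow> v \<noteq> gen_source E (hd w) \<Longrightarrow> monom_word (Vertex v # w) \<in> I"
proof -
  obtain g w' where w: "w = g # w'" "g \<in> lpa_gens E" "set w' \<subseteq> lpa_gens E"
    using assms by (cases w) auto
  let ?s = "gen_source E g"
  show *: "monom_word (Vertex (gen_source E (hd w)) # w) \<approx> monom_word w"
    using word_cong[OF rel_source[OF w(2)], of "[]" w'] w by simp
  show "monom_word (Vertex v # w) \<in> I" if "v \<in> verts E" "v \<noteq> gen_source E (hd w)"
  proof -
    have "monom_word (Vertex v # Vertex ?s # w) \<in> I"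
      using word_in[OF rel_orthogonal[of v ?s], of "[]" w] that w gen_source_in by simp
    moreover have "monom_word (Vertex v # Vertex ?s # w) \<approx> monom_word (Vertex v # w)"
      using word_cong[OF *, of "[Vertex v]" "[]"] w that by simp
    ultimately show ?thesis using cong_mem_iff by blast
  qed
qed

lemma word_vertex:
  assumes "w \<noteq> []" "set w \<subseteq> lpa_gens E"
  shows "monom_word (w @ [Vertex (gen_target E (last w))]) \<approx> monom_word w"
    and "v \<in> verts E \<Longrightarrow> v \<noteq> gen_target E (last w) \<Longrightarrow> monom_word (w @ [Vertex v]) \<in> I"
proof -
  obtain g w' where w: "w = w' @ [g]" "g \<in> lpa_gens E" "set w' \<subseteq> lpa_gens E"
    using assms by (cases w rule: rev_cases) auto
  let ?s = "gen_target E g"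
  show *: "monom_word (w @ [Vertex (gen_target E (last w))]) \<approx> monom_word w"
    using word_cong[OF rel_target[OF w(2)], of w' "[]"] w by simp
  show "monom_word (w @ [Vertex v]) \<in> I" if "v \<in> verts E" "v \<noteq> gen_target E (last w)"
  proof -
    have "monom_word (w @ [Vertex ?s, Vertex v]) \<in> I"
      using word_in[OF rel_orthogonal[of ?s v], of w "[]"] that w gen_target_in by simp
    moreover have "monom_word (w @ [Vertex ?s, Vertex v]) \<approx> monom_word (w @ [Vertex v])"
      using word_cong[OF *, of "[]" "[Vertex v]"] w that by simp
    ultimately show ?thesis using cong_mem_iff by blast
  qed
qed

end

section \<open>Local units\<close>

definition vertex_sum :: "'v set \<Rightarrow> ('v, 'e, 'k::field) lpa_free" where
  "vertex_sum W = (\<Sum>v\<in>W. monom_word [Vertex v])"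

lemma vertex_sum_carrier: "W \<subseteq> verts E \<Longrightarrow> vertex_sum W \<in> lpa_carrier E"
  by (auto simp: vertex_sum_def intro!: carrier_sum carrier_monom)

context lpa_ideal
begin

lemma vertex_sum_word:
  assumes "w \<noteq> []" "set w \<subseteq> lpa_gens E" "finite W" "W \<subseteq> verts E"
  shows "gen_source E (hd w) \<in> W \<Longrightarrow> vertex_sum W * monom_word w \<approx> monom_word w"
    and "gen_target E (last w) \<in> W \<Longrightarrow> monom_word w * vertex_sum W \<approx> monom_word w"
proof -
  show "vertex_sum W * monom_word w \<approx> monom_word w" if "gen_source E (hd w) \<in> W"
  proof -
    have "vertex_sum W * monom_word w = (\<Sum>v\<in>W. monom_word (Vertex v # w))"
      by (simp add: vertex_sum_def sum_distrib_right monom_word_mult)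
    also have "\<dots> \<approx> (\<Sum>v\<in>W. if v = gen_source E (hd w) then monom_word w else 0)"
      using vertex_word[OF assms(1,2)] assms(4) by (intro cong_sum) (auto simp: cong_0_iff)
    also have "\<dots> = monom_word w" using that assms by simp
    finally show ?thesis .
  qed
  show "monom_word w * vertex_sum W \<approx> monom_word w" if "gen_target E (last w) \<in> W"
  proof -
    have "monom_word w * vertex_sum W = (\<Sum>v\<in>W. monom_word (w @ [Vertex v]))"
      by (simp add: vertex_sum_def sum_distrib_left monom_word_mult)
    also have "\<dots> \<approx> (\<Sum>v\<in>W. if v = gen_target E (last w) then monom_word w else 0)"
      using word_vertex[OF assms(1,2)] assms(4) by (intro cong_sum) (auto simp: cong_0_iff)
    also have "\<dots> = monom_word w" using that assms by simp
    finally show ?thesis .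
  qed
qed

end

text \<open>Finite sums of vertices are local units. Admitting every finite W above some W0 lets two
  summands share one unit. Working modulo the kernel, whose stability under scalars is known, makes
  the result available in \<open>I_scale\<close> for all other ideals.\<close>

lemma local_units:
  fixes x :: "('v, 'e, 'k::field) lpa_free"
  assumes wf: "wf_digraph E" and x: "x \<in> lpa_carrier E"
  shows "\<exists>W0. finite W0 \<and> W0 \<subseteq> verts E \<and> (\<forall>W. finite W \<longrightarrow> W0 \<subseteq> W \<longrightarrow> W \<subseteq> verts E \<longrightarrow>
     vertex_sum W * x - x \<in> lpa_kernel E \<and> x * vertex_sum W - x \<in> lpa_kernel E)" (is "?P x")
proof -
  interpret K: lpa_ideal E "lpa_kernel E :: ('v, 'e, 'k) lpa_free set"
    by (rule lpa_ideal_kernel) fact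
  show ?thesis
    using x
  proof (induct x rule: carrier_induct)
    case zero
    show ?case by (rule exI[of _ "{}"]) (simp add: K.I_closed)
  next
    case (add p q)
    let ?unit = "\<lambda>U x. vertex_sum U * x - x \<in> lpa_kernel E \<and> x * vertex_sum U - x \<in> lpa_kernel E"
    obtain V where V: "finite V" "V \<subseteq> verts E"
        "\<forall>U. finite U \<longrightarrow> V \<subseteq> U \<longrightarrow> U \<subseteq> verts E \<longrightarrow> ?unit U p"
      using add(1) by (elim exE conjE)
    obtain W where W: "finite W" "W \<subseteq> verts E"
        "\<forall>U. finite U \<longrightarrow> W \<subseteq> U \<longrightarrow> U \<subseteq> verts E \<longrightarrow> ?unit U q"
      using add(2) by (elim exE conjE)
    have "vertex_sum U * (p + q) - (p + q) \<in> lpa_kernel E \<and> (p + q) * vertex_sum U - (p + q) \<in> lpa_kernel E"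
      if "finite U" "V \<union> W \<subseteq> U" "U \<subseteq> verts E" for U
    proof -
      have "(vertex_sum U * p - p) + (vertex_sum U * q - q) \<in> lpa_kernel E"
        "(p * vertex_sum U - p) + (q * vertex_sum U - q) \<in> lpa_kernel E"
        using V(3) W(3) that by (auto intro: K.I_closed)
      then show ?thesis by (simp add: algebra_simps)
    qed
    then show ?case
      using V(1,2) W(1,2) by (intro exI[of _ "V \<union> W"]) simp
  next
    case (scale c w)
    have "hd w \<in> lpa_gens E" "last w \<in> lpa_gens E" using scale by auto
    then have in_verts: "gen_source E (hd w) \<in> verts E" "gen_target E (last w) \<in> verts E"
      using K.gen_source_in K.gen_target_in by blast+
    have "vertex_sum W * scale c (monom_word w) - scale c (monom_word w) \<in> lpa_kernel E \<and>
      scale c (monom_word w) * vertex_sum W - scale c (monom_word w) \<in> lpa_kernel E"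
      if "finite W" "{gen_source E (hd w), gen_target E (last w)} \<subseteq> W" "W \<subseteq> verts E" for W
    proof -
      have "scale c (vertex_sum W * monom_word w - monom_word w) \<in> lpa_kernel E"
        "scale c (monom_word w * vertex_sum W - monom_word w) \<in> lpa_kernel E"
        using K.vertex_sum_word[of w W] scale that
        by (auto intro!: kernel_scale[OF wf] simp: K.cong_def)
      then show ?thesis by (simp add: scale_diff scale_mult_left scale_mult_right)
    qed
    then show ?case
      using in_verts by (intro exI[of _ "{gen_source E (hd w), gen_target E (last w)}"]) auto
  qed
qed

context lpa_ideal
begin

text \<open>A ring ideal is a subspace because the algebra has local units.\<close>

lemma I_scale:
  assumes "x \<in> I"
  shows "scale c x \<in> I"
proof -
  have "x \<in> lpa_carrier E" using assms I_closed by blast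
  then obtain W where W: "finite W" "W \<subseteq> verts E" "vertex_sum W * x - x \<in> lpa_kernel E"
    using local_units[OF wf, of x] by blast
  have "scale c (vertex_sum W) * x \<in> I"
    using I_mult(1) assms carrier_scale vertex_sum_carrier[OF W(2)] by blast
  moreover have "scale c (vertex_sum W * x - x) \<in> I"
    using kernel_scale[OF wf W(3)] kernel by blast
  ultimately have "scale c (vertex_sum W) * x - scale c (vertex_sum W * x - x) \<in> I"
    by (rule I_diff)
  then show ?thesis by (simp add: scale_diff scale_mult_left)
qed

lemma I_scale_cancel: "scale c x \<in> I \<Longrightarrow> c \<noteq> 0 \<Longrightarrow> x \<in> I"
  using I_scale[of "scale c x" "inverse c"] by (simp add: scale_scale)

lemma I_mult_unital:
  assumes "x \<in> I" "a \<in> lpa_unital E"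
  shows "a * x \<in> I" "x * a \<in> I"
proof -
  show "a * x \<in> I"
    using assms(2) by (induct a rule: unital_free_induct)
      (auto simp: assms(1) distrib_right scale_mult_left intro!: I_closed I_scale I_mult_word)
  show "x * a \<in> I"
    using assms(2) by (induct a rule: unital_free_induct)
      (auto simp: assms(1) distrib_left scale_mult_right intro!: I_closed I_scale I_mult_word)
qed

lemma cong_mult_left: "x \<approx> y \<Longrightarrow> a \<in> lpa_unital E \<Longrightarrow> a * x \<approx> a * y"
  using I_mult_unital(1)[of "x - y" a] by (simp add: cong_def algebra_simps)

lemma cong_mult_right: "x \<approx> y \<Longrightarrow> a \<in> lpa_unital E \<Longrightarrow> x * a \<approx> y * a"
  using I_mult_unital(2)[of "x - y" a] by (simp add: cong_def algebra_simps)

lemma cong_scale: "x \<approx> y \<Longrightarrow> scale c x \<approx> scale c y"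
  using I_scale[of "x - y" c] by (simp add: cong_def scale_diff)

lemma local_unit_right:
  assumes "x \<in> lpa_carrier E"
  obtains W where "finite W" "W \<subseteq> verts E" "(\<Sum>w\<in>W. x * vtx w) \<approx> x"
proof -
  obtain W where W: "finite W" "W \<subseteq> verts E" "x * vertex_sum W - x \<in> lpa_kernel E"
    using local_units[OF wf assms] by blast
  then have "(\<Sum>w\<in>W. x * vtx w) \<approx> x"
    using kernel by (auto simp: cong_def vertex_sum_def sum_distrib_left)
  then show ?thesis using that W by blast
qed

lemma vtx_idem: "v \<in> verts E \<Longrightarrow> vtx v * vtx v \<approx> vtx v"
  using rel_source[of "Vertex v"] by (simp add: monom_word_mult)

end

section \<open>Paths\<close>

text \<open>The leading vertex makes the path of length 0 a nonempty word, hence an element of the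
  algebra without identity, and keeps the trivial paths at different vertices apart.
  \<open>ghost_word\<close> is the image of this word under the involution.\<close>

definition path_word :: "'v \<Rightarrow> 'e list \<Rightarrow> ('v, 'e) lpa_gen list" where
  "path_word u p = Vertex u # map Edge p"

definition ghost_word :: "'v \<Rightarrow> 'e list \<Rightarrow> ('v, 'e) lpa_gen list" where
  "ghost_word u p = map Ghost (rev p) @ [Vertex u]"

context lpa_ideal
begin

lemma path_word_gens: "awalk u p v \<Longrightarrow> set (path_word u p) \<subseteq> lpa_gens E"
  by (auto simp: path_word_def awalk_def)

lemma ghost_word_gens: "awalk u p v \<Longrightarrow> set (ghost_word u p) \<subseteq> lpa_gens E"
  by (auto simp: ghost_word_def awalk_def)

lemma path_word_target: "awalk u p v \<Longrightarrow> gen_target E (last (path_word u p)) = v"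
  by (cases p rule: rev_cases) (auto simp: path_word_def awalk_Nil_iff awalk_append_iff awalk_Cons_iff)

lemma path_word_vertex:
  assumes "awalk u p w" "v \<in> verts E"
  shows "v = w \<Longrightarrow> monom_word (path_word u p @ [Vertex v]) \<approx> monom_word (path_word u p)"
    and "v \<noteq> w \<Longrightarrow> monom_word (path_word u p @ [Vertex v]) \<in> I"
  using word_vertex[of "path_word u p"] path_word_gens[OF assms(1)] path_word_target[OF assms(1)] assms(2)
  by (auto simp: path_word_def)

text \<open>Cancellation works from the middle outwards: each innermost pair e* f is r(e) or 0
  according as e = f or not, until p is used up. Since p is not longer than q, no ghost edge
  survives.\<close>

lemma ghost_path:
  assumes "awalk u p w" "awalk u' q w'" "length p \<le> length q"
  shows "u = u' \<Longrightarrow> q = p @ r \<Longrightarrow> monom_word (ghost_word u p @ path_word u' q) \<approx> monom_word (path_word w r)"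
    and "\<not> (u = u' \<and> prefix p q) \<Longrightarrow> monom_word (ghost_word u p @ path_word u' q) \<in> I"
proof -
  have "if u = u' \<and> prefix p q
    then monom_word (ghost_word u p @ path_word u' q) \<approx> monom_word (path_word w (drop (length p) q))
    else monom_word (ghost_word u p @ path_word u' q) \<in> I"
    using assms
  proof (induct p arbitrary: u u' q)
    case Nil
    then have *: "w = u" "u \<in> verts E" "u' \<in> verts E" by (auto simp: awalk_def)
    show ?case
    proof (cases "u = u'")
      case True
      then show ?thesis
        using vertex_word(1)[of "path_word u q"] * path_word_gens[OF Nil(2)]
        by (simp add: ghost_word_def path_word_def)
    next
      case False
      then show ?thesis
        using vertex_word(2)[of "path_word u' q" u] * path_word_gens[OF Nil(2)]
        by (simp add: ghost_word_def path_word_def)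
    qed
  next
    case (Cons e p)
    then obtain f q' where q: "q = f # q'" by (cases q) auto
    have e: "e \<in> arcs E" "tail E e = u" "awalk (head E e) p w" "u \<in> verts E"
      using Cons(2) by (auto simp: awalk_Cons_iff)
    have f: "f \<in> arcs E" "tail E f = u'" "awalk (head E f) q' w'" "u' \<in> verts E"
      using Cons(3) q by (auto simp: awalk_Cons_iff)
    have q'_gens: "set (map Edge q') \<subseteq> lpa_gens E" using f(3) by (auto simp: awalk_def)
    have p_gens: "set (map Ghost (rev p)) \<subseteq> lpa_gens E" using e(3) by (auto simp: awalk_def)
    have w: "ghost_word u (e # p) @ path_word u' q =
        (map Ghost (rev p) @ [Ghost e]) @ [Vertex u, Vertex u'] @ (Edge f # map Edge q')"
      by (simp add: ghost_word_def path_word_def q)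
    show ?case
    proof (cases "u = u'")
      case False
      then show ?thesis
        unfolding w using word_in[OF rel_orthogonal[OF e(4) f(4) False],
            of "map Ghost (rev p) @ [Ghost e]" "Edge f # map Edge q'"] e f p_gens q'_gens by simp
    next
      case True
      have "monom_word (ghost_word u (e # p) @ path_word u' q) \<approx>
          monom_word ((map Ghost (rev p) @ [Ghost e]) @ [Vertex u] @ (Edge f # map Edge q'))"
        unfolding w using word_cong[OF rel_source[of "Vertex u"],
            of "map Ghost (rev p) @ [Ghost e]" "Edge f # map Edge q'"] e f p_gens q'_gens True by simp
      also have "\<dots> \<approx> monom_word ((map Ghost (rev p) @ [Ghost e]) @ [Edge f] @ map Edge q')"
        using word_cong[OF rel_source[of "Edge f"], of "map Ghost (rev p) @ [Ghost e]" "map Edge q'"]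
          e f p_gens q'_gens True by simp
      finally have 1: "monom_word (ghost_word u (e # p) @ path_word u' q) \<approx>
        monom_word (map Ghost (rev p) @ [Ghost e, Edge f] @ map Edge q')" by simp
      show ?thesis
      proof (cases "e = f")
        case False
        have "monom_word (map Ghost (rev p) @ [Ghost e, Edge f] @ map Edge q') \<in> I"
          using word_in[OF rel_ghost_edge_neq[OF e(1) f(1) False] p_gens q'_gens] .
        then show ?thesis using 1 cong_mem False q by auto
      next
        case ef: True
        have "monom_word (map Ghost (rev p) @ [Ghost e, Edge f] @ map Edge q') \<approx>
          monom_word (map Ghost (rev p) @ [Vertex (head E e)] @ map Edge q')"
          using word_cong[OF rel_ghost_edge[OF e(1)] p_gens q'_gens] ef by simp
        \<comment> \<open>The vertex r(e) is doubled to serve as the end of the shorter ghost word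
          and as the start of the shorter path word.\<close>
        also have "\<dots> \<approx> monom_word (map Ghost (rev p) @ [Vertex (head E e), Vertex (head E e)] @ map Edge q')"
          using word_cong[OF cong_sym[OF rel_source[of "Vertex (head E e)"]] p_gens q'_gens] e by simp
        also have "\<dots> = monom_word (ghost_word (head E e) p @ path_word (head E f) q')"
          by (simp add: ghost_word_def path_word_def ef)
        finally have 2: "monom_word (ghost_word u (e # p) @ path_word u' q) \<approx>
          monom_word (ghost_word (head E e) p @ path_word (head E f) q')"
          using 1 cong_trans by blast
        show ?thesis
          using Cons(1)[OF e(3) f(3)] Cons(4) 2 q ef True cong_trans cong_mem by auto
      qed
    qed
  qed
  then show "u = u' \<Longrightarrow> q = p @ r \<Longrightarrow> monom_word (ghost_word u p @ path_word u' q) \<approx> monom_word (path_word w r)"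
    and "\<not> (u = u' \<and> prefix p q) \<Longrightarrow> monom_word (ghost_word u p @ path_word u' q) \<in> I"
    by auto
qed

end

section \<open>Closed paths and Condition (K)\<close>

context wf_digraph
begin

text \<open>An edge continuing c inside d would start at v, which a simple closed path does not
  revisit before its end.\<close>

lemma simple_closed_path_prefix:
  assumes "simple_closed_path G v c" "simple_closed_path G v d" "prefix c d"
  shows "c = d"
proof (rule ccontr)
  assume "c \<noteq> d"
  obtain x where x: "d = c @ x" using assms(3) by (auto simp: prefix_def)
  then obtain f x' where f: "x = f # x'" using \<open>c \<noteq> d\<close> by (cases x) auto
  obtain g c' where c: "c = g # c'" using assms(1) by (cases c) (auto simp: simple_closed_path_def)
  have "awalk v c v" "awalk v (c @ f # x') v"
    using assms(1,2) x f by (auto simp: simple_closed_path_def)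
  then have "tail G f = v"
    by (metis awalk_append_iff awalk_Cons_iff awalk_ends)
  then show False using assms(2) x f c by (auto simp: simple_closed_path_def)
qed

text \<open>The factor c ends at the first return to v.\<close>

lemma closed_path_decomp:
  assumes "awalk v d v" "d \<noteq> []"
  obtains c d' where "d = c @ d'" "simple_closed_path G v c" "awalk v d' v"
proof -
  obtain e p where d: "d = e # p" using assms(2) by (cases d) auto
  define q where "q = takeWhile (\<lambda>f. tail G f \<noteq> v) p"
  define r where "r = dropWhile (\<lambda>f. tail G f \<noteq> v) p"
  have p: "p = q @ r" by (simp add: q_def r_def)
  have w: "awalk v ((e # q) @ r) v" using assms d p by simp
  obtain w where w: "awalk v (e # q) w" "awalk w r v"
    using w by (metis awalk_append_iff)
  have "w = v"
  proof (cases r)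
    case Nil
    then show ?thesis using w(2) by (simp add: awalk_Nil_iff)
  next
    case (Cons f r')
    then have "tail G f = v" using hd_dropWhile[of "\<lambda>f. tail G f \<noteq> v" p] by (simp add: r_def)
    then show ?thesis using w(2) Cons by (simp add: awalk_Cons_iff)
  qed
  moreover have "\<forall>f\<in>set q. tail G f \<noteq> v" by (auto simp: q_def dest: set_takeWhileD)
  ultimately have "simple_closed_path G v (e # q)"
    using w by (auto simp: simple_closed_path_def)
  then show ?thesis using that[of "e # q" r] d p w \<open>w = v\<close> by simp
qed

text \<open>The word \<open>c\<^sup>m c'\<close> does not overlap its translate by a short closed path: cancelling simple closed
  paths from the left identifies \<open>c\<close> with \<open>c'\<close>.\<close>

lemma no_overlap:
  assumes "simple_closed_path G v c" "simple_closed_path G v c'" "c \<noteq> c'"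
    and "awalk v d v" "length d \<le> m" "m \<le> n" "d = [] \<Longrightarrow> m < n"
  shows "\<not> prefix (concat (replicate m c) @ c') (d @ concat (replicate n c) @ c')"
  using assms(4-)
proof (induct m arbitrary: d n)
  case 0
  \<comment> \<open>For m = 0 the bound forces d to be empty, and then n > 0, so the word on the
    right starts with c: one of c and c' would be a prefix of the other.\<close>
  then have [simp]: "d = []" and "0 < n" by auto
  then obtain n' where [simp]: "n = Suc n'" by (cases n) auto
  show ?case
  proof
    assume "prefix (concat (replicate 0 c) @ c') (d @ concat (replicate n c) @ c')"
    then have "prefix c' (c @ (concat (replicate n' c) @ c'))" by simp
    moreover have "prefix c (c @ (concat (replicate n' c) @ c'))" by simp
    ultimately have "prefix c c' \<or> prefix c' c" using prefix_same_cases by blast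
    then show False using simple_closed_path_prefix assms(1-3) by blast
  qed
next
  case (Suc m)
  show ?case
  proof
    assume pre: "prefix (concat (replicate (Suc m) c) @ c') (d @ concat (replicate n c) @ c')"
    show False
    proof (cases "d = []")
      case True
      then obtain n' where n: "n = Suc n'" "m < n'" using Suc by (cases n) auto
      then have "prefix (concat (replicate m c) @ c') ([] @ concat (replicate n' c) @ c')"
        using pre True by simp
      then show False using Suc(1)[of "[]" n'] n Suc(2) by (simp add: awalk_Nil_iff awalk_def)
    next
      case False
      then obtain b d' where d: "d = b @ d'" "simple_closed_path G v b" "awalk v d' v"
        using Suc(2) closed_path_decomp by blast
      have "prefix c (b @ d' @ concat (replicate n c) @ c')"
        using pre d by (simp add: prefix_def) metis
      moreover have "prefix b (b @ d' @ concat (replicate n c) @ c')" by simp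
      ultimately have "prefix c b \<or> prefix b c" using prefix_same_cases by blast
      then have "b = c" using simple_closed_path_prefix assms(1) d(2) by blast
      then have "prefix (concat (replicate m c) @ c') (d' @ concat (replicate n c) @ c')"
        using pre d by simp
      moreover have "b \<noteq> []" using d(2) by (simp add: simple_closed_path_def)
      \<comment> \<open>Removing b = c shortens d by at least one edge, so the length bound holds
        for m; and m < n holds even if nothing remains of d.\<close>
      ultimately show False
        using Suc(1)[of d' n] d(3) Suc(3,4) d(1) by (cases b) auto
    qed
  qed
qed

lemma awalk_concat_replicate: "awalk v c v \<Longrightarrow> awalk v (concat (replicate n c)) v"
  by (induct n) (auto simp: awalk_Nil_iff awalk_append_iff)

text \<open>The exponent of c is N, the bound on the length of d that \<open>no_overlap\<close> asks
  for. At a vertex on no closed path the path of length 0 serves, there being no nonempty d.\<close>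

lemma condition_K_free_path:
  assumes "condition_K G" "v \<in> verts G"
  obtains q where "awalk v q v"
    "\<And>d. awalk v d v \<Longrightarrow> d \<noteq> [] \<Longrightarrow> length d \<le> N \<Longrightarrow> \<not> prefix q (d @ q)"
proof (cases "\<exists>c. simple_closed_path G v c")
  case True
  then obtain c c' where c: "simple_closed_path G v c" "simple_closed_path G v c'" "c \<noteq> c'"
    using assms(1) unfolding condition_K_def by metis
  show ?thesis
  proof (rule that[of "concat (replicate N c) @ c'"])
    show "awalk v (concat (replicate N c) @ c') v"
      using awalk_concat_replicate[of v c N] c by (auto simp: awalk_append_iff simple_closed_path_def)
  qed (use no_overlap[OF c] in auto)
next
  case False
  then show ?thesis
    using closed_path_decomp that[of "[]"] assms(2) by (metis awalk_Nil_iff)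
qed

end

context lpa_ideal
begin

section \<open>Isolating one term of a combination of paths\<close>

lemma I_mult_both: "x \<in> I \<Longrightarrow> a \<in> lpa_unital E \<Longrightarrow> b \<in> lpa_unital E \<Longrightarrow> a * x * b \<in> I"
  by (intro I_mult_unital)

text \<open>Multiplication by such a pair isolates a single term in a combination of paths ending at \<open>w\<close>.\<close>

definition separates where
  "separates w N q' q \<eta> \<longleftrightarrow> q \<in> lpa_unital E \<and> q' \<in> lpa_unital E \<and> vtx w * q \<approx> q \<and> q' * q \<approx> \<eta> \<and>
     (\<forall>d. awalk w d w \<longrightarrow> d \<noteq> [] \<longrightarrow> length d \<le> N \<longrightarrow> q' * monom_word (path_word w d) * q \<in> I)"

lemma separates_path:
  assumes "awalk v q v" "\<And>d. awalk v d v \<Longrightarrow> d \<noteq> [] \<Longrightarrow> length d \<le> N \<Longrightarrow> \<not> prefix q (d @ q)"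
  shows "separates v N (monom_word (ghost_word v q)) (monom_word (path_word v q)) (vtx v)"
proof -
  note gens = path_word_gens[OF assms(1)] ghost_word_gens[OF assms(1)]
  have v: "v \<in> verts E" using assms(1) by auto
  have "vtx v * monom_word (path_word v q) \<approx> monom_word (path_word v q)"
    using vertex_word(1)[of "path_word v q"] gens by (simp add: monom_word_mult path_word_def)
  moreover have "monom_word (ghost_word v q) * monom_word (path_word v q) \<approx> vtx v"
    using ghost_path(1)[OF assms(1,1), of "[]"] by (simp add: monom_word_mult path_word_def)
  moreover have "monom_word (ghost_word v q) * monom_word (path_word v d) * monom_word (path_word v q) \<in> I"
    if d: "awalk v d v" "d \<noteq> []" "length d \<le> N" for d
  proof -
    have dq: "awalk v (d @ q) v" using d assms(1) by (auto simp: awalk_append_iff)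
    have "monom_word (path_word v d @ path_word v q) \<approx> monom_word (path_word v (d @ q))"
      using word_cong[OF path_word_vertex(1)[OF d(1) v refl], of "[]" "map Edge q"] gens
      by (simp add: path_word_def)
    then have "monom_word (ghost_word v q @ path_word v d @ path_word v q) \<approx>
        monom_word (ghost_word v q @ path_word v (d @ q))"
      using word_cong[of _ _ "ghost_word v q" "[]"] gens by simp
    moreover have "monom_word (ghost_word v q @ path_word v (d @ q)) \<in> I"
      by (rule ghost_path(2)[OF assms(1) dq]) (use assms(2)[OF d] in auto)
    ultimately show ?thesis using cong_mem by (simp add: monom_word_mult)
  qed
  ultimately show ?thesis
    using gens by (auto simp: separates_def intro: unital_free_closed)
qed

lemma condition_K_separates:
  assumes "condition_K E" "v \<in> verts E"
  obtains q' q where "separates v N q' q (vtx v)"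
  using condition_K_free_path[OF assms] separates_path by metis

text \<open>Separation moves backwards along e by rotating closed paths: e* d e vanishes unless d
  starts with e, say d = e d', and then it is the closed path d' e at r(e), of the same
  length.\<close>

lemma separates_edge:
  assumes e: "e \<in> arcs E" and sep: "separates (head E e) N q' q \<eta>"
  shows "separates (tail E e) N (q' * monom_word [Ghost e]) (monom_word [Edge e] * q) \<eta>"
proof -
  note sep' = sep[unfolded separates_def]
  have U: "monom_word [Edge e] \<in> lpa_unital E" "monom_word [Ghost e] \<in> lpa_unital E"
    using e by (auto intro: unital_free_closed)
  have "vtx (tail E e) * (monom_word [Edge e] * q) \<approx> monom_word [Edge e] * q"
    using cong_mult_right[OF rel_source[of "Edge e"], of q] e sep' by (simp add: monom_word_mult flip: mult.assoc)
  moreover have "(q' * monom_word [Ghost e]) * (monom_word [Edge e] * q) \<approx> \<eta>"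
  proof -
    have "(q' * monom_word [Ghost e]) * (monom_word [Edge e] * q) = q' * (monom_word [Ghost e, Edge e] * q)"
      by (simp add: mult.assoc monom_word_mult flip: mult.assoc[of "monom_word [Ghost e]"])
    also have "\<dots> \<approx> q' * (vtx (head E e) * q)"
      using rel_ghost_edge[OF e] sep' by (intro cong_mult_left cong_mult_right) auto
    also have "\<dots> \<approx> q' * q" using sep' by (intro cong_mult_left) auto
    also have "\<dots> \<approx> \<eta>" using sep' by blast
    finally show ?thesis .
  qed
  moreover have "(q' * monom_word [Ghost e]) * monom_word (path_word (tail E e) d) * (monom_word [Edge e] * q) \<in> I"
    if d: "awalk (tail E e) d (tail E e)" "d \<noteq> []" "length d \<le> N" for d
  proof -
    obtain f d' where f: "d = f # d'" using d(2) by (cases d) auto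
    have d': "f \<in> arcs E" "tail E f = tail E e" "awalk (head E f) d' (tail E e)"
      using d f by (auto simp: awalk_Cons_iff)
    have gens: "set (map Edge d') \<subseteq> lpa_gens E" using d' by (auto simp: awalk_def)
    have eq: "(q' * monom_word [Ghost e]) * monom_word (path_word (tail E e) d) * (monom_word [Edge e] * q)
        = q' * monom_word ([Ghost e, Vertex (tail E e)] @ (Edge f # map Edge d' @ [Edge e])) * q"
    proof -
      have "(monom_word ([Ghost e, Vertex (tail E e)] @ (Edge f # map Edge d' @ [Edge e])) :: ('v, 'e, 'k) lpa_free) =
        monom_word [Ghost e] * monom_word (path_word (tail E e) d) * monom_word [Edge e]"
        by (simp add: monom_word_mult path_word_def f)
      then show ?thesis by (simp only: mult.assoc)
    qed
    have 1: "monom_word ([Ghost e, Vertex (tail E e)] @ (Edge f # map Edge d' @ [Edge e])) \<approx>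
        monom_word ([Ghost e] @ (Edge f # map Edge d' @ [Edge e]))"
      using word_cong[OF rel_target[of "Ghost e"], of "[]" "Edge f # map Edge d' @ [Edge e]"] e d' gens by simp
    have "q' * monom_word ([Ghost e, Vertex (tail E e)] @ (Edge f # map Edge d' @ [Edge e])) * q \<in> I"
    proof (cases "e = f")
      case False
      have "monom_word ([Ghost e] @ (Edge f # map Edge d' @ [Edge e])) \<in> I"
        using word_in[OF rel_ghost_edge_neq[OF e d'(1) False], of "[]" "map Edge d' @ [Edge e]"] gens e by simp
      then show ?thesis using 1 sep' cong_mem by (intro I_mult_both) auto
    next
      case True
      have w: "awalk (head E e) (d' @ [e]) (head E e)"
        using d' e True by (auto simp: awalk_append_iff awalk_Cons_iff awalk_Nil_iff)
      have "monom_word ([Ghost e] @ (Edge f # map Edge d' @ [Edge e])) \<approx> monom_word (path_word (head E e) (d' @ [e]))"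
        using word_cong[OF rel_ghost_edge[OF e], of "[]" "map Edge d' @ [Edge e]"] gens e True
        by (simp add: path_word_def)
      then have "monom_word ([Ghost e, Vertex (tail E e)] @ (Edge f # map Edge d' @ [Edge e])) \<approx>
          monom_word (path_word (head E e) (d' @ [e]))" using 1 cong_trans by blast
      then have "q' * monom_word ([Ghost e, Vertex (tail E e)] @ (Edge f # map Edge d' @ [Edge e])) * q \<approx>
          q' * monom_word (path_word (head E e) (d' @ [e])) * q"
        using sep' by (intro cong_mult_left cong_mult_right) auto
      moreover have "q' * monom_word (path_word (head E e) (d' @ [e])) * q \<in> I"
        using sep' w d f by auto
      ultimately show ?thesis using cong_mem by blast
    qed
    then show ?thesis using eq by simp
  qed
  ultimately show ?thesis
    unfolding separates_def using U sep' by (auto intro: unital_free_mult)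
qed

text \<open>Indexing by pairs distinguishes the paths of length 0 at different vertices.\<close>

definition path_sum :: "('v \<times> 'e list \<Rightarrow> 'k) \<Rightarrow> ('v \<times> 'e list) set \<Rightarrow> ('v, 'e, 'k) lpa_free" where
  "path_sum k A = (\<Sum>(u, p)\<in>A. scale (k (u, p)) (monom_word (path_word u p)))"

text \<open>Among the paths of A that end at w, let p0 be a shortest one and multiply by q' p0* on
  the left. Paths ending elsewhere vanish against w q, paths ending at w that do not extend p0
  vanish against p0*, and a proper extension of p0 leaves a closed path at w of length at most N,
  which the separating pair annihilates. What remains is a nonzero multiple of \<eta>.\<close>

lemma separates_path_sum:
  assumes A: "finite A" "\<And>u p. (u, p) \<in> A \<Longrightarrow> k (u, p) \<noteq> 0 \<and> length p \<le> N \<and> (\<exists>v. awalk u p v)"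
    and sep: "separates w N q' q \<eta>" and I: "path_sum k A * q \<in> I"
    and w: "(u, p) \<in> A" "awalk u p w"
  shows "\<eta> \<in> I"
proof -
  note sep' = sep[unfolded separates_def]
  define B where "B = {(u, p) \<in> A. awalk u p w}"
  have "finite B" "B \<noteq> {}" using A w by (auto simp: B_def intro: finite_subset[of _ A])
  then obtain u0 p0 where up: "(u0, p0) \<in> B" and min: "\<And>u p. (u, p) \<in> B \<Longrightarrow> length p0 \<le> length p"
    using ex_is_arg_min_if_finite[of B "\<lambda>(u, p). length p"]
    by (auto simp: is_arg_min_linorder split: prod.splits)
  have up': "(u0, p0) \<in> A" "awalk u0 p0 w" using up by (auto simp: B_def)
  have wv: "w \<in> verts E" using up' by auto
  let ?g = "monom_word (ghost_word u0 p0)"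
  let ?t = "\<lambda>u p. q' * (?g * monom_word (path_word u p)) * q"
  have gU: "?g \<in> lpa_unital E" using ghost_word_gens[OF up'(2)] by (rule unital_free_monom)
  have t: "?t u p \<in> I" if up: "(u, p) \<in> A" "(u, p) \<noteq> (u0, p0)" for u p
  proof -
    obtain v where v: "awalk u p v" using A(2) up by blast
    have pU: "monom_word (path_word u p) \<in> lpa_unital E"
      using path_word_gens[OF v] by (rule unital_free_monom)
    show ?thesis
    proof (cases "v = w")
      case False
      have "monom_word (path_word u p) * (vtx w * q) \<in> I"
        using path_word_vertex(2)[OF v wv] False sep' I_mult_unital(2)
        by (simp add: monom_word_mult flip: mult.assoc)
      moreover have "monom_word (path_word u p) * (vtx w * q) \<approx> monom_word (path_word u p) * q"
        using sep' pU by (intro cong_mult_left) auto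
      ultimately have "monom_word (path_word u p) * q \<in> I" using cong_mem_iff by blast
      then have "(q' * ?g) * (monom_word (path_word u p) * q) \<in> I"
        using sep' gU by (intro I_mult_unital(1)[of "_ * q"]) (auto intro: unital_free_mult)
      then show ?thesis by (simp add: mult.assoc)
    next
      case True
      then have len: "length p0 \<le> length p" using min up v by (auto simp: B_def)
      show ?thesis
      proof (cases "u0 = u \<and> prefix p0 p")
        case False
        then have "?g * monom_word (path_word u p) \<in> I"
          using ghost_path(2)[OF up'(2) v len] by (simp add: monom_word_mult)
        then show ?thesis using sep' by (intro I_mult_both) auto
      next
        case pre: True
        then obtain d where d: "p = p0 @ d" by (auto simp: prefix_def)
        have "awalk w d w"
          using v up'(2) pre True d by (metis awalk_append_iff awalk_ends)
        moreover have "d \<noteq> []" using up pre d by auto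
        moreover have "length d \<le> N" using A(2) up d by fastforce
        ultimately have "q' * monom_word (path_word w d) * q \<in> I" using sep' by blast
        moreover have "?t u p \<approx> q' * monom_word (path_word w d) * q"
          using ghost_path(1)[OF up'(2) v len _ d] pre sep'
          by (intro cong_mult_left cong_mult_right) (auto simp: monom_word_mult)
        ultimately show ?thesis using cong_mem by blast
      qed
    qed
  qed
  have t0: "?t u0 p0 \<approx> \<eta>"
  proof -
    have "?t u0 p0 \<approx> q' * vtx w * q"
      using ghost_path(1)[OF up'(2,2), of "[]"] sep'
      by (intro cong_mult_left cong_mult_right) (auto simp: monom_word_mult path_word_def)
    also have "q' * vtx w * q = q' * (vtx w * q)" by (simp add: mult.assoc)
    also have "\<dots> \<approx> q' * q" using sep' by (intro cong_mult_left) auto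
    also have "\<dots> \<approx> \<eta>" using sep' by blast
    finally show ?thesis .
  qed
  have "(q' * ?g) * (path_sum k A * q) \<in> I"
    using I sep' gU by (intro I_mult_unital(1)[of "_ * q"]) (auto intro: unital_free_mult)
  also have "(q' * ?g) * (path_sum k A * q) = (\<Sum>(u, p)\<in>A. scale (k (u, p)) (?t u p))"
    by (simp add: path_sum_def sum_distrib_left sum_distrib_right case_prod_unfold
        scale_mult_left scale_mult_right mult.assoc)
  also have "\<dots> = scale (k (u0, p0)) (?t u0 p0) + (\<Sum>(u, p)\<in>A - {(u0, p0)}. scale (k (u, p)) (?t u p))"
    using A(1) up'(1) by (subst sum.remove[of A "(u0, p0)"]) auto
  finally have 1: "scale (k (u0, p0)) (?t u0 p0) + (\<Sum>(u, p)\<in>A - {(u0, p0)}. scale (k (u, p)) (?t u p)) \<in> I" .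
  have 2: "(\<Sum>(u, p)\<in>A - {(u0, p0)}. scale (k (u, p)) (?t u p)) \<in> I"
    using t by (intro I_sum) (auto intro: I_scale)
  have "scale (k (u0, p0)) (?t u0 p0) \<in> I"
    using I_diff[OF 1 2] by simp
  then have "?t u0 p0 \<in> I" by (rule I_scale_cancel) (use A(2) up'(1) in blast)
  then show ?thesis using t0 cong_mem_iff by blast
qed

end

section \<open>The admissible pair of an ideal\<close>

text \<open>With \<open>F = live_arcs E H v\<close> this is v^H. Other finite sets of edges at v are
  needed in \<open>ideal_eqI\<close>, to annihilate the ghost edges that happen to occur in an
  element.\<close>

definition corner :: "'v \<Rightarrow> 'e set \<Rightarrow> ('v, 'e, 'k::field) lpa_free" where
  "corner v F = monom_word [Vertex v] - (\<Sum>e\<in>F. monom_word [Edge e, Ghost e])"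

definition live_arcs :: "('v, 'e) pre_digraph \<Rightarrow> 'v set \<Rightarrow> 'v \<Rightarrow> 'e set" where
  "live_arcs E H v = {e \<in> out_arcs E v. head E e \<notin> H}"

definition ideal_verts :: "('v, 'e) pre_digraph \<Rightarrow> ('v, 'e, 'k::field) lpa_free set \<Rightarrow> 'v set" where
  "ideal_verts E I = {v \<in> verts E. monom_word [Vertex v] \<in> I}"

definition ideal_breaking :: "('v, 'e) pre_digraph \<Rightarrow> ('v, 'e, 'k::field) lpa_free set \<Rightarrow> 'v set" where
  "ideal_breaking E I = {v \<in> breaking_vertices E (ideal_verts E I).
     corner v (live_arcs E (ideal_verts E I) v) \<in> I}"

lemma breaking_vertices_iff:
  "v \<in> breaking_vertices E H \<longleftrightarrow> v \<in> verts E \<and> v \<notin> H \<and> infinite (out_arcs E v) \<and>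
     finite (live_arcs E H v) \<and> live_arcs E H v \<noteq> {}"
  by (auto simp: breaking_vertices_def infinite_emitter_def live_arcs_def)

lemma live_arcs_subset: "live_arcs E H v \<subseteq> out_arcs E v"
  by (auto simp: live_arcs_def)

lemma corner_unital:
  "v \<in> verts E \<Longrightarrow> F \<subseteq> arcs E \<Longrightarrow> corner v F \<in> lpa_unital E"
  unfolding corner_def by (intro unital_free_minus unital_free_sum unital_free_monom) auto

lemma corner_carrier:
  "v \<in> verts E \<Longrightarrow> F \<subseteq> arcs E \<Longrightarrow> corner v F \<in> lpa_carrier E"
  unfolding corner_def by (intro carrier_minus carrier_sum carrier_monom) auto

context lpa_ideal
begin

lemma edge_in_iff:
  assumes "e \<in> arcs E"
  shows "monom_word [Edge e] \<in> I \<longleftrightarrow> vtx (head E e) \<in> I"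
proof
  assume "monom_word [Edge e] \<in> I"
  then have "monom_word [Ghost e, Edge e] \<in> I"
    using word_in[of "[Edge e]" "[Ghost e]" "[]"] assms by simp
  then show "vtx (head E e) \<in> I" using rel_ghost_edge[OF assms] cong_mem_iff by blast
next
  assume "vtx (head E e) \<in> I"
  then have "monom_word [Edge e, Vertex (head E e)] \<in> I"
    using word_in[of "[Vertex (head E e)]" "[Edge e]" "[]"] assms by simp
  then show "monom_word [Edge e] \<in> I" using rel_target[of "Edge e"] assms cong_mem_iff by simp
qed

text \<open>The forward direction multiplies by e on the right: e e* e = e.\<close>

lemma edge_ghost_in_iff:
  assumes "e \<in> arcs E"
  shows "monom_word [Edge e, Ghost e] \<in> I \<longleftrightarrow> vtx (head E e) \<in> I"
proof
  assume "monom_word [Edge e, Ghost e] \<in> I"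
  then have "monom_word [Edge e, Ghost e, Edge e] \<in> I"
    using word_in[of "[Edge e, Ghost e]" "[]" "[Edge e]"] assms by simp
  moreover have "monom_word [Edge e, Ghost e, Edge e] \<approx> monom_word [Edge e, Vertex (head E e)]"
    using word_cong[OF rel_ghost_edge[OF assms], of "[Edge e]" "[]"] assms by simp
  moreover have "monom_word [Edge e, Vertex (head E e)] \<approx> monom_word [Edge e]"
    using rel_target[of "Edge e"] assms by simp
  ultimately show "vtx (head E e) \<in> I" using edge_in_iff[OF assms] cong_mem_iff by blast
next
  assume "vtx (head E e) \<in> I"
  then have "monom_word [Edge e] \<in> I" using edge_in_iff[OF assms] by simp
  then show "monom_word [Edge e, Ghost e] \<in> I"
    using word_in[of "[Edge e]" "[]" "[Ghost e]"] assms by simp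
qed

lemma vertex_edge_in:
  assumes "e \<in> arcs E" "vtx (tail E e) \<in> I"
  shows "vtx (head E e) \<in> I"
proof -
  have "monom_word [Vertex (tail E e), Edge e] \<in> I"
    using word_in[of "[Vertex (tail E e)]" "[]" "[Edge e]"] assms by simp
  then have "monom_word [Edge e] \<in> I"
    using rel_source[of "Edge e"] assms cong_mem_iff by simp
  then show ?thesis using edge_in_iff assms by simp
qed

lemma hereditary_ideal_verts: "hereditary E (ideal_verts E I)"
proof -
  have "w \<in> ideal_verts E I" if "v \<rightarrow>\<^sup>*\<^bsub>E\<^esub> w" "v \<in> ideal_verts E I" for v w
    using that
  proof (induct rule: reachable_induct)
    case (step x y)
    then obtain e where "e \<in> arcs E" "tail E e = x" "head E e = y" by auto
    then show ?case using step vertex_edge_in[of e] by (auto simp: ideal_verts_def)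
  qed auto
  then show ?thesis by (auto simp: hereditary_def ideal_verts_def)
qed

lemma saturated_ideal_verts: "saturated E (ideal_verts E I)"
  unfolding saturated_def
proof (intro allI impI)
  fix v assume v: "regular_vertex E v" "head E ` out_arcs E v \<subseteq> ideal_verts E I"
  have "(\<Sum>e\<in>out_arcs E v. monom_word [Edge e, Ghost e]) \<in> I"
  proof (rule I_sum)
    fix e assume e: "e \<in> out_arcs E v"
    then have "head E e \<in> ideal_verts E I" using v(2) by blast
    then show "monom_word [Edge e, Ghost e] \<in> I" using e by (simp add: edge_ghost_in_iff ideal_verts_def)
  qed
  then show "v \<in> ideal_verts E I"
    using cong_mem[OF rel_regular[OF v(1)]] v(1) by (auto simp: ideal_verts_def regular_vertex_def)
qed

lemma admissible_ideal_pair: "admissible_pair E (ideal_verts E I, ideal_breaking E I)"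
  using hereditary_ideal_verts saturated_ideal_verts
  by (auto simp: admissible_pair_def ideal_breaking_def)

lemma corner_cong:
  assumes "finite G" "F \<subseteq> G" "G \<subseteq> arcs E" "\<And>e. e \<in> G - F \<Longrightarrow> vtx (head E e) \<in> I"
  shows "corner v G \<approx> corner v F"
proof -
  have "(\<Sum>e\<in>G. monom_word [Edge e, Ghost e]) =
      (\<Sum>e\<in>F. monom_word [Edge e, Ghost e]) + (\<Sum>e\<in>G - F. monom_word [Edge e, Ghost e] :: ('v, 'e, 'k) lpa_free)"
    using sum.subset_diff[OF assms(2,1), of "\<lambda>e. monom_word [Edge e, Ghost e] :: ('v, 'e, 'k) lpa_free"]
    by (simp add: add.commute)
  moreover have "(\<Sum>e\<in>G - F. monom_word [Edge e, Ghost e]) \<in> I"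
    using assms by (intro I_sum) (auto simp: edge_ghost_in_iff)
  ultimately show ?thesis
    using I_closed(3) by (simp add: cong_def corner_def)
qed

section \<open>The idempotents v - \<Sum> e e*\<close>

context
  fixes v F
  assumes v: "v \<in> verts E" and F: "finite F" "F \<subseteq> out_arcs E v"
begin

lemma vertex_corner: "vtx v * corner v F \<approx> corner v F"
proof -
  have "vtx v * corner v F = monom_word [Vertex v, Vertex v] - (\<Sum>e\<in>F. monom_word ([Vertex v, Edge e] @ [Ghost e]))"
    by (simp add: corner_def right_diff_distrib sum_distrib_left monom_word_mult)
  also have "\<dots> \<approx> vtx v - (\<Sum>e\<in>F. monom_word ([Edge e] @ [Ghost e]))"
  proof (intro cong_diff cong_sum)
    show "monom_word [Vertex v, Vertex v] \<approx> vtx v" using rel_source[of "Vertex v"] v by simp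
    show "monom_word ([Vertex v, Edge e] @ [Ghost e]) \<approx> monom_word ([Edge e] @ [Ghost e])" if "e \<in> F" for e
      using word_cong[OF rel_source[of "Edge e"], of "[]" "[Ghost e]"] F that by auto
  qed
  finally show ?thesis by (simp add: corner_def)
qed

lemma corner_vertex: "corner v F * vtx v \<approx> corner v F"
proof -
  have "corner v F * vtx v = monom_word [Vertex v, Vertex v] - (\<Sum>e\<in>F. monom_word ([Edge e] @ [Ghost e, Vertex v]))"
    by (simp add: corner_def left_diff_distrib sum_distrib_right monom_word_mult)
  also have "\<dots> \<approx> vtx v - (\<Sum>e\<in>F. monom_word ([Edge e] @ [Ghost e]))"
  proof (intro cong_diff cong_sum)
    show "monom_word [Vertex v, Vertex v] \<approx> vtx v" using rel_source[of "Vertex v"] v by simp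
    show "monom_word ([Edge e] @ [Ghost e, Vertex v]) \<approx> monom_word ([Edge e] @ [Ghost e])" if "e \<in> F" for e
      using word_cong[OF rel_target[of "Ghost e"], of "[Edge e]" "[]"] F that by auto
  qed
  finally show ?thesis by (simp add: corner_def)
qed

lemma corner_edge:
  assumes "e \<in> F"
  shows "corner v F * monom_word [Edge e] \<in> I"
proof -
  have e: "e \<in> arcs E" "tail E e = v" using assms F by auto
  have "corner v F * monom_word [Edge e] =
      monom_word [Vertex v, Edge e] - (\<Sum>f\<in>F. monom_word ([Edge f] @ [Ghost f, Edge e]))"
    by (simp add: corner_def left_diff_distrib sum_distrib_right monom_word_mult)
  also have "\<dots> \<approx> monom_word [Edge e] - (\<Sum>f\<in>F. if f = e then monom_word [Edge e] else 0)"
  proof (intro cong_diff cong_sum)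
    show "monom_word [Vertex v, Edge e] \<approx> monom_word [Edge e]"
      using rel_source[of "Edge e"] e by simp
    fix f assume f: "f \<in> F"
    show "monom_word ([Edge f] @ [Ghost f, Edge e]) \<approx> (if f = e then monom_word [Edge e] else 0)"
    proof (cases "f = e")
      case True
      have "monom_word ([Edge e] @ [Ghost e, Edge e]) \<approx> monom_word [Edge e, Vertex (head E e)]"
        using word_cong[OF rel_ghost_edge[of e], of "[Edge e]" "[]"] e by simp
      also have "\<dots> \<approx> monom_word [Edge e]" using rel_target[of "Edge e"] e by simp
      finally show ?thesis using True by simp
    next
      case False
      then show ?thesis
        using word_in[OF rel_ghost_edge_neq[of f e], of "[Edge f]" "[]"] e f F by (auto simp: cong_0_iff)
    qed
  qed
  also have "\<dots> = 0" using F assms by simp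
  finally show ?thesis by (simp add: cong_0_iff)
qed

text \<open>A ghost edge e* with e not starting at v is annihilated by v already; for e in F, the
  term of e in the sum turns e* into e* e e* = e*, which cancels.\<close>

lemma ghost_corner:
  assumes "e \<in> arcs E" "e \<in> F \<or> tail E e \<noteq> v"
  shows "monom_word [Ghost e] * corner v F \<in> I"
proof (cases "e \<in> F")
  case True
  have e: "tail E e = v" using True F by auto
  have "monom_word [Ghost e] * corner v F =
      monom_word [Ghost e, Vertex v] - (\<Sum>f\<in>F. monom_word ([Ghost e, Edge f] @ [Ghost f]))"
    by (simp add: corner_def right_diff_distrib sum_distrib_left monom_word_mult)
  also have "\<dots> \<approx> monom_word [Ghost e] - (\<Sum>f\<in>F. if f = e then monom_word [Ghost e] else 0)"
  proof (intro cong_diff cong_sum)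
    show "monom_word [Ghost e, Vertex v] \<approx> monom_word [Ghost e]"
      using rel_target[of "Ghost e"] e assms by simp
    fix f assume f: "f \<in> F"
    show "monom_word ([Ghost e, Edge f] @ [Ghost f]) \<approx> (if f = e then monom_word [Ghost e] else 0)"
    proof (cases "f = e")
      case True
      have "monom_word ([Ghost e, Edge e] @ [Ghost e]) \<approx> monom_word [Vertex (head E e), Ghost e]"
        using word_cong[OF rel_ghost_edge[of e], of "[]" "[Ghost e]"] assms by simp
      also have "\<dots> \<approx> monom_word [Ghost e]" using rel_source[of "Ghost e"] assms by simp
      finally show ?thesis using True by simp
    next
      case False
      then show ?thesis
        using word_in[OF rel_ghost_edge_neq[of e f], of "[]" "[Ghost f]"] assms f F by (auto simp: cong_0_iff)
    qed
  qed
  also have "\<dots> = 0" using F True by simp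
  finally show ?thesis by (simp add: cong_0_iff)
next
  case False
  then have e: "tail E e \<noteq> v" using assms by simp
  have "monom_word [Ghost e] * vtx v \<in> I"
    using word_vertex(2)[of "[Ghost e]" v] v assms e by (simp add: monom_word_mult)
  then have "monom_word [Ghost e] * vtx v * corner v F \<in> I"
    by (rule I_mult_unital(2)) (use F v in \<open>auto intro!: corner_unital\<close>)
  moreover have "monom_word [Ghost e] * (vtx v * corner v F) \<approx> monom_word [Ghost e] * corner v F"
    using assms by (intro cong_mult_left vertex_corner unital_free_monom) auto
  ultimately show ?thesis using cong_mem_iff by (simp add: mult.assoc)
qed

lemma corner_idem: "corner v F * corner v F \<approx> corner v F"
proof -
  have "corner v F * corner v F = corner v F * vtx v - (\<Sum>e\<in>F. corner v F * monom_word [Edge e] * monom_word [Ghost e])"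
    by (subst (2) corner_def) (simp add: right_diff_distrib sum_distrib_left monom_word_mult mult.assoc)
  also have "\<dots> \<approx> corner v F - (\<Sum>e\<in>F. 0)"
    using F by (intro cong_diff cong_sum corner_vertex)
      (auto simp: cong_0_iff intro!: I_mult_unital corner_edge unital_free_monom)
  finally show ?thesis by simp
qed

text \<open>The corner separates on its own: the first edge of a closed path at v either lies in F
  and is annihilated by the corner, or ends in I and hence lies in I itself.\<close>

lemma separates_corner:
  assumes live: "\<And>e. e \<in> out_arcs E v - F \<Longrightarrow> vtx (head E e) \<in> I"
  shows "separates v N (corner v F) (corner v F) (corner v F)"
proof -
  have U: "corner v F \<in> lpa_unital E" using v F by (intro corner_unital) auto
  have "corner v F * monom_word (path_word v d) * corner v F \<in> I" if d: "awalk v d v" "d \<noteq> []" for d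
  proof -
    obtain e d' where e: "d = e # d'" using d by (cases d) auto
    then have e': "e \<in> arcs E" "tail E e = v" and d': "set (map Edge d') \<subseteq> lpa_gens E"
      using d by (auto simp: awalk_Cons_iff awalk_def)
    have "corner v F * monom_word [Edge e] \<in> I"
    proof (cases "e \<in> F")
      case False
      then have "monom_word [Edge e] \<in> I" using live[of e] e' edge_in_iff by auto
      then show ?thesis using U by (rule I_mult_unital)
    qed (rule corner_edge)
    then have "corner v F * monom_word [Edge e] * monom_word (map Edge d') \<in> I"
      using unital_free_monom[OF d'] by (rule I_mult_unital(2))
    moreover have "corner v F * vtx v * (monom_word [Edge e] * monom_word (map Edge d')) \<approx>
        corner v F * (monom_word [Edge e] * monom_word (map Edge d'))"
      using e' d' by (intro cong_mult_right corner_vertex unital_free_mult unital_free_monom) auto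
    ultimately have "corner v F * vtx v * (monom_word [Edge e] * monom_word (map Edge d')) \<in> I"
      using cong_mem_iff by (simp add: mult.assoc)
    then have "corner v F * monom_word (path_word v d) \<in> I"
      by (simp add: mult.assoc monom_word_mult path_word_def e)
    then show ?thesis using U by (rule I_mult_unital)
  qed
  then show ?thesis
    using U vertex_corner corner_idem by (auto simp: separates_def)
qed

end

section \<open>Ideals with the same admissible pair\<close>

inductive_set path_span :: "('v, 'e, 'k) lpa_free set" where
  zero: "0 \<in> path_span"
| add: "awalk u p v \<Longrightarrow> x \<in> path_span \<Longrightarrow> scale c (monom_word (path_word u p)) + x \<in> path_span"

lemma path_span_path: "awalk u p v \<Longrightarrow> scale c (monom_word (path_word u p)) \<in> path_span"
  using path_span.add[OF _ path_span.zero] by simp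

lemma path_span_add: "x \<in> path_span \<Longrightarrow> y \<in> path_span \<Longrightarrow> x + y \<in> path_span"
  by (induct rule: path_span.induct) (auto simp: add.assoc intro: path_span.add)

lemma path_span_scale: "x \<in> path_span \<Longrightarrow> scale c x \<in> path_span"
  by (induct rule: path_span.induct) (auto simp: scale_add scale_scale intro: path_span.intros)

lemma path_span_carrier: "x \<in> path_span \<Longrightarrow> x \<in> lpa_carrier E"
proof (induct rule: path_span.induct)
  case (add u p v x c)
  have "path_word u p \<noteq> []" by (simp add: path_word_def)
  then show ?case
    using add path_word_gens[OF add(1)] by (intro carrier_add carrier_scale carrier_monom)
qed (rule carrier_0)

lemma path_span_vertex:
  assumes "x \<in> path_span" "v \<in> verts E"
  shows "\<exists>y\<in>path_span. x * vtx v \<approx> y"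
  using assms(1)
proof (induct rule: path_span.induct)
  case zero
  then show ?case using path_span.zero by (intro bexI[of _ 0]) auto
next
  case (add u p w x c)
  then obtain y where y: "y \<in> path_span" "x * vtx v \<approx> y" by blast
  have eq: "(scale c (monom_word (path_word u p)) + x) * vtx v =
      scale c (monom_word (path_word u p @ [Vertex v])) + x * vtx v"
    by (simp add: distrib_right scale_mult_left monom_word_mult)
  show ?case
  proof (cases "v = w")
    case True
    have "scale c (monom_word (path_word u p @ [Vertex v])) + x * vtx v \<approx> scale c (monom_word (path_word u p)) + y"
      using path_word_vertex(1)[OF add(1) assms(2) True] y by (intro cong_add cong_scale)
    then show ?thesis unfolding eq using path_span.add[OF add(1) y(1)] by blast
  next
    case False
    have "scale c (monom_word (path_word u p @ [Vertex v])) + x * vtx v \<approx> 0 + y"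
      using path_word_vertex(2)[OF add(1) assms(2) False] y by (intro cong_add) (auto simp: cong_0_iff I_scale)
    then show ?thesis unfolding eq using y(1) by auto
  qed
qed

lemma path_word_edge:
  assumes "awalk u p w" "e \<in> arcs E" "tail E e \<noteq> w"
  shows "monom_word (path_word u p @ [Edge e]) \<in> I"
proof -
  have "monom_word (path_word u p @ [Vertex (tail E e)]) \<in> I"
    using path_word_vertex(2)[OF assms(1)] assms by simp
  then have "monom_word (path_word u p @ [Vertex (tail E e), Edge e]) \<in> I"
    using word_in[of _ "[]" "[Edge e]"] assms(2) by fastforce
  moreover have "monom_word (path_word u p @ [Vertex (tail E e), Edge e]) \<approx> monom_word (path_word u p @ [Edge e])"
    using word_cong[OF rel_source[of "Edge e"], of "path_word u p" "[]"] path_word_gens[OF assms(1)] assms(2) by simp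
  ultimately show ?thesis using cong_mem_iff by blast
qed

lemma path_span_edge:
  assumes "x \<in> path_span" "e \<in> arcs E"
  shows "\<exists>y\<in>path_span. x * monom_word [Edge e] \<approx> y"
  using assms(1)
proof (induct rule: path_span.induct)
  case zero
  then show ?case using path_span.zero by (intro bexI[of _ 0]) auto
next
  case (add u p w x c)
  then obtain y where y: "y \<in> path_span" "x * monom_word [Edge e] \<approx> y" by blast
  have eq: "(scale c (monom_word (path_word u p)) + x) * monom_word [Edge e] =
      scale c (monom_word (path_word u p @ [Edge e])) + x * monom_word [Edge e]"
    by (simp add: distrib_right scale_mult_left monom_word_mult)
  show ?case
  proof (cases "tail E e = w")
    case True
    have w: "awalk u (p @ [e]) (head E e)"
      using add(1) True assms(2) by (auto simp: awalk_append_iff awalk_Cons_iff awalk_Nil_iff)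
    have "scale c (monom_word (path_word u p @ [Edge e])) + x * monom_word [Edge e] \<approx>
        scale c (monom_word (path_word u (p @ [e]))) + y"
      using y by (intro cong_add cong_scale) (auto simp: path_word_def)
    then show ?thesis unfolding eq using path_span.add[OF w y(1)] by blast
  next
    case False
    have "scale c (monom_word (path_word u p @ [Edge e])) + x * monom_word [Edge e] \<approx> 0 + y"
      using path_word_edge[OF add(1) assms(2) False] y by (intro cong_add) (auto simp: cong_0_iff I_scale)
    then show ?thesis unfolding eq using y(1) by auto
  qed
qed

lemma path_span_path_sum:
  assumes "x \<in> path_span"
  obtains k A where "finite A" "x = path_sum k A"
    "\<And>u p. (u, p) \<in> A \<Longrightarrow> k (u, p) \<noteq> 0 \<and> (\<exists>v. awalk u p v)"
proof -
  have "\<exists>k A. finite A \<and> x = path_sum k A \<and> (\<forall>(u, p)\<in>A. \<exists>v. awalk u p v)"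
    using assms
  proof (induct rule: path_span.induct)
    case zero
    then show ?case by (intro exI[of _ "\<lambda>_. 0"] exI[of _ "{}"]) (simp add: path_sum_def)
  next
    case (add u p v x c)
    then obtain k A where A: "finite A" "x = path_sum k A" "\<forall>(u, p)\<in>A. \<exists>v. awalk u p v" by blast
    \<comment> \<open>The new path may already occur in A, so its coefficient is added to the old
      one. Coefficients that become 0 are discarded only at the end; separation needs the remaining
      ones to be invertible.\<close>
    define l where "l = (\<lambda>a. (if a \<in> A then k a else 0) + (if a = (u, p) then c else 0))"
    let ?m = "\<lambda>a. monom_word (path_word (fst a) (snd a)) :: ('v, 'e, 'k) lpa_free"
    have "path_sum l (insert (u, p) A) =
        (\<Sum>a\<in>insert (u, p) A. if a \<in> A then scale (k a) (?m a) else 0)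
        + (\<Sum>a\<in>insert (u, p) A. if a = (u, p) then scale c (?m a) else 0)"
      unfolding path_sum_def sum.distrib[symmetric]
    proof (rule sum.cong[OF refl])
      fix a
      show "(case a of (u, p) \<Rightarrow> scale (l (u, p)) (monom_word (path_word u p))) =
          (if a \<in> A then scale (k a) (?m a) else 0) + (if a = (u, p) then scale c (?m a) else 0)"
        by (cases a; cases "a \<in> A"; cases "a = (u, p)") (auto simp: l_def scale_add_left)
    qed
    also have "(\<Sum>a\<in>insert (u, p) A. if a \<in> A then scale (k a) (?m a) else 0) = path_sum k A"
      unfolding path_sum_def using A(1) by (intro sum.mono_neutral_cong_right) auto
    also have "(\<Sum>a\<in>insert (u, p) A. if a = (u, p) then scale c (?m a) else 0) =
        scale c (monom_word (path_word u p))"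
      using A(1) by (subst sum.delta) auto
    finally show ?case
      using A add(1) by (intro exI[of _ l] exI[of _ "insert (u, p) A"]) (auto simp: add.commute)
  qed
  then obtain k A where A: "finite A" "x = path_sum k A" "\<forall>(u, p)\<in>A. \<exists>v. awalk u p v" by blast
  have "path_sum k A = path_sum k {a \<in> A. k a \<noteq> 0}"
    unfolding path_sum_def using A(1) by (intro sum.mono_neutral_right) auto
  then show ?thesis using A by (intro that[of "{a \<in> A. k a \<noteq> 0}" k]) auto
qed

lemma path_sum_in:
  assumes "\<And>u p. (u, p) \<in> A \<Longrightarrow> \<exists>w. awalk u p w \<and> vtx w \<in> I"
  shows "path_sum k A \<in> I"
proof -
  have "monom_word (path_word u p) \<in> I" if up: "(u, p) \<in> A" for u p
  proof -
    obtain w where w: "awalk u p w" "vtx w \<in> I" using assms[OF up] by blast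
    have "monom_word (path_word u p @ [Vertex w]) \<in> I"
      using word_in[of "[Vertex w]" "path_word u p" "[]"] w path_word_gens[OF w(1)] by simp
    moreover have "w \<in> verts E" using w by auto
    ultimately show ?thesis using path_word_vertex(1)[OF w(1)] cong_mem_iff by blast
  qed
  then show ?thesis unfolding path_sum_def by (intro I_sum) (auto intro: I_scale)
qed

text \<open>Modulo I, level d consists of the combinations of words p q* with q of length at most d.
  The recursion splits off the last ghost edge, which is what multiplication by an edge on the right
  can cancel.\<close>

primrec ghost_filtration :: "nat \<Rightarrow> ('v, 'e, 'k) lpa_free set" where
  "ghost_filtration 0 = {x. \<exists>y\<in>path_span. x \<approx> y}"
| "ghost_filtration (Suc d) = {x. \<exists>F f y. finite F \<and> F \<subseteq> arcs E \<and> (\<forall>e\<in>F. f e \<in> ghost_filtration d) \<and>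
     y \<in> path_span \<and> x \<approx> (\<Sum>e\<in>F. f e * monom_word [Ghost e]) + y}"

lemma cong_carrier: "x \<approx> y \<Longrightarrow> y \<in> lpa_carrier E \<Longrightarrow> x \<in> lpa_carrier E"
  using carrier_add[of "x - y" "lpa_gens E" y] I_closed(4)[of "x - y"] by (simp add: cong_def)

lemma filtration_carrier: "x \<in> ghost_filtration d \<Longrightarrow> x \<in> lpa_carrier E"
proof (induct d arbitrary: x)
  case 0
  then show ?case using cong_carrier path_span_carrier by auto
next
  case (Suc d)
  then obtain F f y where F: "F \<subseteq> arcs E" "\<forall>e\<in>F. f e \<in> ghost_filtration d" "y \<in> path_span"
    "x \<approx> (\<Sum>e\<in>F. f e * monom_word [Ghost e]) + y" by auto
  have "(\<Sum>e\<in>F. f e * monom_word [Ghost e]) \<in> lpa_carrier E"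
  proof (rule carrier_sum)
    fix e assume e: "e \<in> F"
    show "f e * monom_word [Ghost e] \<in> lpa_carrier E"
      by (rule carrier_mult_right[OF unital_free_monom]) (use F Suc(1) e in auto)
  qed
  then show ?case using cong_carrier[OF F(4)] carrier_add path_span_carrier[OF F(3)] by blast
qed

lemma filtration_unital: "x \<in> ghost_filtration d \<Longrightarrow> x \<in> lpa_unital E"
  using filtration_carrier carrier_subset_unital by blast

lemma filtration_cong: "x \<approx> y \<Longrightarrow> y \<in> ghost_filtration d \<Longrightarrow> x \<in> ghost_filtration d"
  by (cases d) (auto dest: cong_trans)

lemma path_span_filtration: "y \<in> path_span \<Longrightarrow> y \<in> ghost_filtration d"
  by (cases d) (force intro: exI[of _ "{}"])+

lemma filtration_add: "x \<in> ghost_filtration d \<Longrightarrow> y \<in> ghost_filtration d \<Longrightarrow> x + y \<in> ghost_filtration d"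
proof (induct d arbitrary: x y)
  case 0
  then obtain x' y' where "x' \<in> path_span" "x \<approx> x'" "y' \<in> path_span" "y \<approx> y'" by auto
  then show ?case using path_span_add[of x' y'] cong_add[of x x' y y'] by auto
next
  case (Suc d)
  obtain F f u where F: "finite F" "F \<subseteq> arcs E" "\<forall>e\<in>F. f e \<in> ghost_filtration d" "u \<in> path_span"
    "x \<approx> (\<Sum>e\<in>F. f e * monom_word [Ghost e]) + u" using Suc(2) by auto
  obtain G g v where G: "finite G" "G \<subseteq> arcs E" "\<forall>e\<in>G. g e \<in> ghost_filtration d" "v \<in> path_span"
    "y \<approx> (\<Sum>e\<in>G. g e * monom_word [Ghost e]) + v" using Suc(3) by auto
  define h where "h e = (if e \<in> F then f e else 0) + (if e \<in> G then g e else 0)" for e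
  have "(\<Sum>e\<in>F \<union> G. h e * monom_word [Ghost e]) =
      (\<Sum>e\<in>F \<union> G. (if e \<in> F then f e * monom_word [Ghost e] else 0))
      + (\<Sum>e\<in>F \<union> G. (if e \<in> G then g e * monom_word [Ghost e] else 0))"
    unfolding sum.distrib[symmetric] by (intro sum.cong) (auto simp: h_def distrib_right)
  also have "(\<Sum>e\<in>F \<union> G. (if e \<in> F then f e * monom_word [Ghost e] else 0)) = (\<Sum>e\<in>F. f e * monom_word [Ghost e])"
    using F(1) G(1) by (intro sum.mono_neutral_cong_right) auto
  also have "(\<Sum>e\<in>F \<union> G. (if e \<in> G then g e * monom_word [Ghost e] else 0)) = (\<Sum>e\<in>G. g e * monom_word [Ghost e])"
    using F(1) G(1) by (intro sum.mono_neutral_cong_right) auto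
  finally have "x + y \<approx> (\<Sum>e\<in>F \<union> G. h e * monom_word [Ghost e]) + (u + v)"
    using cong_add[OF F(5) G(5)] by (simp add: algebra_simps)
  moreover have "h e \<in> ghost_filtration d" if "e \<in> F \<union> G" for e
    using that F(3) G(3) Suc(1) path_span_filtration[OF path_span.zero] by (auto simp: h_def)
  ultimately show ?case
    unfolding ghost_filtration.simps using F G path_span_add
    by (intro CollectI exI[of _ "F \<union> G"] exI[of _ h] exI[of _ "u + v"]) auto
qed

lemma filtration_scale: "x \<in> ghost_filtration d \<Longrightarrow> scale c x \<in> ghost_filtration d"
proof (induct d arbitrary: x)
  case 0
  then obtain x' where "x' \<in> path_span" "x \<approx> x'" by auto
  then show ?case using path_span_scale[of x' c] cong_scale[of x x' c] by auto
next
  case (Suc d)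
  then obtain F f u where F: "finite F" "F \<subseteq> arcs E" "\<forall>e\<in>F. f e \<in> ghost_filtration d" "u \<in> path_span"
    "x \<approx> (\<Sum>e\<in>F. f e * monom_word [Ghost e]) + u" by auto
  have "scale c x \<approx> (\<Sum>e\<in>F. scale c (f e) * monom_word [Ghost e]) + scale c u"
    using cong_scale[OF F(5), of c] by (simp add: scale_add scale_sum scale_mult_left)
  then show ?case
    unfolding ghost_filtration.simps using F Suc(1) path_span_scale[OF F(4)]
    by (intro CollectI exI[of _ F] exI[of _ "\<lambda>e. scale c (f e)"] exI[of _ "scale c u"]) auto
qed

lemma filtration_Suc: "x \<in> ghost_filtration d \<Longrightarrow> x \<in> ghost_filtration (Suc d)"
proof (induct d arbitrary: x)
  case 0
  then obtain y where "y \<in> path_span" "x \<approx> y" by auto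
  then show ?case using filtration_cong path_span_filtration by blast
next
  case (Suc d)
  then obtain F f u where F: "finite F" "F \<subseteq> arcs E" "\<forall>e\<in>F. f e \<in> ghost_filtration d" "u \<in> path_span"
    "x \<approx> (\<Sum>e\<in>F. f e * monom_word [Ghost e]) + u" by auto
  have "\<forall>e\<in>F. f e \<in> ghost_filtration (Suc d)" using F(3) Suc(1) by blast
  then show ?case
    unfolding ghost_filtration.simps(2)[of "Suc d"] using F(1,2,4,5) by blast
qed

lemma filtration_mono: "d \<le> d' \<Longrightarrow> x \<in> ghost_filtration d \<Longrightarrow> x \<in> ghost_filtration d'"
  by (induct rule: dec_induct) (auto intro: filtration_Suc simp del: ghost_filtration.simps)

lemma filtration_vertex:
  assumes "x \<in> ghost_filtration d" "v \<in> verts E"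
  shows "x * vtx v \<in> ghost_filtration d"
proof -
  have vU: "vtx v \<in> lpa_unital E" using assms by (auto intro: unital_free_monom)
  show ?thesis
  proof (cases d)
    case 0
    then obtain y where y: "y \<in> path_span" "x \<approx> y" using assms by auto
    obtain z where "z \<in> path_span" "y * vtx v \<approx> z" using path_span_vertex[OF y(1) assms(2)] by blast
    then show ?thesis using cong_mult_right[OF y(2) vU] cong_trans 0 by auto
  next
    case (Suc d')
    obtain F f u where F: "finite F" "F \<subseteq> arcs E" "\<forall>e\<in>F. f e \<in> ghost_filtration d'" "u \<in> path_span"
      "x \<approx> (\<Sum>e\<in>F. f e * monom_word [Ghost e]) + u" using assms Suc by auto
    obtain z where z: "z \<in> path_span" "u * vtx v \<approx> z" using path_span_vertex[OF F(4) assms(2)] by blast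
    have "x * vtx v \<approx> ((\<Sum>e\<in>F. f e * monom_word [Ghost e]) + u) * vtx v"
      using cong_mult_right[OF F(5) vU] .
    also have "\<dots> = (\<Sum>e\<in>F. f e * monom_word [Ghost e, Vertex v]) + u * vtx v"
      by (simp add: distrib_right sum_distrib_right mult.assoc monom_word_mult)
    also have "\<dots> \<approx> (\<Sum>e\<in>F. if tail E e = v then f e * monom_word [Ghost e] else 0) + z"
    proof (intro cong_add cong_sum z(2))
      fix e assume e: "e \<in> F"
      have fU: "f e \<in> lpa_unital E" using F(3) e filtration_unital by blast
      show "f e * monom_word [Ghost e, Vertex v] \<approx> (if tail E e = v then f e * monom_word [Ghost e] else 0)"
      proof (cases "tail E e = v")
        case True
        then show ?thesis using cong_mult_left[OF rel_target[of "Ghost e"] fU] e F(2) by auto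
      next
        case False
        then have "monom_word [Ghost e, Vertex v] \<in> I"
          using word_vertex(2)[of "[Ghost e]" v] e F(2) assms(2) by auto
        then show ?thesis using False I_mult_unital(1)[OF _ fU] by (simp add: cong_0_iff)
      qed
    qed
    also have "\<dots> = (\<Sum>e\<in>{e\<in>F. tail E e = v}. f e * monom_word [Ghost e]) + z"
      using F(1) by (simp add: sum.inter_filter)
    finally have "x * vtx v \<approx> (\<Sum>e\<in>{e\<in>F. tail E e = v}. f e * monom_word [Ghost e]) + z" .
    then show ?thesis
      unfolding Suc ghost_filtration.simps using F z(1)
      by (intro CollectI exI[of _ "{e\<in>F. tail E e = v}"] exI[of _ f] exI[of _ z]) auto
  qed
qed

lemma filtration_edge_sum:
  assumes "finite F" "F \<subseteq> arcs E" "\<And>e. e \<in> F \<Longrightarrow> f e \<in> lpa_unital E" "g \<in> arcs E"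
  shows "(\<Sum>e\<in>F. f e * monom_word [Ghost e]) * monom_word [Edge g] \<approx>
    (if g \<in> F then f g * vtx (head E g) else 0)"
proof -
  have "(\<Sum>e\<in>F. f e * monom_word [Ghost e]) * monom_word [Edge g] = (\<Sum>e\<in>F. f e * monom_word [Ghost e, Edge g])"
    by (simp add: sum_distrib_right mult.assoc monom_word_mult)
  also have "\<dots> \<approx> (\<Sum>e\<in>F. if e = g then f e * vtx (head E g) else 0)"
  proof (rule cong_sum)
    fix e assume e: "e \<in> F"
    show "f e * monom_word [Ghost e, Edge g] \<approx> (if e = g then f e * vtx (head E g) else 0)"
    proof (cases "e = g")
      case True
      then show ?thesis using cong_mult_left[OF rel_ghost_edge[of g] assms(3)[OF e]] assms(4) by simp
    next
      case False
      then have "monom_word [Ghost e, Edge g] \<in> I" using rel_ghost_edge_neq e assms by blast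
      then show ?thesis using False I_mult_unital(1)[OF _ assms(3)[OF e]] by (simp add: cong_0_iff)
    qed
  qed
  also have "\<dots> = (if g \<in> F then f g * vtx (head E g) else 0)"
    using assms(1) by simp
  finally show ?thesis .
qed

text \<open>As e* g is r(g) or 0, multiplication by g selects one of the coefficients
  \<open>f e\<close> and thereby lowers the level; the induction of \<open>ideal_eqI\<close> rests
  on this.\<close>

lemma filtration_edge:
  assumes "g \<in> arcs E"
  shows "x \<in> ghost_filtration (Suc d) \<Longrightarrow> x * monom_word [Edge g] \<in> ghost_filtration d"
    and "x \<in> ghost_filtration d \<Longrightarrow> x * monom_word [Edge g] \<in> ghost_filtration d"
proof -
  have gU: "monom_word [Edge g] \<in> lpa_unital E" using assms by (auto intro: unital_free_monom)
  show *: "x * monom_word [Edge g] \<in> ghost_filtration d" if x: "x \<in> ghost_filtration (Suc d)" for x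
  proof -
    obtain F f u where F: "finite F" "F \<subseteq> arcs E" "\<forall>e\<in>F. f e \<in> ghost_filtration d" "u \<in> path_span"
      "x \<approx> (\<Sum>e\<in>F. f e * monom_word [Ghost e]) + u" using x by auto
    obtain z where z: "z \<in> path_span" "u * monom_word [Edge g] \<approx> z" using path_span_edge[OF F(4) assms] by blast
    have "x * monom_word [Edge g] \<approx> (\<Sum>e\<in>F. f e * monom_word [Ghost e]) * monom_word [Edge g] + u * monom_word [Edge g]"
      using cong_mult_right[OF F(5) gU] by (simp add: distrib_right)
    also have "\<dots> \<approx> (if g \<in> F then f g * vtx (head E g) else 0) + z"
      using filtration_edge_sum[OF F(1,2) _ assms, of f] F(3) filtration_unital z(2) by (intro cong_add) blast+
    finally have 1: "x * monom_word [Edge g] \<approx> (if g \<in> F then f g * vtx (head E g) else 0) + z" .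
    have "(if g \<in> F then f g * vtx (head E g) else 0) \<in> ghost_filtration d"
      using F(3) filtration_vertex assms path_span_filtration[OF path_span.zero] by auto
    then show ?thesis
      using filtration_cong[OF 1] filtration_add path_span_filtration[OF z(1)] by blast
  qed
  show "x * monom_word [Edge g] \<in> ghost_filtration d" if "x \<in> ghost_filtration d"
    using *[OF filtration_Suc[OF that]] .
qed

lemma filtration_ghost:
  assumes "x \<in> ghost_filtration d" "g \<in> arcs E"
  shows "x * monom_word [Ghost g] \<in> ghost_filtration (Suc d)"
  unfolding ghost_filtration.simps using assms path_span.zero
  by (intro CollectI exI[of _ "{g}"] exI[of _ "\<lambda>_. x"] exI[of _ 0]) auto

lemma filtration_exhaustive:
  assumes "x \<in> lpa_carrier E"
  obtains d where "x \<in> ghost_filtration d"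
proof -
  have word: "\<exists>d. monom_word w \<in> ghost_filtration d" if "w \<noteq> []" "set w \<subseteq> lpa_gens E" for w
    using that
  proof (induct w rule: rev_induct)
    case (snoc g w)
    have "\<exists>d. monom_word (w @ [g]) \<in> ghost_filtration d" if x: "monom_word w \<in> ghost_filtration d" for d
    proof -
      have "monom_word w * monom_word [g] \<in> ghost_filtration (Suc d)"
        \<comment> \<open>Only a ghost edge raises the level; vertices and edges are lifted to level
          d + 1 as well, so that all generators are treated alike.\<close>
        using filtration_vertex[OF filtration_Suc[OF x]] filtration_edge(1)[OF _ filtration_Suc[OF filtration_Suc[OF x]]]
          filtration_ghost[OF x] snoc(3)
        by (cases g) (simp_all del: ghost_filtration.simps)
      then show ?thesis by (auto simp: monom_word_mult simp del: ghost_filtration.simps)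
    qed
    \<comment> \<open>Path words begin with a vertex, so a one-letter word is first given its source
      as a path of length 0.\<close>
    moreover have "\<exists>d. monom_word [g] \<in> ghost_filtration d" if "w = []"
    proof -
      define s where "s = gen_source E g"
      have s: "s \<in> verts E" using gen_source_in snoc(3) by (auto simp: s_def)
      have "scale 1 (monom_word (path_word s [])) \<in> path_span"
        using s by (intro path_span_path) (simp add: awalk_Nil_iff)
      then have x: "vtx s \<in> ghost_filtration 0"
        using path_span_filtration by (simp add: path_word_def del: ghost_filtration.simps)
      have "vtx s * monom_word [g] \<in> ghost_filtration (Suc 0)"
        using filtration_vertex[OF filtration_Suc[OF x]] filtration_edge(1)[OF _ filtration_Suc[OF filtration_Suc[OF x]]]
          filtration_ghost[OF x] snoc(3)
        by (cases g) (simp_all del: ghost_filtration.simps)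
      moreover have "monom_word [g] \<approx> vtx s * monom_word [g]"
        using cong_sym[OF rel_source[of g]] snoc(3) by (simp add: monom_word_mult s_def)
      ultimately show ?thesis using filtration_cong by blast
    qed
    ultimately show ?case using snoc by (cases "w = []") (auto simp del: ghost_filtration.simps)
  qed simp
  have "\<exists>d. x \<in> ghost_filtration d"
    using assms
  proof (induct x rule: carrier_induct)
    case zero
    show ?case using path_span_filtration[OF path_span.zero] by blast
  next
    case (add p q)
    then obtain a b where "p \<in> ghost_filtration a" "q \<in> ghost_filtration b" by blast
    then have "p \<in> ghost_filtration (max a b)" "q \<in> ghost_filtration (max a b)"
      using filtration_mono[of a "max a b"] filtration_mono[of b "max a b"] by simp_all
    then show ?case using filtration_add by blast
  next
    case (scale c w)
    then show ?case using word filtration_scale by blast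
  qed
  then show ?thesis using that by blast
qed

text \<open>N is the largest length of a path in A. The right factor r is fixed in advance while q
  may depend on N; r is 1, an edge or a corner in the three uses below.\<close>

lemma separated_target:
  assumes A: "finite A" "\<And>u p. (u, p) \<in> A \<Longrightarrow> k (u, p) \<noteq> 0 \<and> (\<exists>v. awalk u p v)"
    and I: "path_sum k A * r \<in> I" and up: "(u, p) \<in> A" "awalk u p w"
    and sep: "\<And>N. \<exists>q' q. q \<in> lpa_unital E \<and> separates w N q' (r * q) \<eta>"
  shows "\<eta> \<in> I"
proof -
  define N where "N = Max ((\<lambda>(u, p). length p) ` A)"
  obtain q' q where sep: "q \<in> lpa_unital E" "separates w N q' (r * q) \<eta>" using sep by blast
  have "path_sum k A * (r * q) \<in> I"
    using I_mult_unital(2)[OF I sep(1)] by (simp add: mult.assoc)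
  moreover have "length p \<le> N" if "(u, p) \<in> A" for u p
    unfolding N_def using A(1) that by (intro Max_ge) force+
  ultimately show ?thesis
    using separates_path_sum[OF A(1) _ sep(2), of k u p] A(2) up by blast
qed

lemma path_sum_target:
  assumes K: "condition_K E"
    and A: "finite A" "\<And>u p. (u, p) \<in> A \<Longrightarrow> k (u, p) \<noteq> 0 \<and> (\<exists>v. awalk u p v)"
    and I: "path_sum k A \<in> I" and up: "(u, p) \<in> A" "awalk u p w"
  shows "vtx w \<in> I"
proof (rule separated_target[OF A _ up])
  show "path_sum k A * 1 \<in> I" using I by simp
  show "\<exists>q' q. q \<in> lpa_unital E \<and> separates w N q' (1 * q) (vtx w)" for N
    using condition_K_separates[OF K awalk_last_in_verts[OF up(2)], of N]
    by (metis mult_1 separates_def)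
qed

text \<open>For vertices with infinitely many live edges, where only the product of the combination
  with a single edge is known to lie in I.\<close>

lemma path_sum_edge_target:
  assumes K: "condition_K E"
    and A: "finite A" "\<And>u p. (u, p) \<in> A \<Longrightarrow> k (u, p) \<noteq> 0 \<and> (\<exists>v. awalk u p v)"
    and e: "e \<in> arcs E"
    and I: "path_sum k A * monom_word [Edge e] \<in> I" and up: "(u, p) \<in> A" "awalk u p (tail E e)"
  shows "vtx (head E e) \<in> I"
proof (rule separated_target[OF A I up])
  show "\<exists>q' q. q \<in> lpa_unital E \<and> separates (tail E e) N q' (monom_word [Edge e] * q) (vtx (head E e))" for N
    using condition_K_separates[OF K head_in_verts[OF e], of N] separates_edge[OF e]
    by (metis separates_def)
qed

lemma path_sum_corner_target:
  assumes A: "finite A" "\<And>u p. (u, p) \<in> A \<Longrightarrow> k (u, p) \<noteq> 0 \<and> (\<exists>v. awalk u p v)"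
    and F: "finite F" "F \<subseteq> out_arcs E w" "\<And>e. e \<in> out_arcs E w - F \<Longrightarrow> vtx (head E e) \<in> I"
    and I: "path_sum k A * corner w F \<in> I" and up: "(u, p) \<in> A" "awalk u p w"
  shows "corner w F \<in> I"
proof (rule separated_target[OF A I up])
  have "separates w N (corner w F) (corner w F * 1) (corner w F)" for N
    using separates_corner[OF _ F] awalk_last_in_verts[OF up(2)] by simp
  moreover have "1 \<in> lpa_unital E"
    using unital_free_monom[of "[]"] by (simp add: monom_word_Nil)
  ultimately show "\<exists>q' q. q \<in> lpa_unital E \<and> separates w N q' (corner w F * q) (corner w F)" for N
    by blast
qed

lemma path_sum_corner_in:
  assumes F: "w \<in> verts E" "finite F" "F \<subseteq> out_arcs E w"
    and A: "\<And>u p. (u, p) \<in> A \<Longrightarrow> \<exists>v. awalk u p v \<and> v \<noteq> w"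
  shows "path_sum k A * corner w F \<in> I"
proof -
  have U: "corner w F \<in> lpa_unital E" using F by (intro corner_unital) auto
  have "monom_word (path_word u p) * corner w F \<in> I" if up: "(u, p) \<in> A" for u p
  proof -
    obtain v where v: "awalk u p v" "v \<noteq> w" using A[OF up] by blast
    have "monom_word (path_word u p) * vtx w * corner w F \<in> I"
      using path_word_vertex(2)[OF v(1) F(1)] v(2) U
      by (intro I_mult_unital(2)[of "_ * vtx w"]) (auto simp: monom_word_mult)
    moreover have "monom_word (path_word u p) * (vtx w * corner w F) \<approx> monom_word (path_word u p) * corner w F"
      using path_word_gens[OF v(1)] F by (intro cong_mult_left vertex_corner unital_free_monom)
    ultimately show ?thesis using cong_mem_iff by (simp add: mult.assoc)
  qed
  then have "(\<Sum>(u, p)\<in>A. scale (k (u, p)) (monom_word (path_word u p) * corner w F)) \<in> I"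
    by (intro I_sum) (auto intro: I_scale)
  then show ?thesis
    by (simp add: path_sum_def sum_distrib_right scale_mult_left case_prod_unfold)
qed

end

text \<open>If \<open>J\<close> were larger than \<open>I\<close>, some element of \<open>J - I\<close> could be multiplied to a vertex, or to an
  element $v^H$, outside \<open>I\<close>.\<close>

theorem ideal_eqI:
  fixes I J :: "('v, 'e, 'k::field) lpa_free set"
  assumes K: "condition_K E" and I: "lpa_ideal E I" and J: "lpa_ideal E J" and "I \<subseteq> J"
    and verts: "ideal_verts E I = ideal_verts E J"
    and breaking: "ideal_breaking E I = ideal_breaking E J"
  shows "I = J"
proof -
  interpret I: lpa_ideal E I by fact
  interpret J: lpa_ideal E J by fact
  have vtxI: "monom_word [Vertex w] \<in> I" if "monom_word [Vertex w] \<in> J" "w \<in> verts E" for w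
    using that verts by (auto simp: ideal_verts_def)
  \<comment> \<open>Elements without ghost edges: by Condition (K) every path occurring in one has
    its end vertex in J, hence in I, so each single term lies in I.\<close>
  have base: "x \<in> I" if x: "x \<in> J" "x \<in> I.ghost_filtration 0" for x
  proof -
    obtain y where y: "y \<in> I.path_span" "I.cong x y" using x by auto
    obtain k A where A: "finite A" "y = I.path_sum k A"
      "\<And>u p. (u, p) \<in> A \<Longrightarrow> k (u, p) \<noteq> 0 \<and> (\<exists>v. I.awalk u p v)"
      using I.path_span_path_sum[OF y(1)] by metis
    have "y \<in> J"
      using J.I_diff[OF x(1), of "x - y"] y(2) \<open>I \<subseteq> J\<close> by (auto simp: I.cong_def)
    have "y \<in> I" unfolding A(2)
    proof (rule I.path_sum_in)
      fix u p assume up: "(u, p) \<in> A"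
      then obtain v where v: "I.awalk u p v" using A(3) by blast
      have "monom_word [Vertex v] \<in> J"
        using J.path_sum_target[OF K A(1,3) _ up v] A(2) \<open>y \<in> J\<close> by simp
      then show "\<exists>v. I.awalk u p v \<and> monom_word [Vertex v] \<in> I"
        using v vtxI I.awalk_last_in_verts by blast
    qed
    then show ?thesis using I.cong_mem[OF y(2)] by blast
  qed
  have "x \<in> I" if "x \<in> I.ghost_filtration d" "x \<in> J" for d x
    using that
  proof (induct d arbitrary: x)
    case 0
    then show ?case using base by blast
  next
    case (Suc d)
    have xU: "x \<in> lpa_unital E" using I.filtration_unital Suc(2) by blast
    \<comment> \<open>An edge on the right lowers the level, so the induction hypothesis applies.
      Knowing all x e, it remains to treat x w for single vertices w.\<close>
    have xe: "x * monom_word [Edge e] \<in> I" if "e \<in> arcs E" for e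
      using Suc(1) I.filtration_edge(1)[OF that Suc(2)] J.I_mult_word(2)[OF Suc(3), of "[Edge e]"] that by simp
    have xee: "(\<Sum>e\<in>G. x * monom_word [Edge e, Ghost e]) \<in> I" if "G \<subseteq> arcs E" for G
    proof (rule I.I_sum)
      fix e assume "e \<in> G"
      then have "e \<in> arcs E" using that by blast
      then have "x * monom_word [Edge e] * monom_word [Ghost e] \<in> I"
        using I.I_mult_word(2)[OF xe[of e], of "[Ghost e]"] by simp
      then show "x * monom_word [Edge e, Ghost e] \<in> I" by (simp add: monom_word_mult mult.assoc)
    qed
    obtain F f y where F: "finite F" "F \<subseteq> arcs E" "\<forall>e\<in>F. f e \<in> I.ghost_filtration d" "y \<in> I.path_span"
      "I.cong x ((\<Sum>e\<in>F. f e * monom_word [Ghost e]) + y)" using Suc(2) by auto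
    obtain k A where A: "finite A" "y = I.path_sum k A"
      "\<And>u p. (u, p) \<in> A \<Longrightarrow> k (u, p) \<noteq> 0 \<and> (\<exists>v. I.awalk u p v)"
      using I.path_span_path_sum[OF F(4)] by metis
    have yU: "y \<in> lpa_unital E" using I.path_span_carrier[OF F(4)] carrier_subset_unital by blast
    \<comment> \<open>Modulo I the factor w may be replaced by any corner at w, since the x e e* lie
      in I. If G contains the edges of F at w, that corner annihilates the whole ghost part of x and
      leaves the combination of paths y.\<close>
    have corner: "I.cong (x * monom_word [Vertex w]) (y * corner w G)"
      if w: "w \<in> verts E" and G: "finite G" "G \<subseteq> out_arcs E w" "{e \<in> F. tail E e = w} \<subseteq> G" for w G
    proof -
      have GE: "G \<subseteq> arcs E" using G(2) by auto
      have cU: "corner w G \<in> lpa_unital E" using w G by (intro corner_unital) auto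
      have "x * monom_word [Vertex w] - x * corner w G \<in> I"
        using xee[OF GE] by (simp add: corner_def right_diff_distrib sum_distrib_left)
      then have "I.cong (x * monom_word [Vertex w]) (x * corner w G)" by (simp add: I.cong_def)
      also have "I.cong (x * corner w G) (((\<Sum>e\<in>F. f e * monom_word [Ghost e]) + y) * corner w G)"
        by (rule I.cong_mult_right[OF F(5) cU])
      also have "((\<Sum>e\<in>F. f e * monom_word [Ghost e]) + y) * corner w G =
          (\<Sum>e\<in>F. f e * (monom_word [Ghost e] * corner w G)) + y * corner w G"
        by (simp add: distrib_right sum_distrib_right mult.assoc)
      also have "I.cong \<dots> (0 + y * corner w G)"
      proof (intro I.cong_add I.cong_refl)
        have "(\<Sum>e\<in>F. f e * (monom_word [Ghost e] * corner w G)) \<in> I"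
        proof (rule I.I_sum)
          fix e assume e: "e \<in> F"
          then have "monom_word [Ghost e] * corner w G \<in> I"
            using F(2) G(3) by (intro I.ghost_corner[OF w G(1,2)]) auto
          then show "f e * (monom_word [Ghost e] * corner w G) \<in> I"
            by (rule I.I_mult_unital(1)) (use F(3) e I.filtration_unital in blast)
        qed
        then show "I.cong (\<Sum>e\<in>F. f e * (monom_word [Ghost e] * corner w G)) 0"
          by (simp add: I.cong_0_iff)
      qed
      finally show ?thesis by simp
    qed
    have "x * monom_word [Vertex w] \<in> I" if w: "w \<in> verts E" for w
    proof (cases "w \<in> ideal_verts E I")
      case True
      then show ?thesis using I.I_mult_unital(1)[OF _ xU] by (auto simp: ideal_verts_def)
    next
      case False
      then have wI: "monom_word [Vertex w] \<notin> I" using w by (simp add: ideal_verts_def)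
      let ?L = "live_arcs E (ideal_verts E I) w"
      have not_live: "monom_word [Vertex (head E e)] \<in> I" if "e \<in> out_arcs E w - ?L" for e
        using that by (auto simp: live_arcs_def ideal_verts_def)
      have avoid: "y * corner w G \<in> I"
        if G: "finite G" "G \<subseteq> out_arcs E w" and none: "\<not> (\<exists>(u, p)\<in>A. I.awalk u p w)" for G
        unfolding A(2)
      proof (rule I.path_sum_corner_in[OF w G])
        fix u p assume up: "(u, p) \<in> A"
        then obtain v where "I.awalk u p v" using A(3) by blast
        then show "\<exists>v. I.awalk u p v \<and> v \<noteq> w" using none up by blast
      qed
      show ?thesis
      \<comment> \<open>A regular w is the sum of its e e*, so x w follows from the x e. Otherwise
        it matters whether w has finitely many live edges.\<close>
      proof (cases "regular_vertex E w")
        case True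
        have "I.cong (x * monom_word [Vertex w]) (x * (\<Sum>e\<in>out_arcs E w. monom_word [Edge e, Ghost e]))"
          by (rule I.cong_mult_left[OF I.rel_regular[OF True] xU])
        moreover have "x * (\<Sum>e\<in>out_arcs E w. monom_word [Edge e, Ghost e]) \<in> I"
          using xee[of "out_arcs E w"] by (simp add: sum_distrib_left subset_eq)
        ultimately show ?thesis using I.cong_mem by blast
      next
        case not_reg: False
        let ?F = "{e \<in> F. tail E e = w}"
        have F': "finite ?F" "?F \<subseteq> out_arcs E w" using F(1,2) by auto
        show ?thesis
        proof (cases "finite ?L")
          case True
          have G: "finite (?F \<union> ?L)" "?F \<union> ?L \<subseteq> out_arcs E w"
            using F' True live_arcs_subset[of E _ w] by simp_all
          \<comment> \<open>The edges of F at w are needed to remove the ghost part; those that are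
            not live may then be dropped from the corner, because their e e* lies in I.\<close>
          have "I.cong (x * monom_word [Vertex w]) (y * corner w (?F \<union> ?L))"
            using corner[OF w G] by blast
          also have "I.cong \<dots> (y * corner w ?L)"
            by (intro I.cong_mult_left I.corner_cong yU) (use G not_live in auto)
          finally have 1: "I.cong (x * monom_word [Vertex w]) (y * corner w ?L)" .
          have xJ: "x * monom_word [Vertex w] \<in> J"
            using J.I_mult_word(2)[OF Suc(3), of "[Vertex w]"] w by simp
          have yJ: "y * corner w ?L \<in> J"
            using J.I_diff[OF xJ, of "x * monom_word [Vertex w] - y * corner w ?L"] 1 \<open>I \<subseteq> J\<close>
            by (auto simp: I.cong_def)
          have "y * corner w ?L \<in> I"
          proof (cases "?L = {}")
            case True
            \<comment> \<open>Without live edges the corner is w itself, and y w has no ghost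
              edges.\<close>
            then have "y * monom_word [Vertex w] \<in> J" using yJ by (simp add: corner_def)
            moreover have "y * monom_word [Vertex w] \<in> I.ghost_filtration 0"
              using I.filtration_vertex[OF I.path_span_filtration[OF F(4)] w] .
            ultimately show ?thesis using base True by (simp add: corner_def)
          next
            case False
            show ?thesis
            proof (cases "\<exists>(u, p)\<in>A. I.awalk u p w")
              case True
              then obtain u p where up: "(u, p) \<in> A" "I.awalk u p w" by blast
              have "corner w ?L \<in> J"
              proof (rule J.path_sum_corner_target[OF A(1,3) \<open>finite ?L\<close> live_arcs_subset _ _ up])
                show "monom_word [Vertex (head E e)] \<in> J" if "e \<in> out_arcs E w - ?L" for e
                  using not_live[OF that] \<open>I \<subseteq> J\<close> by blast
                show "J.path_sum k A * corner w ?L \<in> J" using yJ A(2) by simp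
              qed
              \<comment> \<open>An irregular vertex with a live edge is an infinite emitter, hence
                breaking here, so its v^H passes from J to I by the equality of the pairs.\<close>
              moreover have "infinite (out_arcs E w)"
                using not_reg False live_arcs_subset w by (force simp: regular_vertex_def)
              then have "w \<in> breaking_vertices E (ideal_verts E I)"
                using w \<open>w \<notin> ideal_verts E I\<close> \<open>finite ?L\<close> False by (simp add: breaking_vertices_iff)
              ultimately have "w \<in> ideal_breaking E J" using verts by (simp add: ideal_breaking_def)
              then have "corner w ?L \<in> I" using breaking by (auto simp: ideal_breaking_def)
              then show ?thesis using I.I_mult_unital(1) yU by blast
            next
              case False
              then show ?thesis using avoid[OF \<open>finite ?L\<close> live_arcs_subset] by blast
            qed
          qed
          then show ?thesis using I.cong_mem[OF 1] by blast
        next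
          case False
          then have "\<not> ?L \<subseteq> ?F" using F'(1) finite_subset by blast
          \<comment> \<open>One of the infinitely many live edges avoids F. For it x e = y e modulo
            I, so a path of y ending at w would force r(e) into I; hence no path of y ends at w, and
            y times the corner vanishes.\<close>
          then obtain e where e: "e \<in> arcs E" "tail E e = w" "head E e \<notin> ideal_verts E I" "e \<notin> F"
            by (auto simp: live_arcs_def)
          have eU: "monom_word [Edge e] \<in> lpa_unital E" using e by (auto intro: unital_free_monom)
          have "I.cong (x * monom_word [Edge e]) ((\<Sum>e\<in>F. f e * monom_word [Ghost e]) * monom_word [Edge e] + y * monom_word [Edge e])"
            using I.cong_mult_right[OF F(5) eU] by (simp add: distrib_right)
          also have "I.cong \<dots> ((if e \<in> F then f e * monom_word [Vertex (head E e)] else 0) + y * monom_word [Edge e])"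
            using I.filtration_edge_sum[OF F(1,2) _ e(1), of f] F(3) I.filtration_unital
            by (intro I.cong_add I.cong_refl) blast+
          finally have "I.cong (x * monom_word [Edge e]) (y * monom_word [Edge e])" using e(4) by simp
          then have ye: "y * monom_word [Edge e] \<in> I" using xe[OF e(1)] I.cong_mem_iff by blast
          have "\<not> (\<exists>(u, p)\<in>A. I.awalk u p w)"
          proof
            assume "\<exists>(u, p)\<in>A. I.awalk u p w"
            then obtain u p where up: "(u, p) \<in> A" "I.awalk u p (tail E e)" using e(2) by blast
            then have "monom_word [Vertex (head E e)] \<in> I"
              using I.path_sum_edge_target[OF K A(1,3) e(1) _ up] ye A(2) by simp
            then show False using e(1,3) by (simp add: ideal_verts_def)
          qed
          then have "y * corner w ?F \<in> I" using avoid[OF F'] by blast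
          then show ?thesis using I.cong_mem[OF corner[OF w F']] by blast
        qed
      qed
    qed
    note xw = this
    obtain W where W: "W \<subseteq> verts E" "I.cong (\<Sum>w\<in>W. x * monom_word [Vertex w]) x"
      using I.local_unit_right[OF I.filtration_carrier[OF Suc(2)]] by blast
    have "(\<Sum>w\<in>W. x * monom_word [Vertex w]) \<in> I" using xw W(1) by (intro I.I_sum) blast
    then show ?case using W(2) I.cong_mem_iff by blast
  qed
  moreover have "\<exists>d. x \<in> I.ghost_filtration d" if "x \<in> J" for x
    using I.filtration_exhaustive J.I_closed(4)[OF that] by metis
  ultimately show ?thesis using \<open>I \<subseteq> J\<close> by blast
qed

section \<open>Ideals from representations\<close>

lemma lookup_scale: "Poly_Mapping.lookup (scale c p) w = c * Poly_Mapping.lookup p w"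
  unfolding scale_def by (simp add: map.rep_eq when_def flip: mult_map_scale_conv_mult)

text \<open>Linear operators on functions, one for each generator and subject to no relations,
  extend to the free algebra; the relations enter only in \<open>annihilator_ideal\<close>.\<close>

locale free_representation = module sc
  for sc :: "'k::field \<Rightarrow> 'w::ab_group_add \<Rightarrow> 'w" +
  fixes gen_op :: "('v, 'e) lpa_gen \<Rightarrow> ('x \<Rightarrow> 'w) \<Rightarrow> 'x \<Rightarrow> 'w"
  assumes gen_op_add: "gen_op g (\<lambda>x. f x + h x) = (\<lambda>x. gen_op g f x + gen_op g h x)"
    and gen_op_scale: "gen_op g (\<lambda>x. sc c (f x)) = (\<lambda>x. sc c (gen_op g f x))"
begin

primrec word_op :: "('v, 'e) lpa_gen list \<Rightarrow> ('x \<Rightarrow> 'w) \<Rightarrow> 'x \<Rightarrow> 'w" where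
  "word_op [] f = f"
| "word_op (g # w) f = gen_op g (word_op w f)"

definition act :: "('v, 'e, 'k) lpa_free \<Rightarrow> ('x \<Rightarrow> 'w) \<Rightarrow> 'x \<Rightarrow> 'w" where
  "act p f x = (\<Sum>w\<in>Poly_Mapping.keys p. sc (Poly_Mapping.lookup p w) (word_op (letters w) f x))"

lemma word_op_append: "word_op (u @ v) f = word_op u (word_op v f)"
  by (induct u) simp_all

lemma word_op_add: "word_op w (\<lambda>x. f x + h x) = (\<lambda>x. word_op w f x + word_op w h x)"
  by (induct w) (simp_all add: gen_op_add)

lemma word_op_scale: "word_op w (\<lambda>x. sc c (f x)) = (\<lambda>x. sc c (word_op w f x))"
  by (induct w) (simp_all add: gen_op_scale)

lemma word_op_0: "word_op w (\<lambda>x. 0) = (\<lambda>x. 0)"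
  using word_op_scale[of w 0 "\<lambda>_. 0"] by simp

lemma act_superset:
  assumes "finite A" "Poly_Mapping.keys p \<subseteq> A"
  shows "act p f x = (\<Sum>w\<in>A. sc (Poly_Mapping.lookup p w) (word_op (letters w) f x))"
  unfolding act_def using assms by (intro sum.mono_neutral_left) (auto simp: in_keys_iff)

lemma act_0: "act 0 f x = 0"
  by (simp add: act_def)

lemma act_add: "act (p + q) f x = act p f x + act q f x"
proof -
  let ?A = "Poly_Mapping.keys p \<union> Poly_Mapping.keys q"
  have "act p f x + act q f x = (\<Sum>w\<in>?A. sc (Poly_Mapping.lookup p w) (word_op (letters w) f x))
      + (\<Sum>w\<in>?A. sc (Poly_Mapping.lookup q w) (word_op (letters w) f x))"
    by (simp add: act_superset[of ?A])
  also have "\<dots> = (\<Sum>w\<in>?A. sc (Poly_Mapping.lookup (p + q) w) (word_op (letters w) f x))"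
    by (simp add: lookup_add scale_left_distrib sum.distrib)
  also have "\<dots> = act (p + q) f x"
    using Poly_Mapping.keys_add[of p q] by (intro act_superset[symmetric]) auto
  finally show ?thesis by simp
qed

lemma act_uminus: "act (- p) f x = - act p f x"
  using act_add[of p "- p" f x] by (simp add: act_0 eq_neg_iff_add_eq_0 add.commute)

lemma act_diff: "act (p - q) f x = act p f x - act q f x"
  using act_add[of p "- q" f x] by (simp add: act_uminus)

lemma act_sum: "act (sum g A) f x = (\<Sum>i\<in>A. act (g i) f x)"
  by (induct A rule: infinite_finite_induct) (simp_all add: act_0 act_add)

lemma act_scale: "act (scale c p) f x = sc c (act p f x)"
proof -
  have "act (scale c p) f x = (\<Sum>w\<in>Poly_Mapping.keys p. sc (Poly_Mapping.lookup (scale c p) w) (word_op (letters w) f x))"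
    by (intro act_superset) (auto simp: in_keys_iff lookup_scale)
  then show ?thesis by (simp add: act_def lookup_scale scale_sum_right)
qed

lemma act_monom: "act (monom_word w) f x = word_op w f x"
  by (simp add: act_def monom_word_def)

lemma act_mult: "act (p * q) f x = act p (act q f) x"
proof -
  \<comment> \<open>First a single word on the left, by linearity in q; then the general case, by
    linearity in p.\<close>
  have "word_op u (act q f) x = act (monom_word u * q) f x" for u x
  proof -
    have "q \<in> unital_free UNIV" by (simp add: unital_free_def)
    then show ?thesis
    proof (induct q arbitrary: x rule: unital_free_induct)
      case zero
      have "act 0 f = (\<lambda>x. 0)" by (rule ext) (rule act_0)
      then show ?case by (simp add: word_op_0 act_0)
    next
      case (add p q)
      have "act (p + q) f = (\<lambda>x. act p f x + act q f x)" by (rule ext) (rule act_add)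
      then show ?case using add by (simp add: word_op_add distrib_left act_add)
    next
      case (scale c w)
      have "act (scale c (monom_word w)) f = (\<lambda>x. sc c (word_op w f x))"
        by (rule ext) (simp add: act_scale act_monom)
      then show ?case
        by (simp add: word_op_scale scale_mult_right act_scale monom_word_mult act_monom word_op_append)
    qed
  qed
  note word = this
  have "p \<in> unital_free UNIV" by (simp add: unital_free_def)
  then show ?thesis
  proof (induct p arbitrary: x rule: unital_free_induct)
    case zero
    then show ?case by (simp add: act_0)
  next
    case (add p q)
    then show ?case by (simp add: distrib_right act_add)
  next
    case (scale c w)
    then show ?case by (simp add: scale_mult_left act_scale act_monom word)
  qed
qed

lemma act_zero_fun: "act p (\<lambda>x. 0) x = 0"
  by (simp add: act_def word_op_0)

definition annihilator :: "('v, 'e) pre_digraph \<Rightarrow> ('v, 'e, 'k) lpa_free set" where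
  "annihilator E = {p \<in> lpa_carrier E. \<forall>f x. act p f x = 0}"

lemma annihilator_ideal:
  assumes "wf_digraph E" "\<And>r f x. r \<in> lpa_relators E \<Longrightarrow> act r f x = 0"
  shows "lpa_ideal E (annihilator E)"
proof (rule lpa_ideal.intro)
  show "wf_digraph E" by fact
  have zero: "act p (act q f) x = 0" if "\<forall>f x. act q f x = 0" for p q f x
  proof -
    have "act q f = (\<lambda>x. 0)" using that by blast
    then show ?thesis by (simp add: act_zero_fun)
  qed
  show ideal: "rng_ideal (annihilator E) (free_rng (lpa_gens E))"
    unfolding free_rng_ideal_iff annihilator_def
    by (auto simp: act_0 act_add act_uminus act_mult zero
      intro: carrier_0 carrier_add carrier_uminus carrier_mult_left carrier_subset_unital)
  show "lpa_kernel E \<subseteq> annihilator E"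
    by (rule kernel_least[OF ideal])
      (auto simp: annihilator_def act_scale assms intro!: carrier_scale relators_carrier)
qed

end

text \<open>The functions on the points of a branching system form a module, on which the edges act with
  coefficients twisted by the automorphisms \<open>\<theta>\<close>.\<close>

locale branching_system = wf_digraph E + module sc
  for E :: "('v, 'e) pre_digraph" and sc :: "'k::field \<Rightarrow> 'w::ab_group_add \<Rightarrow> 'w" +
  fixes D :: "'v \<Rightarrow> 'x set" and \<tau> :: "'e \<Rightarrow> 'x \<Rightarrow> 'x" and \<theta> \<theta>' :: "'e \<Rightarrow> 'x \<Rightarrow> 'w \<Rightarrow> 'w"
  assumes disjoint: "u \<in> verts E \<Longrightarrow> v \<in> verts E \<Longrightarrow> u \<noteq> v \<Longrightarrow> D u \<inter> D v = {}"
    and \<tau>_in: "e \<in> arcs E \<Longrightarrow> x \<in> D (head E e) \<Longrightarrow> \<tau> e x \<in> D (tail E e)"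
    and \<tau>_inj: "e \<in> arcs E \<Longrightarrow> f \<in> arcs E \<Longrightarrow> x \<in> D (head E e) \<Longrightarrow> y \<in> D (head E f) \<Longrightarrow>
      \<tau> e x = \<tau> f y \<Longrightarrow> e = f \<and> x = y"
    and \<tau>_surj: "regular_vertex E v \<Longrightarrow> x \<in> D v \<Longrightarrow> \<exists>e\<in>out_arcs E v. \<exists>y\<in>D (head E e). x = \<tau> e y"
    and \<theta>_add: "\<theta> e x (a + b) = \<theta> e x a + \<theta> e x b" "\<theta>' e x (a + b) = \<theta>' e x a + \<theta>' e x b"
    and \<theta>_scale: "\<theta> e x (sc c a) = sc c (\<theta> e x a)" "\<theta>' e x (sc c a) = sc c (\<theta>' e x a)"
    and \<theta>_inverse: "\<theta>' e x (\<theta> e x a) = a" "\<theta> e x (\<theta>' e x a) = a"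
begin

text \<open>Edges push a function forward along \<tau> e and ghost edges pull it back, so that e* e
  is restriction to \<open>D (head E e)\<close> and e e* is restriction to the range of \<tau>
  e.\<close>

fun gen_op :: "('v, 'e) lpa_gen \<Rightarrow> ('x \<Rightarrow> 'w) \<Rightarrow> 'x \<Rightarrow> 'w" where
  "gen_op (Vertex v) f x = (if x \<in> D v then f x else 0)"
| "gen_op (Edge e) f x = (if x \<in> \<tau> e ` D (head E e)
     then \<theta> e (inv_into (D (head E e)) (\<tau> e) x) (f (inv_into (D (head E e)) (\<tau> e) x)) else 0)"
| "gen_op (Ghost e) f x = (if x \<in> D (head E e) then \<theta>' e x (f (\<tau> e x)) else 0)"

declare gen_op.simps(2,3) [simp del]

sublocale free_representation sc gen_op
proof
  show "gen_op g (\<lambda>x. f x + h x) = (\<lambda>x. gen_op g f x + gen_op g h x)" for g f h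
    by (rule ext, cases g) (simp_all add: gen_op.simps \<theta>_add)
  show "gen_op g (\<lambda>x. sc c (f x)) = (\<lambda>x. sc c (gen_op g f x))" for g c f
    by (rule ext, cases g) (simp_all add: gen_op.simps \<theta>_scale)
qed

lemma \<tau>_inv: "e \<in> arcs E \<Longrightarrow> y \<in> D (head E e) \<Longrightarrow> inv_into (D (head E e)) (\<tau> e) (\<tau> e y) = y"
  using \<tau>_inj[of e e] by (intro inv_into_f_f inj_onI) auto

lemma gen_op_edge: "e \<in> arcs E \<Longrightarrow> y \<in> D (head E e) \<Longrightarrow> gen_op (Edge e) f (\<tau> e y) = \<theta> e y (f y)"
  by (simp add: gen_op.simps \<tau>_inv)

lemma gen_op_edge_0: "x \<notin> \<tau> e ` D (head E e) \<Longrightarrow> gen_op (Edge e) f x = 0"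
  by (simp add: gen_op.simps)

lemma image_disjoint:
  assumes "e \<in> arcs E" "f \<in> arcs E" "e \<noteq> f" "x \<in> \<tau> e ` D (head E e)"
  shows "x \<notin> \<tau> f ` D (head E f)"
proof
  assume "x \<in> \<tau> f ` D (head E f)"
  then obtain y z where "y \<in> D (head E e)" "z \<in> D (head E f)" "\<tau> e y = \<tau> f z" using assms(4) by auto
  then show False using \<tau>_inj[OF assms(1,2)] assms(3) by blast
qed

lemma edge_ghost_op:
  assumes "e \<in> arcs E"
  shows "gen_op (Edge e) (gen_op (Ghost e) f) x = (if x \<in> \<tau> e ` D (head E e) then f x else 0)"
  using assms by (auto simp: gen_op_edge gen_op_edge_0 gen_op.simps(3) \<theta>_inverse)

lemma edge_ghost_sum:
  assumes F: "finite F" "F \<subseteq> arcs E"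
  shows "(\<Sum>e\<in>F. gen_op (Edge e) (gen_op (Ghost e) f) x) =
    (if x \<in> (\<Union>e\<in>F. \<tau> e ` D (head E e)) then f x else 0)"
proof (cases "x \<in> (\<Union>e\<in>F. \<tau> e ` D (head E e))")
  case True
  then obtain e where e: "e \<in> F" "x \<in> \<tau> e ` D (head E e)" by blast
  have "x \<notin> \<tau> e' ` D (head E e')" if "e' \<in> F" "e' \<noteq> e" for e'
    using that e F(2) image_disjoint[of e e'] by blast
  then have "(\<Sum>e'\<in>F. gen_op (Edge e') (gen_op (Ghost e') f) x) = (\<Sum>e'\<in>F. if e' = e then f x else 0)"
    using e F(2) by (intro sum.cong) (auto simp: edge_ghost_op)
  then show ?thesis using True e F(1) by simp
next
  case False
  then have "gen_op (Edge e) (gen_op (Ghost e) f) x = 0" if "e \<in> F" for e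
    using that F(2) edge_ghost_op[of e f x] by auto
  then show ?thesis using False by simp
qed

lemma relator_acts:
  assumes "r \<in> lpa_relators E"
  shows "act r f x = 0"
proof -
  have edge_target: "gen_op (Edge e) (gen_op (Vertex (head E e)) f) x = gen_op (Edge e) f x" if "e \<in> arcs E" for e
    using that by (cases "x \<in> \<tau> e ` D (head E e)")
      (auto simp: gen_op_edge gen_op_edge_0)
  have edge_source: "gen_op (Vertex (tail E e)) (gen_op (Edge e) f) x = gen_op (Edge e) f x" if "e \<in> arcs E" for e
  proof -
    have "gen_op (Edge e) f x = 0" if "x \<notin> D (tail E e)"
      using that \<tau>_in[OF \<open>e \<in> arcs E\<close>] by (intro gen_op_edge_0) blast
    then show ?thesis by simp
  qed
  have ghost_source: "gen_op (Ghost e) (gen_op (Vertex (tail E e)) f) x = gen_op (Ghost e) f x" if "e \<in> arcs E" for e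
    using that \<tau>_in[of e] by (simp add: gen_op.simps(3))
  have ghost_target: "gen_op (Vertex (head E e)) (gen_op (Ghost e) f) x = gen_op (Ghost e) f x" for e
    by (simp add: gen_op.simps(3))
  have ghost_edge: "gen_op (Ghost e) (gen_op (Edge e) f) x = gen_op (Vertex (head E e)) f x" if "e \<in> arcs E" for e
    using that by (simp add: gen_op.simps(3) gen_op_edge \<theta>_inverse)
  have ghost_edge_neq: "gen_op (Ghost e) (gen_op (Edge e') f) x = 0"
    if "e \<in> arcs E" "e' \<in> arcs E" "e \<noteq> e'" for e e'
  proof -
    have "gen_op (Edge e') f (\<tau> e x) = 0" if "x \<in> D (head E e)"
      using image_disjoint[of e e' "\<tau> e x"] that \<open>e \<in> arcs E\<close> \<open>e' \<in> arcs E\<close> \<open>e \<noteq> e'\<close>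
      by (intro gen_op_edge_0) simp
    moreover have "\<theta>' e x 0 = 0" using \<theta>_add(2)[of e x 0 0] by simp
    ultimately show ?thesis by (simp add: gen_op.simps(3))
  qed
  have vertex_orth: "gen_op (Vertex u) (gen_op (Vertex v) f) x = 0" if "u \<in> verts E" "v \<in> verts E" "u \<noteq> v" for u v
    using disjoint[OF that] by auto
  have regular: "gen_op (Vertex v) f x = (\<Sum>e\<in>out_arcs E v. gen_op (Edge e) (gen_op (Ghost e) f) x)"
    if v: "regular_vertex E v" for v
  proof -
    have fin: "finite (out_arcs E v)" "out_arcs E v \<subseteq> arcs E" using v by (auto simp: regular_vertex_def)
    \<comment> \<open>The relation v = \<Sum> e e* asks that D v be the union of the pairwise
      disjoint ranges; this is the surjectivity demanded at regular vertices.\<close>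
    have "x \<in> D v \<longleftrightarrow> x \<in> (\<Union>e\<in>out_arcs E v. \<tau> e ` D (head E e))"
    proof
      assume "x \<in> D v"
      then show "x \<in> (\<Union>e\<in>out_arcs E v. \<tau> e ` D (head E e))" using \<tau>_surj[OF v] by blast
    next
      assume "x \<in> (\<Union>e\<in>out_arcs E v. \<tau> e ` D (head E e))"
      then obtain e y where "e \<in> arcs E" "tail E e = v" "y \<in> D (head E e)" "x = \<tau> e y" by auto
      then show "x \<in> D v" using \<tau>_in[of e y] by simp
    qed
    then show ?thesis using edge_ghost_sum[OF fin] by simp
  qed
  show ?thesis
    using assms unfolding lpa_relators_def
    by (elim UnE CollectE exE conjE)
      (simp_all add: act_diff act_sum act_monom edge_target edge_source ghost_source ghost_target ghost_edge
        ghost_edge_neq vertex_orth regular del: gen_op.simps(1), simp_all)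
qed

lemma annihilator_lpa_ideal: "lpa_ideal E (annihilator E)"
  using annihilator_ideal relator_acts wf_digraph_axioms by blast

lemma vertex_annihilator:
  assumes "v \<in> verts E" "a \<noteq> (0::'w)"
  shows "monom_word [Vertex v] \<in> annihilator E \<longleftrightarrow> D v = {}"
proof
  assume "monom_word [Vertex v] \<in> annihilator E"
  then have "act (monom_word [Vertex v]) (\<lambda>_. a) x = 0" for x
    unfolding annihilator_def by blast
  then have "(if x \<in> D v then a else 0) = 0" for x by (simp add: act_monom)
  then show "D v = {}" using assms(2) by (metis equals0I)
next
  assume "D v = {}"
  then show "monom_word [Vertex v] \<in> annihilator E"
    using assms(1) by (auto simp: annihilator_def act_monom intro: carrier_monom)
qed

text \<open>The corner acts as restriction to the points of D v outside the ranges of the edges of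
  F; a nonzero constant function detects any such point.\<close>

lemma corner_annihilator:
  assumes v: "v \<in> verts E" and F: "finite F" "F \<subseteq> out_arcs E v" and a: "a \<noteq> (0::'w)"
  shows "corner v F \<in> annihilator E \<longleftrightarrow> D v \<subseteq> (\<Union>e\<in>F. \<tau> e ` D (head E e))"
proof -
  have FE: "F \<subseteq> arcs E" using F(2) by auto
  have act: "act (corner v F) f x =
      (if x \<in> D v then f x else 0) - (if x \<in> (\<Union>e\<in>F. \<tau> e ` D (head E e)) then f x else 0)" for f x
    using edge_ghost_sum[OF F(1) FE, of f x] by (simp add: corner_def act_diff act_sum act_monom)
  have sub: "(\<Union>e\<in>F. \<tau> e ` D (head E e)) \<subseteq> D v"
  proof
    fix x assume "x \<in> (\<Union>e\<in>F. \<tau> e ` D (head E e))"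
    then obtain e y where "e \<in> F" "y \<in> D (head E e)" "x = \<tau> e y" by auto
    moreover from this have "e \<in> arcs E" "tail E e = v" using F(2) by auto
    ultimately show "x \<in> D v" using \<tau>_in[of e y] by simp
  qed
  show ?thesis
  proof
    assume "corner v F \<in> annihilator E"
    then have "act (corner v F) (\<lambda>_. a) x = 0" for x unfolding annihilator_def by blast
    then have zero: "(if x \<in> D v then a else 0) - (if x \<in> (\<Union>e\<in>F. \<tau> e ` D (head E e)) then a else 0) = 0" for x
      unfolding act .
    show "D v \<subseteq> (\<Union>e\<in>F. \<tau> e ` D (head E e))"
    proof
      fix x assume x: "x \<in> D v"
      show "x \<in> (\<Union>e\<in>F. \<tau> e ` D (head E e))"
      proof (rule ccontr)
        assume "x \<notin> (\<Union>e\<in>F. \<tau> e ` D (head E e))"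
        then show False using zero[of x] a x by (simp only: if_True if_False diff_zero)
      qed
    qed
  next
    assume "D v \<subseteq> (\<Union>e\<in>F. \<tau> e ` D (head E e))"
    then have "D v = (\<Union>e\<in>F. \<tau> e ` D (head E e))" using sub by blast
    then show "corner v F \<in> annihilator E"
      using corner_carrier[OF v FE] by (simp add: annihilator_def act)
  qed
qed

end

text \<open>Used with L the live edges at a vertex. Prefixing an edge to a list is injective for
  every L and misses the empty list. A bijection comes from cardinal arithmetic: the set of lists is
  infinite and at least as large as L.\<close>

lemma ex_branching_map:
  fixes L :: "'e set"
  assumes "b \<Longrightarrow> finite L \<and> L \<noteq> {}"
  shows "\<exists>t :: 'e \<times> 'e list \<Rightarrow> 'e list. inj_on t (L \<times> UNIV) \<and> (t ` (L \<times> UNIV) = UNIV \<longleftrightarrow> b)"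
proof (cases b)
  case True
  then have L: "finite L" "L \<noteq> {}" using assms by auto
  have inf: "infinite (UNIV :: 'e list set)" by (rule infinite_UNIV_listI)
  have "(card_of L, card_of (UNIV :: 'e list set)) \<in> ordLeq"
    by (subst card_of_ordLeq[symmetric]) (auto intro!: exI[of _ "\<lambda>e. [e]"] inj_onI)
  then have "(card_of (L \<times> (UNIV :: 'e list set)), card_of (UNIV :: 'e list set)) \<in> ordIso"
    using card_of_Times_infinite[OF inf L(2)] by blast
  then obtain t where "bij_betw t (L \<times> (UNIV :: 'e list set)) (UNIV :: 'e list set)"
    using card_of_ordIso by blast
  then show ?thesis using True by (auto simp: bij_betw_def)
next
  case False
  have "[] \<notin> (\<lambda>(e, z). e # z) ` (L \<times> UNIV)" by auto
  then show ?thesis using False by (intro exI[of _ "\<lambda>(e, z). e # z"]) (auto intro: inj_onI)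
qed

text \<open>The ideal is the annihilator of a branching system whose fibre over v is empty for v in
  H and a copy of all edge lists otherwise. Outside H, the ranges of the live edges fill the fibre
  exactly at regular vertices, as the relations require, and at members of S, so that v^H acts as 0
  exactly for v in S.\<close>

lemma ideal_of_admissible_pair:
  fixes E :: "('v, 'e) pre_digraph"
  assumes "wf_digraph E" and adm: "admissible_pair E (H, S)"
  obtains I :: "('v, 'e, 'k::field) lpa_free set"
  where "lpa_ideal E I" "ideal_verts E I = H" "ideal_breaking E I = S"
proof -
  interpret wf_digraph E by fact
  have H: "hereditary E H" "saturated E H" "S \<subseteq> breaking_vertices E H"
    using adm by (auto simp: admissible_pair_def)
  have H_verts: "H \<subseteq> verts E" using H(1) by (simp add: hereditary_def)
  have H_edge: "tail E e \<notin> H" if "e \<in> arcs E" "head E e \<notin> H" for e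
    using H(1) that unfolding hereditary_def by (meson dominatesI reachable_adjI arc_to_ends_def)
  let ?b = "\<lambda>v. v \<notin> H \<and> (regular_vertex E v \<or> v \<in> S)"
  \<comment> \<open>Saturation of H gives a regular vertex outside H at least one live edge; for v
    in S both facts are part of being a breaking vertex.\<close>
  have "finite (live_arcs E H v) \<and> live_arcs E H v \<noteq> {}" if "?b v" for v
  proof (cases "regular_vertex E v")
    case True
    then have "\<not> head E ` out_arcs E v \<subseteq> H" using H(2) that by (auto simp: saturated_def)
    moreover have "finite (live_arcs E H v)"
      by (rule finite_subset[OF live_arcs_subset]) (use True in \<open>simp add: regular_vertex_def\<close>)
    ultimately show ?thesis by (auto simp: live_arcs_def)
  next
    case False
    then show ?thesis using that H(3) by (auto simp: breaking_vertices_iff)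
  qed
  then have "\<exists>t :: 'e \<times> 'e list \<Rightarrow> 'e list. inj_on t (live_arcs E H v \<times> UNIV) \<and>
      (t ` (live_arcs E H v \<times> UNIV) = UNIV \<longleftrightarrow> ?b v)" for v
    by (rule ex_branching_map)
  then obtain t :: "'v \<Rightarrow> 'e \<times> 'e list \<Rightarrow> 'e list"
    where t: "\<And>v. inj_on (t v) (live_arcs E H v \<times> UNIV)"
      "\<And>v. t v ` (live_arcs E H v \<times> UNIV) = UNIV \<longleftrightarrow> ?b v"
    by metis
  define D where "D v = (if v \<in> H then {} else {v} \<times> (UNIV :: 'e list set))" for v
  define \<tau> where "\<tau> e x = (tail E e, t (tail E e) (e, snd x))" for e and x :: "'v \<times> 'e list"
  have live: "e \<in> live_arcs E H (tail E e)" if "e \<in> arcs E" "x \<in> D (head E e)" for e x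
    using that by (auto simp: live_arcs_def D_def split: if_splits)
  interpret branching_system E "(*) :: 'k \<Rightarrow> 'k \<Rightarrow> 'k" D \<tau> "\<lambda>e x a. a" "\<lambda>e x a. a"
  proof
    fix e f x y
    assume e: "e \<in> arcs E" "x \<in> D (head E e)"
    show "\<tau> e x \<in> D (tail E e)"
      using e H_edge[of e] by (auto simp: D_def \<tau>_def split: if_splits)
    assume f: "f \<in> arcs E" "y \<in> D (head E f)" and eq: "\<tau> e x = \<tau> f y"
    have tail: "tail E f = tail E e" and "t (tail E e) (e, snd x) = t (tail E e) (f, snd y)"
      using eq by (auto simp: \<tau>_def)
    moreover have "(e, snd x) \<in> live_arcs E H (tail E e) \<times> UNIV" "(f, snd y) \<in> live_arcs E H (tail E e) \<times> UNIV"
      using live[OF e] live[OF f] tail by auto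
    ultimately have "(e, snd x) = (f, snd y)" using t(1) by (meson inj_onD)
    then show "e = f \<and> x = y"
      using e f by (auto simp: D_def prod_eq_iff split: if_splits)
  next
    fix v x assume v: "regular_vertex E v" "x \<in> D v"
    then have "v \<notin> H" "x = (v, snd x)" by (auto simp: D_def split: if_splits)
    then obtain e z where "e \<in> live_arcs E H v" "t v (e, z) = snd x"
      using t(2)[of v] v(1) by (metis (no_types, lifting) UNIV_I imageE mem_Sigma_iff surj_pair)
    then show "\<exists>e\<in>out_arcs E v. \<exists>y\<in>D (head E e). x = \<tau> e y"
      using \<open>x = (v, snd x)\<close> by (intro bexI[of _ e] bexI[of _ "(head E e, z)"]) (auto simp: live_arcs_def D_def \<tau>_def)
  qed (auto simp: algebra_simps D_def)
  have verts: "ideal_verts E (annihilator E) = H"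
    using H_verts vertex_annihilator[of _ "1 :: 'k"] by (auto simp: ideal_verts_def D_def split: if_splits)
  have "corner v (live_arcs E H v) \<in> annihilator E \<longleftrightarrow> v \<in> S" if v: "v \<in> breaking_vertices E H" for v
  proof -
    have v': "v \<in> verts E" "v \<notin> H" "infinite (out_arcs E v)" "finite (live_arcs E H v)"
      using v by (auto simp: breaking_vertices_iff)
    have "(\<Union>e\<in>live_arcs E H v. \<tau> e ` D (head E e)) = {v} \<times> t v ` (live_arcs E H v \<times> UNIV)"
      by (force simp: live_arcs_def \<tau>_def D_def)
    then have "corner v (live_arcs E H v) \<in> annihilator E \<longleftrightarrow> t v ` (live_arcs E H v \<times> UNIV) = UNIV"
      using corner_annihilator[OF v'(1,4) live_arcs_subset, of "1 :: 'k"] v'(2) by (auto simp: D_def)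
    then show ?thesis using t(2)[of v] v' by (simp add: regular_vertex_def)
  qed
  then have "ideal_breaking E (annihilator E) = S"
    using H(3) by (auto simp: ideal_breaking_def verts)
  then show ?thesis using that annihilator_lpa_ideal verts by blast
qed

text \<open>If \<open>v\<close> is the base of exactly one simple closed path \<open>c\<close>, the paths from \<open>u\<close> to their first
  arrival at \<open>v\<close> form a branching system, in which \<open>c\<close> may act by any automorphism.\<close>

locale unique_closed_path = wf_digraph E
  for E :: "('v, 'e) pre_digraph" +
  fixes v :: 'v and c :: "'e list"
  assumes simple: "simple_closed_path E v c"
    and unique: "simple_closed_path E v c' \<Longrightarrow> c' = c"
begin

definition arrivals :: "'v \<Rightarrow> 'e list set" where
  "arrivals u = {p. awalk u p v \<and> (\<forall>e\<in>set p. tail E e \<noteq> v)}"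

text \<open>Prefixing an edge to a first arrival yields a first arrival again, unless the edge
  starts at v; then the result is the whole of c and is identified with the path of length
  0.\<close>

definition arrive :: "'e \<Rightarrow> 'e list \<Rightarrow> 'e list" where
  "arrive e p = (if e # p = c then [] else e # p)"

text \<open>Such a path meets v only at its two ends, so it is simple and must be c.\<close>

lemma closed_arrival:
  assumes "e \<in> arcs E" "tail E e = v" "p \<in> arrivals (head E e)"
  shows "e # p = c"
  using assms by (intro unique) (auto simp: simple_closed_path_def arrivals_def awalk_Cons_iff)

lemma arrivals_v: "arrivals v = {[]}"
proof -
  have "p = []" if "p \<in> arrivals v" for p
    using that by (cases p) (auto simp: arrivals_def awalk_Cons_iff)
  moreover have "v \<in> verts E" using simple by (auto simp: simple_closed_path_def)
  ultimately show ?thesis by (auto simp: arrivals_def awalk_Nil_iff)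
qed

lemma c_Cons:
  obtains e p where "e # p = c" "e \<in> arcs E" "tail E e = v" "p \<in> arrivals (head E e)"
  using simple by (cases c) (auto simp: simple_closed_path_def arrivals_def awalk_Cons_iff)

text \<open>Uniqueness of c keeps \<open>arrive\<close> inside the first arrivals: an edge leaving v
  completes c and no other closed path. Only that step is twisted, so one turn around c acts as
  T.\<close>

lemma branching_system_arrivals:
  fixes sc :: "'k::field \<Rightarrow> 'w::ab_group_add \<Rightarrow> 'w"
  assumes "module sc" "\<And>a b. T (a + b) = T a + T b" "\<And>a b. T' (a + b) = T' a + T' b"
    "\<And>k a. T (sc k a) = sc k (T a)" "\<And>k a. T' (sc k a) = sc k (T' a)"
    "\<And>a. T' (T a) = a" "\<And>a. T (T' a) = a"
  shows "branching_system E sc arrivals arrive (\<lambda>e p a. if e # p = c then T a else a)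
    (\<lambda>e p a. if e # p = c then T' a else a)"
proof (intro branching_system.intro branching_system_axioms.intro)
  show "wf_digraph E" by unfold_locales
  show "module sc" by fact
  show "arrivals u \<inter> arrivals w = {}" if "u \<noteq> w" for u w
  proof -
    have "u = w" if "awalk u p v" "awalk w p v" for p
      using that by (cases p) (auto simp: awalk_Nil_iff awalk_Cons_iff)
    then show ?thesis using that by (auto simp: arrivals_def)
  qed
  show in_tail: "arrive e p \<in> arrivals (tail E e)" if "e \<in> arcs E" "p \<in> arrivals (head E e)" for e p
  proof (cases "e # p = c")
    case True
    then have "tail E e = v" using c_Cons by auto
    then show ?thesis using True by (simp add: arrive_def arrivals_v)
  next
    case False
    then show ?thesis
      using that closed_arrival[of e p] by (auto simp: arrive_def arrivals_def awalk_Cons_iff)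
  qed
  show "e = f \<and> p = q" if "arrive e p = arrive f q" for e f p q
    using that by (auto simp: arrive_def split: if_splits)
  show "\<exists>e\<in>out_arcs E u. \<exists>q\<in>arrivals (head E e). p = arrive e q" if "p \<in> arrivals u" for u p
  proof (cases p)
    case Nil
    then have "u = v" using that by (simp add: arrivals_def awalk_Nil_iff)
    moreover obtain e q where "e # q = c" "e \<in> arcs E" "tail E e = v" "q \<in> arrivals (head E e)"
      by (rule c_Cons)
    ultimately show ?thesis using Nil by (auto simp: arrive_def intro!: bexI[of _ e] bexI[of _ q])
  next
    case (Cons e q)
    then have e: "e \<in> out_arcs E u" "q \<in> arrivals (head E e)" "tail E e \<noteq> v"
      using that by (auto simp: arrivals_def awalk_Cons_iff)
    then have "e # q \<noteq> c" using c_Cons by auto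
    then show ?thesis using e Cons by (auto simp: arrive_def)
  qed
qed (use assms(2-) in auto)

text \<open>The vertex v cuts a function down to the empty path, the only arrival at v. The edges of
  c, read from the last, carry this value along the arrivals unchanged, and the completing step
  returns it to the empty path with T applied.\<close>

lemma cycle_act:
  fixes sc :: "'k::field \<Rightarrow> 'w::ab_group_add \<Rightarrow> 'w" and T T' :: "'w \<Rightarrow> 'w"
  assumes bs: "branching_system E sc arrivals arrive (\<lambda>e p a. if e # p = c then T a else a)
    (\<lambda>e p a. if e # p = c then T' a else a)" and T0: "T 0 = 0"
  defines "op \<equiv> branching_system.gen_op E arrivals arrive (\<lambda>e p a. if e # p = c then T a else a)
    (\<lambda>e p a. if e # p = c then T' a else a)"
  shows "free_representation.act sc op (monom_word [Vertex v]) f x = (if x = [] then f [] else 0)"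
    and "free_representation.act sc op (monom_word (map Edge c @ [Vertex v])) f x = (if x = [] then T (f []) else 0)"
proof -
  interpret branching_system E sc arrivals arrive "\<lambda>e p a. if e # p = c then T a else a"
    "\<lambda>e p a. if e # p = c then T' a else a" by fact
  have op: "op = gen_op" by (simp add: op_def)
  show "free_representation.act sc op (monom_word [Vertex v]) f x = (if x = [] then f [] else 0)"
    by (simp add: op act_monom arrivals_v)
  have edge: "gen_op (Edge e) (\<lambda>x. if x = p then a else 0) y =
      (if y = arrive e p then (if e # p = c then T a else a) else 0)"
    if e: "e \<in> arcs E" "p \<in> arrivals (head E e)" for e p a y
  proof (cases "y \<in> arrive e ` arrivals (head E e)")
    case True
    then obtain z where z: "z \<in> arrivals (head E e)" "y = arrive e z" by blast
    then have "arrive e z = arrive e p \<longleftrightarrow> z = p" using \<tau>_inj[OF e(1) e(1) z(1) e(2)] by blast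
    then show ?thesis using gen_op_edge[OF e(1) z(1)] z T0 by auto
  next
    case False
    then show ?thesis using gen_op_edge_0[OF False] e(2) by auto
  qed
  have walk: "word_op (map Edge p @ [Vertex v]) f = (\<lambda>x. if x = p then f [] else 0)"
    if "p \<in> arrivals u" for p u
    using that
  proof (induct p arbitrary: u)
    case Nil
    show ?case by (rule ext) (auto simp: arrivals_v)
  next
    case (Cons e p)
    then have e: "e \<in> arcs E" "p \<in> arrivals (head E e)" "tail E e \<noteq> v"
      by (auto simp: arrivals_def awalk_Cons_iff)
    then have ne: "e # p \<noteq> c" using c_Cons by auto
    then have "arrive e p = e # p" by (simp add: arrive_def)
    then show ?case
      using Cons(1)[OF e(2)] edge[OF e(1,2), of "f []"] ne by (intro ext) simp
  qed
  obtain e p where c: "e # p = c" "e \<in> arcs E" "tail E e = v" "p \<in> arrivals (head E e)" by (rule c_Cons)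
  show "free_representation.act sc op (monom_word (map Edge c @ [Vertex v])) f x = (if x = [] then T (f []) else 0)"
  proof -
    have "arrive e p = []" using c(1) by (simp add: arrive_def)
    moreover have "map Edge c @ [Vertex v] = Edge e # (map Edge p @ [Vertex v])"
      using c(1)[symmetric] by simp
    ultimately show ?thesis
      using walk[OF c(4)] edge[OF c(2,4), of "f []" x] c(1) by (simp add: op act_monom)
  qed
qed

text \<open>The automorphisms \<open>id\<close> and \<open>(a, b) \<mapsto> (-b, a + b)\<close> of the plane are annihilated by the
  comaximal polynomials \<open>1 - x\<close> and $1 - x + x^2$.\<close>

lemma incomparable_ideals:
  obtains I J :: "('v, 'e, 'k::field) lpa_free set"
  where "lpa_ideal E I" "lpa_ideal E J" "\<not> I \<subseteq> J" "\<not> J \<subseteq> I"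
proof -
  define sc :: "'k \<Rightarrow> 'k \<times> 'k \<Rightarrow> 'k \<times> 'k" where "sc k p = (k * fst p, k * snd p)" for k p
  \<comment> \<open>T satisfies T^2 = T - 1, and \<open>T'\<close> is its inverse. A plane is taken
    because over the field with two elements a line has no automorphism but the identity.\<close>
  define T :: "'k \<times> 'k \<Rightarrow> 'k \<times> 'k" where "T p = (- snd p, fst p + snd p)" for p
  define T' :: "'k \<times> 'k \<Rightarrow> 'k \<times> 'k" where "T' p = (fst p + snd p, - fst p)" for p
  have sc: "module sc" by unfold_locales (auto simp: sc_def algebra_simps)
  have A: "branching_system E sc arrivals arrive (\<lambda>e p a. if e # p = c then id a else a)
    (\<lambda>e p a. if e # p = c then id a else a)"
    by (rule branching_system_arrivals[OF sc]) auto
  have B: "branching_system E sc arrivals arrive (\<lambda>e p a. if e # p = c then T a else a)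
    (\<lambda>e p a. if e # p = c then T' a else a)"
    by (rule branching_system_arrivals[OF sc]) (auto simp: T_def T'_def sc_def algebra_simps)
  interpret A: branching_system E sc arrivals arrive "\<lambda>e p a. if e # p = c then id a else a"
    "\<lambda>e p a. if e # p = c then id a else a" by fact
  interpret B: branching_system E sc arrivals arrive "\<lambda>e p a. if e # p = c then T a else a"
    "\<lambda>e p a. if e # p = c then T' a else a" by fact
  define a :: "('v, 'e, 'k) lpa_free" where "a = monom_word [Vertex v]"
  define b :: "('v, 'e, 'k) lpa_free" where "b = monom_word (map Edge c @ [Vertex v])"
  have act_A: "A.act a f x = (if x = [] then f [] else 0)" "A.act b f x = (if x = [] then f [] else 0)" for f x
    using cycle_act[OF A] by (simp_all add: a_def b_def)
  have act_B: "B.act a f x = (if x = [] then f [] else 0)" "B.act b f x = (if x = [] then T (f []) else 0)" for f x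
    using cycle_act[OF B] by (simp_all add: a_def b_def T_def zero_prod_def)
  have gens: "v \<in> verts E" "set c \<subseteq> arcs E"
    using simple by (auto simp: simple_closed_path_def)
  have ab: "a \<in> lpa_carrier E" "b \<in> lpa_carrier E"
    unfolding a_def b_def using gens by (auto intro!: carrier_monom simp: subset_iff)
  then have bb: "b * b \<in> lpa_carrier E" using carrier_mult_left carrier_subset_unital by blast
  let ?I = "A.annihilator E" and ?J = "B.annihilator E"
  have I: "a - b \<in> ?I"
    using ab by (auto simp: A.annihilator_def A.act_diff act_A intro: carrier_minus)
  have J: "a - b + b * b \<in> ?J"
    using ab bb by (auto simp: B.annihilator_def B.act_diff B.act_add B.act_mult act_B T_def
      prod_eq_iff intro: carrier_minus carrier_add)
  \<comment> \<open>\<open>b * b\<close> is the difference of the two elements just found. On the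
    value at the empty path it acts invertibly in either module, as id or as T^2, which excludes
    both inclusions.\<close>
  have bb_I: "b * b \<notin> ?I"
  proof
    assume "b * b \<in> ?I"
    then have "A.act (b * b) (\<lambda>_. (1, 0)) [] = 0" unfolding A.annihilator_def by blast
    then show False by (simp add: A.act_mult act_A zero_prod_def)
  qed
  have bb_J: "b * b \<notin> ?J"
  proof
    assume "b * b \<in> ?J"
    then have "B.act (b * b) (\<lambda>_. (1, 0)) [] = 0" unfolding B.annihilator_def by blast
    then show False by (simp add: B.act_mult act_B T_def zero_prod_def)
  qed
  interpret I: lpa_ideal E ?I by (rule A.annihilator_lpa_ideal)
  interpret J: lpa_ideal E ?J by (rule B.annihilator_lpa_ideal)
  have "\<not> ?I \<subseteq> ?J"
  proof
    assume "?I \<subseteq> ?J"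
    then have "(a - b + b * b) - (a - b) \<in> ?J" using I J J.I_diff by blast
    then show False using bb_J by simp
  qed
  moreover have "\<not> ?J \<subseteq> ?I"
  proof
    assume "?J \<subseteq> ?I"
    then have "(a - b + b * b) - (a - b) \<in> ?I" using I J I.I_diff by blast
    then show False using bb_I by simp
  qed
  ultimately show ?thesis
    using that A.annihilator_lpa_ideal B.annihilator_lpa_ideal by blast
qed

end

theorem condition_K_if_chain:
  fixes E :: "('v, 'e) pre_digraph"
  assumes wf: "wf_digraph E"
    and chain: "\<And>I J :: ('v, 'e, 'k::field) lpa_free set. lpa_ideal E I \<Longrightarrow> lpa_ideal E J \<Longrightarrow> I \<subseteq> J \<or> J \<subseteq> I"
  shows "condition_K E"
proof (rule ccontr)
  assume "\<not> condition_K E"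
  then obtain v c where "simple_closed_path E v c" "\<And>c'. simple_closed_path E v c' \<Longrightarrow> c' = c"
    unfolding condition_K_def by blast
  then interpret unique_closed_path E v c
    using wf by (intro unique_closed_path.intro unique_closed_path_axioms.intro)
  obtain I J :: "('v, 'e, 'k) lpa_free set" where "lpa_ideal E I" "lpa_ideal E J" "\<not> I \<subseteq> J" "\<not> J \<subseteq> I"
    by (rule incomparable_ideals)
  then show False using chain by blast
qed

section \<open>Ideals and the order of admissible pairs\<close>

lemma ideal_verts_mono: "I \<subseteq> J \<Longrightarrow> ideal_verts E I \<subseteq> ideal_verts E J"
  by (auto simp: ideal_verts_def)

lemma live_arcs_mono: "H \<subseteq> H' \<Longrightarrow> live_arcs E H' v \<subseteq> live_arcs E H v"
  by (auto simp: live_arcs_def)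

context lpa_ideal
begin

lemma corner_live_cong:
  assumes "H \<subseteq> ideal_verts E I" "finite (live_arcs E H v)"
  shows "corner v (live_arcs E H v) \<approx> corner v (live_arcs E (ideal_verts E I) v)"
  using assms live_arcs_mono[OF assms(1), of E v]
  by (intro corner_cong) (auto simp: live_arcs_def ideal_verts_def)

text \<open>When H grows to the vertices of I, the terms of v^H for edges ending in I vanish. If no
  term survives, v^H has become v; otherwise it has become the element for the larger set. This
  dichotomy is the union in \<open>admissible_le\<close>.\<close>

lemma corner_in_cases:
  assumes H: "H \<subseteq> ideal_verts E I" and v: "v \<in> breaking_vertices E H"
    and I: "corner v (live_arcs E H v) \<in> I"
  shows "v \<in> ideal_verts E I \<union> ideal_breaking E I"
proof (cases "v \<in> ideal_verts E I")
  case False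
  let ?L = "live_arcs E (ideal_verts E I) v"
  have v': "v \<in> verts E" "infinite (out_arcs E v)" "finite (live_arcs E H v)"
    using v by (auto simp: breaking_vertices_iff)
  have corner: "corner v ?L \<in> I"
    using corner_live_cong[OF H v'(3)] I cong_mem_iff by blast
  have "?L \<noteq> {}"
  proof
    assume "?L = {}"
    then have "vtx v \<in> I" using corner by (simp add: corner_def)
    then show False using False v'(1) by (simp add: ideal_verts_def)
  qed
  moreover have "finite ?L" by (rule finite_subset[OF live_arcs_mono[OF H] v'(3)])
  ultimately show ?thesis
    using corner False v' by (simp add: ideal_breaking_def breaking_vertices_iff)
qed simp

lemma corner_in:
  assumes H: "H \<subseteq> ideal_verts E I" and v: "v \<in> breaking_vertices E H" "v \<in> ideal_verts E I \<union> ideal_breaking E I"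
  shows "corner v (live_arcs E H v) \<in> I"
proof (cases "v \<in> ideal_verts E I")
  case True
  have v': "v \<in> verts E" "finite (live_arcs E H v)" "live_arcs E H v \<subseteq> out_arcs E v"
    using v(1) live_arcs_subset[of E H v] by (simp_all add: breaking_vertices_iff)
  then have "live_arcs E H v \<subseteq> arcs E" by auto
  then have "vtx v * corner v (live_arcs E H v) \<in> I"
    using True I_mult_unital(2) corner_unital[OF v'(1)] by (auto simp: ideal_verts_def)
  then show ?thesis using vertex_corner[OF v'] cong_mem_iff by blast
next
  case False
  then have "corner v (live_arcs E (ideal_verts E I) v) \<in> I"
    using v by (auto simp: ideal_breaking_def)
  then show ?thesis
    using corner_live_cong[OF H] v(1) cong_mem_iff by (auto simp: breaking_vertices_iff)
qed

end

lemma ideal_pair_mono: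
  assumes "lpa_ideal E J" "I \<subseteq> J"
  shows "admissible_le (ideal_verts E I, ideal_breaking E I) (ideal_verts E J, ideal_breaking E J)"
proof -
  interpret J: lpa_ideal E J by fact
  have "v \<in> ideal_verts E J \<union> ideal_breaking E J" if "v \<in> ideal_breaking E I" for v
    using that assms(2) J.corner_in_cases[OF ideal_verts_mono[OF assms(2)]]
    by (auto simp: ideal_breaking_def)
  then show ?thesis using ideal_verts_mono[OF assms(2)] by (auto simp: admissible_le_def)
qed

lemma lpa_ideal_Inter:
  assumes "\<A> \<noteq> {}" "\<And>A. A \<in> \<A> \<Longrightarrow> lpa_ideal E A"
  shows "lpa_ideal E (\<Inter>\<A>)"
proof (rule lpa_ideal.intro)
  show "wf_digraph E" using assms by (auto simp: lpa_ideal_def)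
  show "rng_ideal (\<Inter>\<A>) (free_rng (lpa_gens E))"
    using assms by (intro free_rng_ideal_Inter) (auto simp: lpa_ideal_def)
  show "lpa_kernel E \<subseteq> \<Inter>\<A>" using assms(2) lpa_ideal.kernel by blast
qed

text \<open>The intersection of I and J has the pair of I, so \<open>ideal_eqI\<close> identifies it
  with I.\<close>

lemma ideal_subset_if_pair_le:
  fixes I J :: "('v, 'e, 'k::field) lpa_free set"
  assumes K: "condition_K E" and I: "lpa_ideal E I" and J: "lpa_ideal E J"
    and le: "admissible_le (ideal_verts E I, ideal_breaking E I) (ideal_verts E J, ideal_breaking E J)"
  shows "I \<subseteq> J"
proof -
  interpret J: lpa_ideal E J by fact
  have IJ: "lpa_ideal E (I \<inter> J)"
    using lpa_ideal_Inter[of "{I, J}" E] I J by auto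
  have verts: "ideal_verts E (I \<inter> J) = ideal_verts E I"
    using le by (auto simp: admissible_le_def ideal_verts_def)
  have H: "ideal_verts E I \<subseteq> ideal_verts E J" using le by (simp add: admissible_le_def)
  have "corner v (live_arcs E (ideal_verts E I) v) \<in> J" if "v \<in> ideal_breaking E I" for v
    using J.corner_in[OF H, of v] that le by (auto simp: admissible_le_def ideal_breaking_def)
  then have "ideal_breaking E (I \<inter> J) = ideal_breaking E I"
    by (auto simp: ideal_breaking_def verts)
  then have "I \<inter> J = I"
    using ideal_eqI[OF K IJ I] verts by blast
  then show ?thesis by blast
qed

section \<open>The strong countable separation property\<close>

context wf_digraph
begin

lemma hereditary_iff:
  "hereditary G H \<longleftrightarrow> H \<subseteq> verts G \<and> (\<forall>e\<in>arcs G. tail G e \<in> H \<longrightarrow> head G e \<in> H)"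
proof
  assume H: "hereditary G H"
  have "head G e \<in> H" if "e \<in> arcs G" "tail G e \<in> H" for e
    using H that unfolding hereditary_def by (meson dominatesI reachable_adjI arc_to_ends_def)
  then show "H \<subseteq> verts G \<and> (\<forall>e\<in>arcs G. tail G e \<in> H \<longrightarrow> head G e \<in> H)"
    using H by (simp add: hereditary_def)
next
  assume H: "H \<subseteq> verts G \<and> (\<forall>e\<in>arcs G. tail G e \<in> H \<longrightarrow> head G e \<in> H)"
  have "w \<in> H" if "v \<rightarrow>\<^sup>*\<^bsub>G\<^esub> w" "v \<in> H" for v w
    using that
  proof (induct rule: reachable_induct)
    case (step x y)
    then obtain e where "e \<in> arcs G" "tail G e = x" "head G e = y" by auto
    then show ?case using step H by auto
  qed auto
  then show "hereditary G H" using H by (auto simp: hereditary_def)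
qed

lemma arc_reachable: "e \<in> arcs G \<Longrightarrow> tail G e \<rightarrow>\<^sup>*\<^bsub>G\<^esub> head G e"
  by (meson dominatesI reachable_adjI arc_to_ends_def)

text \<open>For a vertex u, the least hereditary saturated set containing it. Starting from all
  descendants of u leaves only saturation steps, and these preserve heredity.\<close>

inductive_set hs_closure for u where
  reach: "u \<rightarrow>\<^sup>*\<^bsub>G\<^esub> w \<Longrightarrow> w \<in> hs_closure u"
| regular: "regular_vertex G w \<Longrightarrow> (\<And>e. e \<in> out_arcs G w \<Longrightarrow> head G e \<in> hs_closure u) \<Longrightarrow> w \<in> hs_closure u"

lemma hs_closure_hereditary: "hereditary G (hs_closure u)"
proof -
  have "w \<in> verts G \<and> (\<forall>e\<in>out_arcs G w. head G e \<in> hs_closure u)" if "w \<in> hs_closure u" for w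
    using that
  proof (induct rule: hs_closure.induct)
    case (reach w)
    have "u \<rightarrow>\<^sup>*\<^bsub>G\<^esub> head G e" if "e \<in> out_arcs G w" for e
      using that reach arc_reachable[of e] reachable_trans by auto
    then show ?case using reach reachable_in_verts(2) hs_closure.reach by blast
  next
    case (regular w)
    then show ?case by (auto simp: regular_vertex_def)
  qed
  then show ?thesis unfolding hereditary_iff by auto
qed

lemma hs_closure_saturated: "saturated G (hs_closure u)"
  unfolding saturated_def by (auto intro: hs_closure.regular)

text \<open>A saturation step keeps a way into the descendants of u, through any one of the edges of
  the regular vertex.\<close>

lemma hs_closure_meets:
  assumes "w \<in> hs_closure u"
  obtains x where "w \<rightarrow>\<^sup>*\<^bsub>G\<^esub> x" "u \<rightarrow>\<^sup>*\<^bsub>G\<^esub> x"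
proof -
  have "\<exists>x. w \<rightarrow>\<^sup>*\<^bsub>G\<^esub> x \<and> u \<rightarrow>\<^sup>*\<^bsub>G\<^esub> x"
    using assms
  proof (induct rule: hs_closure.induct)
    case (reach w)
    then show ?case using reachable_in_verts(2) reachable_refl by blast
  next
    case (regular w)
    obtain e where e: "e \<in> out_arcs G w" using regular(1) unfolding regular_vertex_def by blast
    then obtain x where "head G e \<rightarrow>\<^sup>*\<^bsub>G\<^esub> x" "u \<rightarrow>\<^sup>*\<^bsub>G\<^esub> x" using regular by blast
    then show ?case using e arc_reachable[of e] reachable_trans by auto
  qed
  then show ?thesis using that by blast
qed

lemma hs_closure_self: "u \<in> verts G \<Longrightarrow> u \<in> hs_closure u"
  by (auto intro: hs_closure.reach)

text \<open>One member c of C suffices, as it lies in the closure of every vertex: c and u have a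
  common descendant x, which stays in the closure of v, so x and v have one too.\<close>

lemma strong_CSP_downward_directed:
  assumes "strong_CSP G"
  shows "downward_directed G"
proof -
  obtain C where C: "C \<noteq> {}" "\<And>X. X \<noteq> {} \<Longrightarrow> hereditary G X \<Longrightarrow> saturated G X \<Longrightarrow> C \<subseteq> X"
    using assms unfolding strong_CSP_def by metis
  then obtain c where "c \<in> C" by blast
  have c: "c \<in> hs_closure u" if "u \<in> verts G" for u
    using C(2)[OF _ hs_closure_hereditary hs_closure_saturated, of u] hs_closure_self[OF that] \<open>c \<in> C\<close> by blast
  have "\<exists>w\<in>verts G. u \<rightarrow>\<^sup>*\<^bsub>G\<^esub> w \<and> v \<rightarrow>\<^sup>*\<^bsub>G\<^esub> w" if u: "u \<in> verts G" and v: "v \<in> verts G" for u v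
  proof -
    obtain x where x: "c \<rightarrow>\<^sup>*\<^bsub>G\<^esub> x" "u \<rightarrow>\<^sup>*\<^bsub>G\<^esub> x" using hs_closure_meets[OF c[OF u]] by blast
    then have "x \<in> hs_closure v"
      using hs_closure_hereditary[of v] c[OF v] unfolding hereditary_def by blast
    then obtain y where "x \<rightarrow>\<^sup>*\<^bsub>G\<^esub> y" "v \<rightarrow>\<^sup>*\<^bsub>G\<^esub> y" using hs_closure_meets by blast
    then show ?thesis using x(2) reachable_trans reachable_in_verts(2) by blast
  qed
  then show ?thesis by (simp add: downward_directed_def)
qed

text \<open>Descendants are sorted by the number of steps from c; each level is a countable union of
  finite sets of successors.\<close>

lemma countable_descendants:
  assumes "\<And>w. c \<rightarrow>\<^sup>*\<^bsub>G\<^esub> w \<Longrightarrow> regular_vertex G w"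
  shows "countable {w. c \<rightarrow>\<^sup>*\<^bsub>G\<^esub> w}"
proof -
  define level where "level = rec_nat {c} (\<lambda>_ X. \<Union>x\<in>X. head G ` out_arcs G x)"
  have level_0: "level 0 = {c}" and level_Suc: "level (Suc n) = (\<Union>x\<in>level n. head G ` out_arcs G x)" for n
    by (simp_all add: level_def)
  show ?thesis
  proof (cases "c \<in> verts G")
    case True
    have "level n \<subseteq> {w. c \<rightarrow>\<^sup>*\<^bsub>G\<^esub> w} \<and> countable (level n)" for n
    proof (induct n)
      case 0
      then show ?case using True by (simp add: level_0)
    next
      case (Suc n)
      have "countable (head G ` out_arcs G x)" if "x \<in> level n" for x
        using assms[of x] that Suc by (auto simp: regular_vertex_def intro!: countable_finite)
      moreover have "c \<rightarrow>\<^sup>*\<^bsub>G\<^esub> head G e" if "x \<in> level n" "e \<in> out_arcs G x" for x e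
        using that Suc arc_reachable[of e] reachable_trans by auto
      ultimately show ?case using Suc by (auto simp: level_Suc)
    qed
    then have "countable (\<Union>n. level n)" by (intro countable_UN) auto
    moreover have "w \<in> (\<Union>n. level n)" if "c \<rightarrow>\<^sup>*\<^bsub>G\<^esub> w" for w
      using that
    proof (induct rule: reachable_induct)
      case base
      then show ?case using level_0 by blast
    next
      case (step x y)
      then obtain n e where "x \<in> level n" "e \<in> arcs G" "tail G e = x" "head G e = y" by auto
      then have "y \<in> level (Suc n)" by (force simp: level_Suc)
      then show ?case by blast
    qed
    moreover from this have "{w. c \<rightarrow>\<^sup>*\<^bsub>G\<^esub> w} \<subseteq> (\<Union>n. level n)" by blast
    ultimately show ?thesis using countable_subset by blast
  next
    case False
    then have "{w. c \<rightarrow>\<^sup>*\<^bsub>G\<^esub> w} = {}" using reachable_in_verts(1) by blast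
    then show ?thesis by simp
  qed
qed

text \<open>A vertex common to all nonempty hereditary saturated sets that is a sink or an infinite emitter
  is reached from everywhere; if there is no such vertex, the descendants of a common vertex form a
  countable set.\<close>

lemma strong_CSP_if_common_vertex:
  assumes "\<exists>c\<in>verts G. \<forall>X. X \<noteq> {} \<longrightarrow> hereditary G X \<longrightarrow> saturated G X \<longrightarrow> c \<in> X"
  shows "strong_CSP G"
proof -
  define N where "N = {c \<in> verts G. \<forall>X. X \<noteq> {} \<longrightarrow> hereditary G X \<longrightarrow> saturated G X \<longrightarrow> c \<in> X}"
  obtain c where "c \<in> N" using assms by (auto simp: N_def)
  have N_sub: "c \<in> X" if "c \<in> N" "X \<noteq> {}" "hereditary G X" "saturated G X" for c X
    using that by (auto simp: N_def)
  have closure: "c \<in> hs_closure u" if "c \<in> N" "u \<in> verts G" for c u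
    using N_sub[OF that(1) _ hs_closure_hereditary hs_closure_saturated, of u] hs_closure_self[OF that(2)] by blast
  show ?thesis
  proof (cases "\<exists>c\<in>N. \<not> regular_vertex G c")
    case True
    then obtain c where c: "c \<in> N" "\<not> regular_vertex G c" by blast
    have "u \<rightarrow>\<^sup>*\<^bsub>G\<^esub> c" if "u \<in> verts G" for u
      \<comment> \<open>An irregular vertex enters a closure only as a descendant.\<close>
      using closure[OF c(1) that] c(2) by (auto elim: hs_closure.cases)
    then show ?thesis
      unfolding strong_CSP_def using c(1) N_sub[OF c(1)]
      by (intro exI[of _ "{c}"] conjI) (simp_all add: N_def)
  next
    case False
    let ?C = "{w. c \<rightarrow>\<^sup>*\<^bsub>G\<^esub> w}"
    have C_sub: "?C \<subseteq> X" if "X \<noteq> {}" "hereditary G X" "saturated G X" for X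
      using N_sub[OF \<open>c \<in> N\<close> that] that(2) by (auto simp: hereditary_def)
    \<comment> \<open>Descendants of a common vertex are common too, hence all regular in this case,
      which bounds the branching below c.\<close>
    have "?C \<subseteq> N"
      using C_sub reachable_in_verts(2) by (auto simp: N_def)
    then have "countable ?C" using False by (intro countable_descendants) blast
    moreover have "?C \<noteq> {}" using \<open>c \<in> N\<close> by (auto simp: N_def)
    moreover have "?C \<subseteq> verts G" using \<open>?C \<subseteq> N\<close> by (auto simp: N_def)
    moreover have "\<forall>u\<in>verts G. \<exists>v\<in>?C. u \<rightarrow>\<^sup>*\<^bsub>G\<^esub> v"
      using hs_closure_meets[OF closure[OF \<open>c \<in> N\<close>]] by blast
    moreover have "\<forall>X. X \<noteq> {} \<longrightarrow> hereditary G X \<longrightarrow> saturated G X \<longrightarrow> ?C \<subseteq> X"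
      using C_sub by simp
    ultimately show ?thesis unfolding strong_CSP_def by (intro exI[of _ ?C] conjI)
  qed
qed

end

section \<open>Quotient graphs\<close>

locale quotient = wf_digraph E for E :: "('v, 'e) pre_digraph" +
  fixes H S :: "'v set"
  assumes admissible: "admissible_pair E (H, S)"
begin

abbreviation F where "F \<equiv> quotient_graph E (H, S)"

text \<open>The vertices with a second, primed copy in the quotient graph.\<close>

definition unbroken :: "'v set" where
  "unbroken = breaking_vertices E H - S"

lemma H_hereditary: "hereditary E H" and H_saturated: "saturated E H"
  using admissible by (auto simp: admissible_pair_def)

lemma H_verts: "H \<subseteq> verts E" and H_edge: "e \<in> arcs E \<Longrightarrow> tail E e \<in> H \<Longrightarrow> head E e \<in> H"
  using H_hereditary by (auto simp: hereditary_iff)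

lemma unbroken_iff: "v \<in> unbroken \<longleftrightarrow> v \<in> verts E \<and> v \<notin> H \<and> v \<notin> S \<and> infinite (out_arcs E v) \<and>
    finite (live_arcs E H v) \<and> live_arcs E H v \<noteq> {}"
  by (auto simp: unbroken_def breaking_vertices_iff)

lemma unbroken_verts: "v \<in> unbroken \<Longrightarrow> v \<in> verts E" "v \<in> unbroken \<Longrightarrow> v \<notin> H"
  by (auto simp: unbroken_iff)

lemma quotient_graph_simps:
  "verts F = Inl ` (verts E - H) \<union> Inr ` unbroken"
  "arcs F = Inl ` {e \<in> arcs E. head E e \<notin> H} \<union> Inr ` {e \<in> arcs E. head E e \<in> unbroken}"
  "tail F (Inl e) = Inl (tail E e)" "tail F (Inr e) = Inl (tail E e)"
  "head F (Inl e) = Inl (head E e)" "head F (Inr e) = Inr (head E e)"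
  by (simp_all add: quotient_graph_def unbroken_def)

lemma wf_quotient: "wf_digraph F"
proof
  fix e assume "e \<in> arcs F"
  moreover have "tail E f \<notin> H" if "f \<in> arcs E" "head E f \<notin> H" for f
    using H_edge[of f] that by blast
  ultimately show "tail F e \<in> verts F" "head F e \<in> verts F"
    using unbroken_verts by (auto simp: quotient_graph_simps)
qed

sublocale F: wf_digraph F by (rule wf_quotient)

lemma out_arcs_quotient:
  "out_arcs F (Inl v) = Inl ` live_arcs E H v \<union> Inr ` {e \<in> live_arcs E H v. head E e \<in> unbroken}"
  "out_arcs F (Inr v) = {}"
  by (auto simp: out_arcs_def quotient_graph_simps live_arcs_def unbroken_iff)

text \<open>Primed edges duplicate some of the live edges, so the live edges alone decide. In
  particular every breaking vertex of H becomes regular, while primed vertices are sinks.\<close>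

lemma regular_quotient:
  "regular_vertex F x \<longleftrightarrow> (\<exists>v\<in>verts E - H. x = Inl v \<and> finite (live_arcs E H v) \<and> live_arcs E H v \<noteq> {})"
proof (cases x)
  case (Inl v)
  have "finite (out_arcs F (Inl v)) \<longleftrightarrow> finite (live_arcs E H v)"
    by (auto simp: out_arcs_quotient dest: finite_imageD)
  moreover have "out_arcs F (Inl v) \<noteq> {} \<longleftrightarrow> live_arcs E H v \<noteq> {}"
    by (auto simp: out_arcs_quotient)
  ultimately show ?thesis using Inl by (auto simp: regular_vertex_def quotient_graph_simps)
qed (auto simp: regular_vertex_def out_arcs_quotient)

text \<open>The vertex \<open>v\<close> of \<open>E\<close> corresponds to the sum of its copies in the quotient graph.\<close>

definition covered :: "('v + 'v) set \<Rightarrow> 'v \<Rightarrow> bool" where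
  "covered X v \<longleftrightarrow> Inl v \<in> X \<and> (v \<in> unbroken \<longrightarrow> Inr v \<in> X)"

lemma hereditary_quotient:
  "hereditary F X \<longleftrightarrow> X \<subseteq> verts F \<and>
    (\<forall>e\<in>arcs E. Inl (tail E e) \<in> X \<longrightarrow> head E e \<notin> H \<longrightarrow> covered X (head E e))"
  unfolding F.hereditary_iff quotient_graph_simps(2) ball_Un ball_simps covered_def
  using unbroken_verts by (auto simp: quotient_graph_simps(3-6))

lemma saturated_quotient:
  "saturated F X \<longleftrightarrow> (\<forall>v\<in>verts E - H. finite (live_arcs E H v) \<longrightarrow> live_arcs E H v \<noteq> {} \<longrightarrow>
     (\<forall>e\<in>live_arcs E H v. covered X (head E e)) \<longrightarrow> Inl v \<in> X)"
proof -
  have "head F ` out_arcs F (Inl v) \<subseteq> X \<longleftrightarrow> (\<forall>e\<in>live_arcs E H v. covered X (head E e))" for v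
    by (auto simp: out_arcs_quotient quotient_graph_simps covered_def image_subset_iff ball_Un)
  moreover have "saturated F X \<longleftrightarrow> (\<forall>v\<in>verts E - H. finite (live_arcs E H v) \<longrightarrow> live_arcs E H v \<noteq> {} \<longrightarrow>
      head F ` out_arcs F (Inl v) \<subseteq> X \<longrightarrow> Inl v \<in> X)"
    unfolding saturated_def regular_quotient by blast
  ultimately show ?thesis by simp
qed

text \<open>This and \<open>lifted_breaking\<close> describe the ideal of L_K(E) above I(H,S) that
  corresponds to X. Modulo I(H,S) a vertex outside H becomes the sum of its copies, and for a
  breaking vertex v the element v^H becomes 0 if v is in S and the primed copy of v
  otherwise.\<close>

definition lifted_verts :: "('v + 'v) set \<Rightarrow> 'v set" where
  "lifted_verts X = H \<union> {v \<in> verts E - H. covered X v}"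

definition lifted_breaking :: "('v + 'v) set \<Rightarrow> 'v set" where
  "lifted_breaking X = {w \<in> breaking_vertices E (lifted_verts X). w \<in> S \<or> w \<in> unbroken \<and> Inr w \<in> X}"

lemma lifted_admissible:
  assumes "hereditary F X" "saturated F X"
  shows "admissible_pair E (lifted_verts X, lifted_breaking X)"
proof -
  have her: "\<forall>e\<in>arcs E. Inl (tail E e) \<in> X \<longrightarrow> head E e \<notin> H \<longrightarrow> covered X (head E e)"
    using assms(1) by (simp add: hereditary_quotient)
  have "hereditary E (lifted_verts X)"
    unfolding hereditary_iff using her H_verts H_edge
    by (auto simp: lifted_verts_def covered_def)
  moreover have "saturated E (lifted_verts X)"
    unfolding saturated_def
  proof (intro allI impI)
    fix v assume v: "regular_vertex E v" "head E ` out_arcs E v \<subseteq> lifted_verts X"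
    show "v \<in> lifted_verts X"
    proof (cases "v \<in> H")
      case False
      have v': "v \<in> verts E" "finite (out_arcs E v)" using v(1) by (auto simp: regular_vertex_def)
      have "finite (live_arcs E H v)" by (rule finite_subset[OF live_arcs_subset v'(2)])
      moreover have "live_arcs E H v \<noteq> {}"
        using False v(1) H_saturated by (auto simp: saturated_def live_arcs_def)
      moreover have "covered X (head E e)" if "e \<in> live_arcs E H v" for e
        using v(2) that by (auto simp: live_arcs_def lifted_verts_def image_subset_iff)
      ultimately have "Inl v \<in> X"
        using assms(2) False v'(1) unfolding saturated_quotient by blast
      then show ?thesis using v' False by (auto simp: lifted_verts_def covered_def unbroken_iff)
    qed (simp add: lifted_verts_def)
  qed
  ultimately show ?thesis by (auto simp: admissible_pair_def lifted_breaking_def)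
qed

text \<open>Suppose that no new vertex appears. A primed member of X then gives a new breaking
  vertex. An unprimed one is not covered, hence unbroken, and so has a live edge; the end of that
  edge is covered because X is hereditary, a contradiction.\<close>

lemma lifted_not_le:
  assumes "hereditary F X" "X \<noteq> {}"
  shows "\<not> admissible_le (lifted_verts X, lifted_breaking X) (H, S)"
proof
  assume le: "admissible_le (lifted_verts X, lifted_breaking X) (H, S)"
  have her: "\<forall>e\<in>arcs E. Inl (tail E e) \<in> X \<longrightarrow> head E e \<notin> H \<longrightarrow> covered X (head E e)"
    and sub: "X \<subseteq> verts F"
    using assms(1) by (simp_all add: hereditary_quotient)
  have not_covered: "\<not> covered X v" if "v \<in> verts E - H" for v
    using le that by (auto simp: admissible_le_def lifted_verts_def)
  have lv: "lifted_verts X = H" using not_covered by (auto simp: lifted_verts_def)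
  obtain x where x: "x \<in> X" using assms(2) by blast
  show False
  proof (cases x)
    case (Inl v)
    then have v: "v \<in> verts E - H" using x sub by (auto simp: quotient_graph_simps)
    then have "v \<in> unbroken" using not_covered[OF v] x Inl by (auto simp: covered_def)
    then obtain e where e: "e \<in> live_arcs E H v" by (auto simp: unbroken_iff)
    then have "covered X (head E e)" "head E e \<in> verts E - H"
      using her x Inl by (auto simp: live_arcs_def)
    then show False using not_covered by blast
  next
    case (Inr w)
    then have w: "w \<in> unbroken" using x sub by (auto simp: quotient_graph_simps)
    then have "w \<in> lifted_breaking X"
      using x Inr by (auto simp: lifted_breaking_def lv unbroken_def)
    then show False using le w by (auto simp: admissible_le_def unbroken_iff)
  qed
qed

lemma lifted_corner:
  assumes "lpa_ideal E A" "ideal_verts E A = lifted_verts X" "ideal_breaking E A = lifted_breaking X"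
    and "w \<in> unbroken" "corner w (live_arcs E H w) \<in> A"
  shows "Inr w \<in> X"
proof -
  interpret A: lpa_ideal E A by fact
  have "w \<in> lifted_verts X \<union> lifted_breaking X"
    using A.corner_in_cases[of H w] assms by (auto simp: lifted_verts_def unbroken_def)
  then show ?thesis
    using assms(4) by (auto simp: lifted_verts_def lifted_breaking_def covered_def unbroken_iff)
qed

text \<open>Each nonempty hereditary saturated X yields an ideal \<open>A X\<close> not contained in
  P. Strong primeness passes this on to the intersection Q, the chain condition puts Q above P, and
  by \<open>ideal_eqI\<close> Q contains a vertex or a v^H outside P; its copy in F lies in every
  X.\<close>

lemma strong_CSP_quotient:
  fixes P :: "('v, 'e, 'k::field) lpa_free set"
  assumes K: "condition_K E"
    and chain: "\<And>I J :: ('v, 'e, 'k) lpa_free set. lpa_ideal E I \<Longrightarrow> lpa_ideal E J \<Longrightarrow> I \<subseteq> J \<or> J \<subseteq> I"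
    and P: "lpa_ideal E P" "ideal_verts E P = H" "ideal_breaking E P = S"
    and prime: "\<And>\<A>. \<A> \<noteq> {} \<Longrightarrow> (\<And>A. A \<in> \<A> \<Longrightarrow> lpa_ideal E A) \<Longrightarrow> \<Inter>\<A> \<subseteq> P \<Longrightarrow> \<exists>A\<in>\<A>. A \<subseteq> P"
    and proper: "H \<noteq> verts E"
  shows "strong_CSP F"
proof (rule F.strong_CSP_if_common_vertex)
  define \<X> where "\<X> = {X. X \<noteq> {} \<and> hereditary F X \<and> saturated F X}"
  have "\<exists>A :: ('v, 'e, 'k) lpa_free set. lpa_ideal E A \<and>
      ideal_verts E A = lifted_verts X \<and> ideal_breaking E A = lifted_breaking X" if "X \<in> \<X>" for X
  proof -
    have "hereditary F X" "saturated F X" using that by (simp_all add: \<X>_def)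
    then obtain A :: "('v, 'e, 'k) lpa_free set"
      where "lpa_ideal E A" "ideal_verts E A = lifted_verts X" "ideal_breaking E A = lifted_breaking X"
      using ideal_of_admissible_pair[OF wf_digraph_axioms lifted_admissible] by metis
    then show ?thesis by blast
  qed
  then obtain A :: "('v + 'v) set \<Rightarrow> ('v, 'e, 'k) lpa_free set"
    where A: "\<And>X. X \<in> \<X> \<Longrightarrow> lpa_ideal E (A X)"
      "\<And>X. X \<in> \<X> \<Longrightarrow> ideal_verts E (A X) = lifted_verts X"
      "\<And>X. X \<in> \<X> \<Longrightarrow> ideal_breaking E (A X) = lifted_breaking X"
    by metis
  \<comment> \<open>The whole vertex set of F is a member of the family, which is therefore
    nonempty, as strong primeness demands.\<close>
  have "verts F \<noteq> {}" using proper H_verts by (auto simp: quotient_graph_simps)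
  moreover have "hereditary F (verts F)" by (simp add: F.hereditary_iff)
  moreover have "saturated F (verts F)" by (auto simp: saturated_def regular_vertex_def)
  ultimately have "verts F \<in> \<X>" by (simp add: \<X>_def)
  then have nonempty: "A ` \<X> \<noteq> {}" by blast
  define Q where "Q = \<Inter>(A ` \<X>)"
  have Q: "lpa_ideal E Q" unfolding Q_def using nonempty A(1) by (intro lpa_ideal_Inter) auto
  have Q_sub: "Q \<subseteq> A X" if "X \<in> \<X>" for X using that by (auto simp: Q_def)
  have "\<not> A X \<subseteq> P" if "X \<in> \<X>" for X
    using ideal_pair_mono[OF P(1), of "A X"] A(2,3)[OF that] P(2,3) lifted_not_le[of X] that
    by (auto simp: \<X>_def)
  then have "\<not> Q \<subseteq> P"
    using prime[OF nonempty] A(1) unfolding Q_def by blast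
  then have "P \<subseteq> Q" "P \<noteq> Q" using chain[OF P(1) Q] by auto
  show "\<exists>c\<in>verts F. \<forall>X. X \<noteq> {} \<longrightarrow> hereditary F X \<longrightarrow> saturated F X \<longrightarrow> c \<in> X"
  proof (cases "ideal_verts E Q = H")
    case False
    then obtain v where v: "v \<in> ideal_verts E Q" "v \<notin> H"
      using ideal_verts_mono[OF \<open>P \<subseteq> Q\<close>, of E] P(2) by blast
    have "Inl v \<in> X" if "X \<in> \<X>" for X
    proof -
      have "v \<in> lifted_verts X" using ideal_verts_mono[OF Q_sub[OF that], of E] A(2)[OF that] v(1) by blast
      then show ?thesis using v(2) by (simp add: lifted_verts_def covered_def)
    qed
    moreover have "Inl v \<in> verts F" using v by (auto simp: quotient_graph_simps ideal_verts_def)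
    ultimately show ?thesis unfolding \<X>_def by blast
  next
    case True
    then have "ideal_breaking E Q \<noteq> S"
      using ideal_eqI[OF K P(1) Q \<open>P \<subseteq> Q\<close>] P(2,3) \<open>P \<noteq> Q\<close> by auto
    moreover have "S \<subseteq> ideal_breaking E Q"
      using P(2,3) True \<open>P \<subseteq> Q\<close> by (auto simp: ideal_breaking_def)
    ultimately obtain w where w: "w \<in> ideal_breaking E Q" "w \<notin> S" by blast
    then have w': "w \<in> unbroken" "corner w (live_arcs E H w) \<in> Q"
      using True by (auto simp: ideal_breaking_def unbroken_def)
    have "Inr w \<in> X" if "X \<in> \<X>" for X
      using lifted_corner[OF A[OF that] w'(1)] w'(2) Q_sub[OF that] by blast
    moreover have "Inr w \<in> verts F" using w' by (auto simp: quotient_graph_simps)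
    ultimately show ?thesis unfolding \<X>_def by blast
  qed
qed

end

section \<open>Ideals above P and sets of vertices of the quotient graph\<close>

locale quotient_ideal = quotient E H S + P: lpa_ideal E P
  for E :: "('v, 'e) pre_digraph" and H S and P :: "('v, 'e, 'k::field) lpa_free set" +
  assumes P_verts: "ideal_verts E P = H" and P_breaking: "ideal_breaking E P = S"
begin

text \<open>The vertices of F whose elements lie in A modulo P. For unbroken v the primed copy
  stands for v^H and the unprimed one for v - v^H, the sum of e e* over the live edges, which lies
  in A exactly if their ends do.\<close>

definition ideal_image :: "('v, 'e, 'k) lpa_free set \<Rightarrow> ('v + 'v) set" where
  "ideal_image A = Inl ` {v \<in> verts E - H. if v \<in> unbroken
      then (\<forall>e\<in>live_arcs E H v. head E e \<in> ideal_verts E A) else v \<in> ideal_verts E A} \<union>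
    Inr ` {v \<in> unbroken. corner v (live_arcs E H v) \<in> A}"

lemma ideal_image_iff:
  "Inl v \<in> ideal_image A \<longleftrightarrow> v \<in> verts E - H \<and> (if v \<in> unbroken
      then \<forall>e\<in>live_arcs E H v. head E e \<in> ideal_verts E A else v \<in> ideal_verts E A)"
  "Inr v \<in> ideal_image A \<longleftrightarrow> v \<in> unbroken \<and> corner v (live_arcs E H v) \<in> A"
  by (auto simp: ideal_image_def)

context
  fixes A :: "('v, 'e, 'k) lpa_free set"
  assumes A: "lpa_ideal E A" and PA: "P \<subseteq> A"
begin

interpretation A: lpa_ideal E A by (rule A)

lemma H_sub_A: "H \<subseteq> ideal_verts E A"
  using ideal_verts_mono[OF PA, of E] P_verts by blast

lemma vertex_if_corner:
  assumes "v \<in> verts E" "finite (live_arcs E H v)" "corner v (live_arcs E H v) \<in> A"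
    "\<And>e. e \<in> live_arcs E H v \<Longrightarrow> head E e \<in> ideal_verts E A"
  shows "v \<in> ideal_verts E A"
proof -
  have "corner v (live_arcs E H v) + (\<Sum>e\<in>live_arcs E H v. monom_word [Edge e, Ghost e]) \<in> A"
    using assms(3,4) by (intro A.I_closed A.I_sum) (auto simp: A.edge_ghost_in_iff live_arcs_def ideal_verts_def)
  then show ?thesis using assms(1) by (simp add: corner_def ideal_verts_def)
qed

text \<open>An unbroken v is the sum of v^H and v - v^H, both multiples of v, so it lies in A
  exactly if both do.\<close>

lemma covered_ideal_image:
  assumes "v \<in> verts E - H"
  shows "covered (ideal_image A) v \<longleftrightarrow> v \<in> ideal_verts E A"
proof (cases "v \<in> unbroken")
  case True
  have "v \<in> ideal_verts E A \<Longrightarrow> \<forall>e\<in>live_arcs E H v. head E e \<in> ideal_verts E A"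
    using A.hereditary_ideal_verts by (auto simp: hereditary_iff live_arcs_def)
  moreover have "v \<in> ideal_verts E A \<Longrightarrow> corner v (live_arcs E H v) \<in> A"
    using A.corner_in[OF H_sub_A, of v] True by (auto simp: unbroken_def)
  moreover have "(\<forall>e\<in>live_arcs E H v. head E e \<in> ideal_verts E A) \<Longrightarrow> corner v (live_arcs E H v) \<in> A \<Longrightarrow>
      v \<in> ideal_verts E A"
    by (rule vertex_if_corner) (use True in \<open>simp_all add: unbroken_iff\<close>)
  ultimately show ?thesis using assms True by (simp add: covered_def ideal_image_iff) blast
next
  case False
  then show ?thesis using assms by (simp add: covered_def ideal_image_iff)
qed

lemma ideal_image_hereditary: "hereditary F (ideal_image A)"
  unfolding hereditary_quotient
proof (intro conjI ballI impI)
  show "ideal_image A \<subseteq> verts F" by (auto simp: ideal_image_def quotient_graph_simps)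
  fix e assume e: "e \<in> arcs E" "Inl (tail E e) \<in> ideal_image A" "head E e \<notin> H"
  have "head E e \<in> ideal_verts E A"
  proof (cases "tail E e \<in> unbroken")
    case True
    then show ?thesis using e by (auto simp: ideal_image_iff live_arcs_def)
  next
    case False
    then have "tail E e \<in> ideal_verts E A" using e by (simp add: ideal_image_iff)
    then show ?thesis using A.hereditary_ideal_verts e(1) by (auto simp: hereditary_iff)
  qed
  then show "covered (ideal_image A) (head E e)" using covered_ideal_image e by auto
qed

lemma ideal_image_saturated: "saturated F (ideal_image A)"
  unfolding saturated_quotient
proof (intro ballI impI)
  fix v assume v: "v \<in> verts E - H" "finite (live_arcs E H v)" "live_arcs E H v \<noteq> {}"
    "\<forall>e\<in>live_arcs E H v. covered (ideal_image A) (head E e)"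
  have heads: "head E e \<in> ideal_verts E A" if "e \<in> live_arcs E H v" for e
  proof -
    have "head E e \<in> verts E - H" using that by (auto simp: live_arcs_def)
    then show ?thesis using covered_ideal_image v(4) that by blast
  qed
  show "Inl v \<in> ideal_image A"
  proof (cases "v \<in> unbroken")
    case True
    then show ?thesis using v(1) heads by (simp add: ideal_image_iff)
  next
    case False
    have "v \<in> ideal_verts E A"
    proof (cases "finite (out_arcs E v)")
      case True
      have "out_arcs E v \<noteq> {}" using v(3) live_arcs_subset[of E H v] by auto
      then have "regular_vertex E v" using v(1) True by (simp add: regular_vertex_def)
      moreover have "head E ` out_arcs E v \<subseteq> ideal_verts E A"
      proof (rule image_subsetI)
        fix e assume "e \<in> out_arcs E v"
        then show "head E e \<in> ideal_verts E A"
          using heads[of e] H_sub_A by (cases "head E e \<in> H") (auto simp: live_arcs_def)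
      qed
      ultimately show ?thesis using A.saturated_ideal_verts by (simp add: saturated_def)
    next
      case inf: False
      \<comment> \<open>An infinite emitter outside H with finitely many live edges, at least one,
        is breaking; not being unbroken it belongs to S, and its v^H lies already in P.\<close>
      then have "v \<in> S" using False v by (auto simp: unbroken_iff)
      then have "corner v (live_arcs E H v) \<in> A"
        using P_verts P_breaking PA by (auto simp: ideal_breaking_def)
      then show ?thesis by (rule vertex_if_corner[rotated 2]) (use v heads in auto)
    qed
    then show ?thesis using v(1) False by (simp add: ideal_image_iff)
  qed
qed

lemma ideal_image_nonempty:
  assumes "condition_K E" "A \<noteq> P"
  shows "ideal_image A \<noteq> {}"
proof (cases "ideal_verts E A = H")
  case False
  then obtain v where v: "v \<in> ideal_verts E A" "v \<notin> H" using H_sub_A by blast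
  then have "v \<in> verts E - H" by (simp add: ideal_verts_def)
  then have "covered (ideal_image A) v" using covered_ideal_image v(1) by blast
  then show ?thesis by (auto simp: covered_def)
next
  case True
  then have "ideal_breaking E A \<noteq> S"
    using ideal_eqI[OF assms(1) P.lpa_ideal_axioms A PA] P_verts P_breaking assms(2) by auto
  moreover have "S \<subseteq> ideal_breaking E A"
    using P_verts P_breaking True PA by (auto simp: ideal_breaking_def)
  ultimately obtain w where "w \<in> ideal_breaking E A" "w \<notin> S" by blast
  then have "Inr w \<in> ideal_image A"
    using True by (simp add: ideal_breaking_def ideal_image_iff unbroken_def)
  then show ?thesis by blast
qed

end

text \<open>A member of C lies in the image of every ideal properly above P, because these images
  are nonempty, hereditary and saturated; so the element it stands for lies in all these
  ideals.\<close>

lemma least_idempotent: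
  assumes K: "condition_K E" and CSP: "strong_CSP F"
  obtains \<epsilon> where "\<epsilon> \<in> lpa_carrier E" "\<epsilon> \<notin> P" "\<epsilon> * \<epsilon> - \<epsilon> \<in> P"
    "\<And>A. lpa_ideal E A \<Longrightarrow> P \<subseteq> A \<Longrightarrow> A \<noteq> P \<Longrightarrow> \<epsilon> \<in> A"
proof -
  note witness = that
  obtain C where C: "C \<subseteq> verts F" "C \<noteq> {}"
    "\<And>X. X \<noteq> {} \<Longrightarrow> hereditary F X \<Longrightarrow> saturated F X \<Longrightarrow> C \<subseteq> X"
    using CSP unfolding strong_CSP_def by metis
  obtain c where "c \<in> C" using C(2) by blast
  have c: "c \<in> ideal_image A" if "lpa_ideal E A" "P \<subseteq> A" "A \<noteq> P" for A
    using C(3)[OF ideal_image_nonempty[OF that(1,2) K that(3)] ideal_image_hereditary[OF that(1,2)]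
        ideal_image_saturated[OF that(1,2)]] \<open>c \<in> C\<close> by blast
  have vertex: thesis if v: "v \<in> verts E - H"
    and least: "\<And>A. lpa_ideal E A \<Longrightarrow> P \<subseteq> A \<Longrightarrow> A \<noteq> P \<Longrightarrow> v \<in> ideal_verts E A" for v
  proof (rule witness[of "monom_word [Vertex v]"])
    show "monom_word [Vertex v] \<in> lpa_carrier E" using v by (auto intro: carrier_monom)
    show "monom_word [Vertex v] \<notin> P" using v P_verts by (auto simp: ideal_verts_def)
    show "monom_word [Vertex v] * monom_word [Vertex v] - monom_word [Vertex v] \<in> P"
      using P.vtx_idem[of v] v by (simp add: P.cong_def)
    show "monom_word [Vertex v] \<in> A" if "lpa_ideal E A" "P \<subseteq> A" "A \<noteq> P" for A
      using least[OF that] by (simp add: ideal_verts_def)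
  qed
  show thesis
  proof (cases c)
    case (Inl v)
    then have v: "v \<in> verts E - H" using C(1) \<open>c \<in> C\<close> by (auto simp: quotient_graph_simps)
    show thesis
    proof (cases "v \<in> unbroken")
      case True
      \<comment> \<open>Here c stands for a sum of e e*; the end of one live edge is a simpler
        idempotent that also lies in all these ideals.\<close>
      then obtain e where e: "e \<in> live_arcs E H v" by (auto simp: unbroken_iff)
      show thesis
      proof (rule vertex)
        show "head E e \<in> verts E - H" using e by (auto simp: live_arcs_def)
        show "head E e \<in> ideal_verts E A" if "lpa_ideal E A" "P \<subseteq> A" "A \<noteq> P" for A
          using c[OF that] Inl True e by (simp add: ideal_image_iff)
      qed
    next
      case False
      show thesis
        by (rule vertex[OF v]) (use c Inl False in \<open>simp add: ideal_image_iff\<close>)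
    qed
  next
    case (Inr w)
    then have w: "w \<in> unbroken" using C(1) \<open>c \<in> C\<close> by (auto simp: quotient_graph_simps)
    then have w': "w \<in> verts E" "finite (live_arcs E H w)" "live_arcs E H w \<subseteq> out_arcs E w"
      using live_arcs_subset[of E H w] by (simp_all add: unbroken_iff)
    show thesis
    proof (rule witness[of "corner w (live_arcs E H w)"])
      show "corner w (live_arcs E H w) \<in> lpa_carrier E"
        using w' by (intro corner_carrier) (auto simp: live_arcs_def)
      show "corner w (live_arcs E H w) \<notin> P"
        using w P_verts P_breaking by (auto simp: unbroken_def ideal_breaking_def)
      show "corner w (live_arcs E H w) * corner w (live_arcs E H w) - corner w (live_arcs E H w) \<in> P"
        using P.corner_idem[OF w'] by (simp add: P.cong_def)
      show "corner w (live_arcs E H w) \<in> A" if "lpa_ideal E A" "P \<subseteq> A" "A \<noteq> P" for A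
        using c[OF that] Inr by (simp add: ideal_image_iff)
    qed
  qed
qed

end

section \<open>Gradedness\<close>

definition homogeneous :: "int \<Rightarrow> ('v, 'e, 'k::field) lpa_free \<Rightarrow> bool" where
  "homogeneous n p \<longleftrightarrow> (\<forall>w\<in>Poly_Mapping.keys p. sum_list (map gen_degree (letters w)) = n)"

lemma homogeneous_0: "homogeneous n 0"
  by (simp add: homogeneous_def)

lemma homogeneous_add: "homogeneous n p \<Longrightarrow> homogeneous n q \<Longrightarrow> homogeneous n (p + q)"
  using Poly_Mapping.keys_add[of p q] by (auto simp: homogeneous_def)

lemma homogeneous_uminus: "homogeneous n p \<Longrightarrow> homogeneous n (- p)"
  by (auto simp: homogeneous_def in_keys_iff)

lemma homogeneous_diff: "homogeneous n p \<Longrightarrow> homogeneous n q \<Longrightarrow> homogeneous n (p - q)"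
  using homogeneous_add[of n p "- q"] homogeneous_uminus[of n q] by simp

lemma homogeneous_sum: "(\<And>i. i \<in> A \<Longrightarrow> homogeneous n (f i)) \<Longrightarrow> homogeneous n (sum f A)"
  by (induct A rule: infinite_finite_induct) (auto intro: homogeneous_0 homogeneous_add)

lemma homogeneous_mult: "homogeneous m p \<Longrightarrow> homogeneous n q \<Longrightarrow> homogeneous (m + n) (p * q)"
  using Poly_Mapping.keys_mult[of p q] by (fastforce simp: homogeneous_def)

lemma homogeneous_monom: "homogeneous (sum_list (map gen_degree w)) (monom_word w)"
  by (simp add: homogeneous_def monom_word_def)

lemma homogeneous_scale: "homogeneous n p \<Longrightarrow> homogeneous n (scale c p)"
  by (auto simp: homogeneous_def in_keys_iff lookup_scale)

lemma homogeneous_corner: "homogeneous 0 (corner v F)"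
  unfolding corner_def
  using homogeneous_monom[of "[Vertex v]"] homogeneous_monom[of "[Edge _, Ghost _]"]
  by (intro homogeneous_diff homogeneous_sum) auto

context lpa_ideal
begin

text \<open>The largest graded ideal inside I. The summands are homogeneous in the free algebra,
  hence the passage modulo the kernel.\<close>

definition graded_part :: "('v, 'e, 'k) lpa_free set" where
  "graded_part = {p. \<exists>N f. finite N \<and> (\<forall>n\<in>N. f n \<in> I \<and> homogeneous n (f n)) \<and>
     p - (\<Sum>n\<in>N. f n) \<in> lpa_kernel E}"

lemma graded_partI:
  "finite N \<Longrightarrow> (\<And>n. n \<in> N \<Longrightarrow> f n \<in> I \<and> homogeneous n (f n)) \<Longrightarrow>
    p - (\<Sum>n\<in>N. f n) \<in> lpa_kernel E \<Longrightarrow> p \<in> graded_part"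
  unfolding graded_part_def by blast

lemma graded_part_subset: "graded_part \<subseteq> I"
proof
  fix p assume "p \<in> graded_part"
  then obtain N f where f: "\<forall>n\<in>N. f n \<in> I \<and> homogeneous n (f n)" "p - (\<Sum>n\<in>N. f n) \<in> lpa_kernel E"
    by (auto simp: graded_part_def)
  then have "(\<Sum>n\<in>N. f n) \<in> I" by (intro I_sum) blast
  then have "(p - (\<Sum>n\<in>N. f n)) + (\<Sum>n\<in>N. f n) \<in> I" using f(2) kernel by (intro I_closed) blast+
  then show "p \<in> I" by simp
qed

lemma homogeneous_graded_part: "p \<in> I \<Longrightarrow> homogeneous n p \<Longrightarrow> p \<in> graded_part"
  using lpa_ideal.I_closed(1)[OF lpa_ideal_kernel[OF wf]] by (intro graded_partI[of "{n}" "\<lambda>_. p"]) auto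

lemma graded_part_add:
  assumes "p \<in> graded_part" "q \<in> graded_part"
  shows "p + q \<in> graded_part"
proof -
  interpret K: lpa_ideal E "lpa_kernel E :: ('v, 'e, 'k) lpa_free set" by (rule lpa_ideal_kernel[OF wf])
  obtain N f where f: "finite N" "\<forall>n\<in>N. f n \<in> I \<and> homogeneous n (f n)" "p - (\<Sum>n\<in>N. f n) \<in> lpa_kernel E"
    using assms(1) by (auto simp: graded_part_def)
  obtain M g where g: "finite M" "\<forall>n\<in>M. g n \<in> I \<and> homogeneous n (g n)" "q - (\<Sum>n\<in>M. g n) \<in> lpa_kernel E"
    using assms(2) by (auto simp: graded_part_def)
  define h where "h n = (if n \<in> N then f n else 0) + (if n \<in> M then g n else 0)" for n
  have "(\<Sum>n\<in>N \<union> M. h n) = (\<Sum>n\<in>N \<union> M. if n \<in> N then f n else 0) + (\<Sum>n\<in>N \<union> M. if n \<in> M then g n else 0)"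
    by (simp add: h_def sum.distrib)
  also have "(\<Sum>n\<in>N \<union> M. if n \<in> N then f n else 0) = (\<Sum>n\<in>N. f n)"
    using f(1) g(1) by (intro sum.mono_neutral_cong_right) auto
  also have "(\<Sum>n\<in>N \<union> M. if n \<in> M then g n else 0) = (\<Sum>n\<in>M. g n)"
    using f(1) g(1) by (intro sum.mono_neutral_cong_right) auto
  finally have "p + q - (\<Sum>n\<in>N \<union> M. h n) \<in> lpa_kernel E"
    using K.I_closed(2)[OF f(3) g(3)] by (simp add: algebra_simps)
  moreover have "h n \<in> I \<and> homogeneous n (h n)" for n
    using f(2) g(2) by (auto simp: h_def intro: I_closed homogeneous_add homogeneous_0)
  ultimately show ?thesis using f(1) g(1) by (intro graded_partI[of "N \<union> M" h]) auto
qed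

lemma graded_part_mult_monom:
  assumes p: "p \<in> graded_part" and w: "set w \<subseteq> lpa_gens E" "w \<noteq> []"
  shows "scale c (monom_word w) * p \<in> graded_part" "p * scale c (monom_word w) \<in> graded_part"
proof -
  interpret K: lpa_ideal E "lpa_kernel E :: ('v, 'e, 'k) lpa_free set" by (rule lpa_ideal_kernel[OF wf])
  obtain N f where f: "finite N" "\<forall>n\<in>N. f n \<in> I \<and> homogeneous n (f n)" "p - (\<Sum>n\<in>N. f n) \<in> lpa_kernel E"
    using p by (auto simp: graded_part_def)
  define d where "d = sum_list (map gen_degree w)"
  define x :: "('v, 'e, 'k) lpa_free" where "x = scale c (monom_word w)"
  have x: "x \<in> lpa_carrier E" "homogeneous d x"
    unfolding x_def d_def using w by (auto intro: carrier_scale carrier_monom homogeneous_scale homogeneous_monom)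
  \<comment> \<open>A word of degree d moves a component of degree n to degree d + n, so the sums
    are reindexed by translation.\<close>
  have shift: "(\<Sum>n\<in>(+) d ` N. g (n - d)) = (\<Sum>n\<in>N. g n)" for g :: "int \<Rightarrow> ('v, 'e, 'k) lpa_free"
    by (subst sum.reindex) (auto simp: inj_on_def)
  have "x * p \<in> graded_part"
  proof (rule graded_partI[of "(+) d ` N" "\<lambda>n. x * f (n - d)"])
    show "x * p - (\<Sum>n\<in>(+) d ` N. x * f (n - d)) \<in> lpa_kernel E"
      using K.I_mult(1)[OF x(1) f(3)] shift[of "\<lambda>n. x * f n"] by (simp add: right_diff_distrib sum_distrib_left)
    show "x * f (n - d) \<in> I \<and> homogeneous n (x * f (n - d))" if "n \<in> (+) d ` N" for n
      using that f(2) I_mult(1)[OF x(1)] homogeneous_mult[OF x(2), of "n - d" "f (n - d)"] by auto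
  qed (use f(1) in simp)
  then show "scale c (monom_word w) * p \<in> graded_part" by (simp add: x_def)
  have "p * x \<in> graded_part"
  proof (rule graded_partI[of "(+) d ` N" "\<lambda>n. f (n - d) * x"])
    show "p * x - (\<Sum>n\<in>(+) d ` N. f (n - d) * x) \<in> lpa_kernel E"
      using K.I_mult(2)[OF x(1) f(3)] shift[of "\<lambda>n. f n * x"] by (simp add: left_diff_distrib sum_distrib_right)
    show "f (n - d) * x \<in> I \<and> homogeneous n (f (n - d) * x)" if "n \<in> (+) d ` N" for n
      using that f(2) I_mult(2)[OF x(1)] homogeneous_mult[OF _ x(2), of "n - d" "f (n - d)"] by auto
  qed (use f(1) in simp)
  then show "p * scale c (monom_word w) \<in> graded_part" by (simp add: x_def)
qed

lemma graded_part_ideal: "lpa_ideal E graded_part"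
proof (rule lpa_ideal.intro)
  interpret K: lpa_ideal E "lpa_kernel E :: ('v, 'e, 'k) lpa_free set" by (rule lpa_ideal_kernel[OF wf])
  show "wf_digraph E" by (rule wf)
  show kernel: "lpa_kernel E \<subseteq> graded_part"
    by (auto intro: graded_partI[of "{}" "\<lambda>_. 0"])
  have zero: "0 \<in> graded_part" using kernel K.I_closed(1) by blast
  have neg: "- p \<in> graded_part" if p: "p \<in> graded_part" for p
  proof -
    obtain N f where f: "finite N" "\<forall>n\<in>N. f n \<in> I \<and> homogeneous n (f n)" "p - (\<Sum>n\<in>N. f n) \<in> lpa_kernel E"
      using p by (auto simp: graded_part_def)
    then show ?thesis
      using K.I_closed(3)[OF f(3)]
      by (intro graded_partI[of N "\<lambda>n. - f n"]) (auto simp: sum_negf intro: I_closed homogeneous_uminus)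
  qed
  have mult: "x * p \<in> graded_part \<and> p * x \<in> graded_part" if "x \<in> lpa_carrier E" "p \<in> graded_part" for x p
    using that(1)
  proof (induct x rule: carrier_induct)
    case zero
    then show ?case using \<open>0 \<in> graded_part\<close> by simp
  next
    case (add x y)
    then show ?case by (simp add: distrib_left distrib_right graded_part_add)
  next
    case (scale c w)
    then show ?case using graded_part_mult_monom that(2) by blast
  qed
  show "rng_ideal graded_part (free_rng (lpa_gens E))"
    unfolding free_rng_ideal_iff
    using zero neg mult graded_part_add graded_part_subset I_closed(4) by blast
qed

text \<open>Vertices and the elements v^H are homogeneous of degree 0, so I and its graded part have
  the same pair.\<close>

lemma graded_part_eq:
  assumes "condition_K E"
  shows "graded_part = I"
proof (rule ideal_eqI[OF assms graded_part_ideal lpa_ideal_axioms graded_part_subset])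
  have "homogeneous 0 (monom_word [Vertex v])" for v :: 'v
    using homogeneous_monom[of "[Vertex v]"] by simp
  then show verts: "ideal_verts E graded_part = ideal_verts E I"
    using homogeneous_graded_part graded_part_subset by (auto simp: ideal_verts_def)
  show "ideal_breaking E graded_part = ideal_breaking E I"
    using homogeneous_graded_part[OF _ homogeneous_corner] graded_part_subset
    by (auto simp: ideal_breaking_def verts)
qed

text \<open>Sums of vertices are local units, so the vertices generate the whole algebra as an
  ideal.\<close>

lemma carrier_if_all_verts:
  assumes "ideal_verts E I = verts E"
  shows "I = lpa_carrier E"
proof
  show "I \<subseteq> lpa_carrier E" using I_closed(4) by blast
  show "lpa_carrier E \<subseteq> I"
  proof
    fix x :: "('v, 'e, 'k) lpa_free" assume x: "x \<in> lpa_carrier E"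
    obtain W where W: "W \<subseteq> verts E" "(\<Sum>w\<in>W. x * vtx w) \<approx> x" using local_unit_right[OF x] by blast
    have "vtx w \<in> I" if "w \<in> W" for w using assms that W(1) by (auto simp: ideal_verts_def)
    then have "(\<Sum>w\<in>W. x * vtx w) \<in> I" by (intro I_sum I_mult(1) x)
    then show "x \<in> I" using W(2) cong_mem_iff by blast
  qed
qed

end

section \<open>The free algebra and its quotient\<close>

definition class_preimage :: "('v, 'e) pre_digraph \<Rightarrow> ('v, 'e, 'k::field) lpa_free set set \<Rightarrow> ('v, 'e, 'k) lpa_free set" where
  "class_preimage E P = {p \<in> lpa_carrier E. lpa_class E p \<in> P}"

locale leavitt = wf_digraph E for E :: "('v, 'e) pre_digraph" +
  fixes L :: "('v, 'e, 'k::field) lpa_free set ring"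
  assumes L_def: "L = lpa TYPE('k) E"
begin

abbreviation (input) R :: "('v, 'e, 'k) lpa_free ring" where "R \<equiv> free_rng (lpa_gens E)"

lemma kernel_ideal': "rng_ideal (lpa_kernel E) R"
  by (rule kernel_ideal) unfold_locales

interpretation R: nonunital_ring R by (rule free_rng_nonunital)

lemma L_eq: "L = R Quot lpa_kernel E"
  by (simp add: L_def lpa_def)

lemma L_nonunital: "nonunital_ring L"
  unfolding L_eq by (rule R.FactRing_nonunital[OF kernel_ideal'])

lemma class_eq: "lpa_class E p = lpa_kernel E +>\<^bsub>R\<^esub> p"
  by (simp add: lpa_class_def)

lemma L_carrier: "carrier L = lpa_class E ` lpa_carrier E"
  unfolding L_eq R.carrier_FactRing by (simp add: class_eq)

lemma L_ops:
  assumes "p \<in> lpa_carrier E" "q \<in> lpa_carrier E"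
  shows "lpa_class E p \<oplus>\<^bsub>L\<^esub> lpa_class E q = lpa_class E (p + q)"
    "lpa_class E p \<otimes>\<^bsub>L\<^esub> lpa_class E q = lpa_class E (p * q)"
    "\<ominus>\<^bsub>L\<^esub> lpa_class E p = lpa_class E (- p)"
  using R.FactRing_simps'[OF kernel_ideal' assms] R.FactRing_minus[OF kernel_ideal' assms(1)]
  by (simp_all add: class_eq L_eq free_rng_a_inv[OF assms(1)])

lemma class_eq_iff:
  assumes "p \<in> lpa_carrier E" "q \<in> lpa_carrier E"
  shows "lpa_class E p = lpa_class E q \<longleftrightarrow> p - q \<in> (lpa_kernel E :: ('v, 'e, 'k) lpa_free set)"
  using R.coset_eq_iff[of "lpa_kernel E" p q] kernel_ideal' assms
  by (simp add: class_eq rng_ideal_def a_minus_def free_rng_a_inv)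

lemma preimage_ideal:
  assumes "rng_ideal P L"
  shows "lpa_ideal E (class_preimage E P)" "lpa_class E ` class_preimage E P = P"
proof -
  note * = R.coset_preimage_ideal[OF kernel_ideal' assms[unfolded L_eq]]
  have eq: "class_preimage E P = {x \<in> carrier R. lpa_kernel E +>\<^bsub>R\<^esub> x \<in> P}"
    by (simp add: class_preimage_def class_eq)
  show "lpa_ideal E (class_preimage E P)"
    unfolding eq using * by (intro lpa_ideal.intro) (auto intro: wf_digraph_axioms)
  show "lpa_class E ` class_preimage E P = P"
    using *(3) by (simp add: eq class_eq)
qed

lemma image_ideal:
  assumes "lpa_ideal E (I :: ('v, 'e, 'k) lpa_free set)"
  shows "rng_ideal (lpa_class E ` I) L" "class_preimage E (lpa_class E ` I) = I"
proof -
  interpret lpa_ideal E I by fact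
  note * = R.coset_image_ideal[OF kernel_ideal' ideal kernel]
  show "rng_ideal (lpa_class E ` I) L" using *(1) by (simp add: L_eq class_eq)
  show "class_preimage E (lpa_class E ` I) = I" using *(2) by (simp add: class_preimage_def class_eq)
qed

lemma preimage_mono_iff:
  assumes "rng_ideal P L" "rng_ideal Q L"
  shows "class_preimage E P \<subseteq> class_preimage E Q \<longleftrightarrow> P \<subseteq> Q"
proof
  assume "class_preimage E P \<subseteq> class_preimage E Q"
  then have "lpa_class E ` class_preimage E P \<subseteq> lpa_class E ` class_preimage E Q" by (rule image_mono)
  then show "P \<subseteq> Q" using preimage_ideal(2) assms by simp
qed (auto simp: class_preimage_def)

lemma proper_iff:
  assumes "rng_ideal P L"
  shows "proper_ideal P L \<longleftrightarrow> class_preimage E P \<noteq> lpa_carrier E"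
proof -
  have "class_preimage E P = lpa_carrier E \<longleftrightarrow> P = carrier L"
    using preimage_ideal(2)[OF assms] L_carrier by (auto simp: class_preimage_def)
  then show ?thesis using assms by (simp add: proper_ideal_def)
qed

lemma gr_pair_eq:
  "gr_pair TYPE('k) E P = (ideal_verts E (class_preimage E P), ideal_breaking E (class_preimage E P))"
proof -
  have verts: "{v \<in> verts E. lpa_vertex TYPE('k) E v \<in> P} = ideal_verts E (class_preimage E P)"
    by (auto simp: ideal_verts_def class_preimage_def lpa_vertex_def intro: carrier_monom)
  have "lpa_breaking_elt TYPE('k) E H v \<in> P \<longleftrightarrow> corner v (live_arcs E H v) \<in> class_preimage E P"
    if "v \<in> breaking_vertices E H" for v H
  proof -
    have "(corner v (live_arcs E H v) :: ('v, 'e, 'k) lpa_free) \<in> lpa_carrier E"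
      using that by (intro corner_carrier) (auto simp: breaking_vertices_iff live_arcs_def)
    then show ?thesis
      by (simp add: class_preimage_def lpa_breaking_elt_def corner_def live_arcs_def)
  qed
  then show ?thesis
    unfolding gr_pair_def Let_def verts by (auto simp: ideal_breaking_def)
qed

definition free_strongly_prime :: "('v, 'e, 'k) lpa_free set \<Rightarrow> bool" where
  "free_strongly_prime P \<longleftrightarrow>
    (\<forall>\<A>. \<A> \<noteq> {} \<longrightarrow> (\<forall>A\<in>\<A>. lpa_ideal E A) \<longrightarrow> \<Inter>\<A> \<subseteq> P \<longrightarrow> (\<exists>A\<in>\<A>. A \<subseteq> P))"

text \<open>Taking images in L commutes with these intersections because every A contains the kernel
  and so is the full preimage of its image.\<close>

lemma strongly_prime_iff:
  assumes P: "proper_ideal P L"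
  shows "strongly_prime P L \<longleftrightarrow> free_strongly_prime (class_preimage E P)"
proof
  have PL: "rng_ideal P L" using P by (simp add: proper_ideal_def)
  assume sp: "strongly_prime P L"
  show "free_strongly_prime (class_preimage E P)"
    unfolding free_strongly_prime_def
  proof (intro allI impI)
    fix \<A> :: "('v, 'e, 'k) lpa_free set set"
    assume \<A>: "\<A> \<noteq> {}" "\<forall>A\<in>\<A>. lpa_ideal E A" "\<Inter>\<A> \<subseteq> class_preimage E P"
    have sub: "\<Inter>((`) (lpa_class E) ` \<A>) \<subseteq> P"
    proof
      fix x assume x: "x \<in> \<Inter>((`) (lpa_class E) ` \<A>)"
      obtain A0 where A0: "A0 \<in> \<A>" using \<A>(1) by blast
      then obtain p where p: "p \<in> A0" "x = lpa_class E p" using x by blast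
      have pc: "p \<in> lpa_carrier E" using \<A>(2) A0 p(1) lpa_ideal.I_closed(4) by blast
      have "p \<in> A" if "A \<in> \<A>" for A
      proof -
        have "p \<in> class_preimage E (lpa_class E ` A)"
          using x that p(2) pc by (auto simp: class_preimage_def)
        then show ?thesis using image_ideal(2) \<A>(2) that by blast
      qed
      then show "x \<in> P" using \<A>(3) p(2) by (auto simp: class_preimage_def)
    qed
    have ideals: "\<forall>B\<in>(`) (lpa_class E) ` \<A>. rng_ideal B L" using \<A>(2) image_ideal(1) by blast
    have ne: "(`) (lpa_class E) ` \<A> \<noteq> {}" using \<A>(1) by simp
    have "\<exists>B\<in>(`) (lpa_class E) ` \<A>. B \<subseteq> P"
      using sp[unfolded strongly_prime_def, THEN conjunct2, THEN spec, THEN mp, OF ne,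
          THEN mp, OF ideals, THEN mp, OF sub] .
    then obtain A where A: "A \<in> \<A>" "lpa_class E ` A \<subseteq> P" by blast
    have "A \<subseteq> lpa_carrier E" using lpa_ideal.I_closed(4) \<A>(2) A(1) by blast
    then have "A \<subseteq> class_preimage E P" using A(2) by (auto simp: class_preimage_def)
    then show "\<exists>A\<in>\<A>. A \<subseteq> class_preimage E P" using A(1) by blast
  qed
next
  have PL: "rng_ideal P L" using P by (simp add: proper_ideal_def)
  assume fp: "free_strongly_prime (class_preimage E P)"
  have "\<exists>A\<in>\<A>. A \<subseteq> P" if \<A>: "\<A> \<noteq> {}" "\<forall>A\<in>\<A>. rng_ideal A L" "\<Inter>\<A> \<subseteq> P" for \<A>
  proof -
    have sub: "\<Inter>(class_preimage E ` \<A>) \<subseteq> class_preimage E P"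
      using \<A>(1,3) by (auto simp: class_preimage_def)
    have ideals: "\<forall>B\<in>class_preimage E ` \<A>. lpa_ideal E B" using \<A>(2) preimage_ideal(1) by blast
    have ne: "class_preimage E ` \<A> \<noteq> {}" using \<A>(1) by simp
    have "\<exists>B\<in>class_preimage E ` \<A>. B \<subseteq> class_preimage E P"
      using fp[unfolded free_strongly_prime_def, THEN spec, THEN mp, OF ne,
          THEN mp, OF ideals, THEN mp, OF sub] .
    then obtain A where "A \<in> \<A>" "class_preimage E A \<subseteq> class_preimage E P" by blast
    then show ?thesis using preimage_mono_iff[OF _ PL, of A] \<A>(2) by (intro bexI[of _ A]) simp_all
  qed
  then show "strongly_prime P L" unfolding strongly_prime_def using P by (intro conjI allI impI)
qed

lemma finsum_class:
  assumes "finite N" "\<And>n. n \<in> N \<Longrightarrow> f n \<in> lpa_carrier E"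
  shows "finsum L (\<lambda>n. lpa_class E (f n)) N = lpa_class E (\<Sum>n\<in>N. f n)"
proof -
  interpret L: nonunital_ring L by (rule L_nonunital)
  show ?thesis
    using assms
  proof (induct N rule: finite_induct)
    case empty
    have "\<zero>\<^bsub>L\<^esub> = lpa_class E 0"
      using R.FactRing_zero[OF kernel_ideal'] by (simp add: L_eq class_eq del: R.a_coset_add_zero)
    then show ?case by simp
  next
    case (insert m N)
    then show ?case
      using L_carrier L_ops(1)[of "f m" "\<Sum>n\<in>N. f n"] by (auto simp: carrier_sum)
  qed
qed

lemma graded_if_condition_K:
  assumes K: "condition_K E" and P: "rng_ideal P L"
  shows "graded_ideal TYPE('k) E P"
proof -
  interpret I: lpa_ideal E "class_preimage E P" by (rule preimage_ideal[OF P])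
  have "\<exists>N f. finite N \<and> (\<forall>n\<in>N. f n \<in> P \<inter> lpa_component TYPE('k) E n) \<and> a = finsum L f N" if a: "a \<in> P" for a
  proof -
    have "a \<in> lpa_class E ` class_preimage E P" using preimage_ideal(2)[OF P] a by simp
    then obtain p where p: "p \<in> class_preimage E P" "a = lpa_class E p" by blast
    then have "p \<in> I.graded_part" using I.graded_part_eq[OF K] by simp
    then obtain N f where f: "finite N" "\<forall>n\<in>N. f n \<in> class_preimage E P \<and> homogeneous n (f n)"
      "p - (\<Sum>n\<in>N. f n) \<in> lpa_kernel E" by (auto simp: I.graded_part_def)
    have fc: "f n \<in> lpa_carrier E" if "n \<in> N" for n using f(2) that by (simp add: class_preimage_def)
    have "a = lpa_class E (\<Sum>n\<in>N. f n)"
      using class_eq_iff[of p "\<Sum>n\<in>N. f n"] p f(3) fc by (auto simp: class_preimage_def intro: carrier_sum)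
    then have "a = finsum L (\<lambda>n. lpa_class E (f n)) N" using finsum_class[OF f(1) fc] by simp
    moreover have "lpa_class E (f n) \<in> P \<inter> lpa_component TYPE('k) E n" if "n \<in> N" for n
      using f(2) that by (auto simp: class_preimage_def lpa_component_def homogeneous_def)
    ultimately show ?thesis
      using f(1) by (intro exI[of _ N] exI[of _ "\<lambda>n. lpa_class E (f n)"]) simp
  qed
  then show ?thesis using P by (simp add: graded_ideal_def L_def[symmetric])
qed

lemma primitive_if_least_idempotent:
  assumes P: "rng_ideal P L" and \<epsilon>: "\<epsilon> \<in> lpa_carrier E" "\<epsilon> \<notin> class_preimage E P" "\<epsilon> * \<epsilon> - \<epsilon> \<in> class_preimage E P"
    and least: "\<And>A. lpa_ideal E A \<Longrightarrow> class_preimage E P \<subseteq> A \<Longrightarrow> A \<noteq> class_preimage E P \<Longrightarrow> \<epsilon> \<in> A"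
  shows "primitive_ideal P L"
proof -
  interpret L: nonunital_ring L by (rule L_nonunital)
  have \<epsilon>\<epsilon>: "\<epsilon> * \<epsilon> \<in> lpa_carrier E" using \<epsilon>(1) carrier_mult_left carrier_subset_unital by blast
  show ?thesis
  proof (rule L.primitive_idealI[OF P, of "lpa_class E \<epsilon>"])
    show "lpa_class E \<epsilon> \<in> carrier L" using \<epsilon>(1) L_carrier by blast
    show "lpa_class E \<epsilon> \<notin> P" using \<epsilon>(1,2) by (simp add: class_preimage_def)
    have "lpa_class E \<epsilon> \<otimes>\<^bsub>L\<^esub> lpa_class E \<epsilon> \<ominus>\<^bsub>L\<^esub> lpa_class E \<epsilon> = lpa_class E (\<epsilon> * \<epsilon> - \<epsilon>)"
      using \<epsilon>(1) \<epsilon>\<epsilon> L_ops(1)[OF \<epsilon>\<epsilon> carrier_uminus[OF \<epsilon>(1)]] by (simp add: L_ops a_minus_def)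
    then show "lpa_class E \<epsilon> \<otimes>\<^bsub>L\<^esub> lpa_class E \<epsilon> \<ominus>\<^bsub>L\<^esub> lpa_class E \<epsilon> \<in> P"
      using \<epsilon>(3) by (simp add: class_preimage_def)
    fix A assume A: "rng_ideal A L" "P \<subseteq> A" "A \<noteq> P"
    have "class_preimage E P \<subseteq> class_preimage E A" "class_preimage E A \<noteq> class_preimage E P"
      using A preimage_mono_iff[OF P A(1)] preimage_mono_iff[OF A(1) P] by auto
    then have "\<epsilon> \<in> class_preimage E A" using least preimage_ideal(1)[OF A(1)] by blast
    then show "lpa_class E \<epsilon> \<in> A" by (simp add: class_preimage_def)
  qed
qed

end

section \<open>The equivalence\<close>

text \<open>Statement (3) in the wording of the theorem, so that the final proof can fold
  it.\<close>

definition CSP_condition :: "('v, 'e) pre_digraph \<Rightarrow> bool" where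
  "CSP_condition E \<longleftrightarrow> condition_K E \<and>
    (\<forall>p q. admissible_pair E p \<longrightarrow> admissible_pair E q \<longrightarrow> admissible_le p q \<or> admissible_le q p) \<and>
    (\<forall>H S. admissible_pair E (H, S) \<longrightarrow> H \<noteq> verts E \<longrightarrow>
       downward_directed (quotient_graph E (H, S)) \<and> strong_CSP (quotient_graph E (H, S)))"

context leavitt
begin

lemma proper_image:
  assumes "lpa_ideal E (I :: ('v, 'e, 'k) lpa_free set)" "I \<noteq> lpa_carrier E"
  shows "proper_ideal (lpa_class E ` I) L"
  using image_ideal[OF assms(1)] proper_iff[of "lpa_class E ` I"] assms(2) by simp

text \<open>The common core of the steps from (1) to (3) and from (2) to (3): both provide the chain
  of ideals and the strong CSP for the pairs of ideals, and every admissible pair is the pair of an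
  ideal.\<close>

lemma CSP_condition_if_chain:
  assumes chain: "\<And>I J :: ('v, 'e, 'k) lpa_free set. lpa_ideal E I \<Longrightarrow> lpa_ideal E J \<Longrightarrow> I \<subseteq> J \<or> J \<subseteq> I"
    and csp: "\<And>I :: ('v, 'e, 'k) lpa_free set. lpa_ideal E I \<Longrightarrow> ideal_verts E I \<noteq> verts E \<Longrightarrow>
      strong_CSP (quotient_graph E (ideal_verts E I, ideal_breaking E I))"
  shows "CSP_condition E"
  unfolding CSP_condition_def
proof (intro conjI allI impI)
  show "condition_K E" using chain by (rule condition_K_if_chain[OF wf_digraph_axioms])
  fix p q assume p: "admissible_pair E p" and q: "admissible_pair E q"
  obtain H S where HS: "p = (H, S)" by (cases p)
  obtain H' S' where HS': "q = (H', S')" by (cases q)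
  obtain I :: "('v, 'e, 'k) lpa_free set" where I: "lpa_ideal E I" "ideal_verts E I = H" "ideal_breaking E I = S"
    using ideal_of_admissible_pair[OF wf_digraph_axioms] p unfolding HS by metis
  obtain J :: "('v, 'e, 'k) lpa_free set" where J: "lpa_ideal E J" "ideal_verts E J = H'" "ideal_breaking E J = S'"
    using ideal_of_admissible_pair[OF wf_digraph_axioms] q unfolding HS' by metis
  show "admissible_le p q \<or> admissible_le q p"
    using chain[OF I(1) J(1)] ideal_pair_mono[OF J(1), of I] ideal_pair_mono[OF I(1), of J] I J HS HS' by auto
next
  fix H S assume HS: "admissible_pair E (H, S)" "H \<noteq> verts E"
  obtain I :: "('v, 'e, 'k) lpa_free set" where "lpa_ideal E I" "ideal_verts E I = H" "ideal_breaking E I = S"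
    using ideal_of_admissible_pair[OF wf_digraph_axioms HS(1)] by metis
  then show csp': "strong_CSP (quotient_graph E (H, S))" using csp HS(2) by blast
  interpret quotient E H S by unfold_locales fact
  show "downward_directed (quotient_graph E (H, S))"
    using F.strong_CSP_downward_directed csp' by blast
qed

lemma CSP_condition_if_strongly_prime:
  assumes sp: "\<forall>P. proper_ideal P L \<longrightarrow> strongly_prime P L"
  shows "CSP_condition E"
proof (rule CSP_condition_if_chain)
  have prime: "free_strongly_prime I" if "lpa_ideal E I" "I \<noteq> lpa_carrier E" for I
    using sp proper_image[OF that] strongly_prime_iff[OF proper_image[OF that]] image_ideal(2)[OF that(1)] by simp
  show chain: "I \<subseteq> J \<or> J \<subseteq> I" if I: "lpa_ideal E I" and J: "lpa_ideal E J" for I J :: "('v, 'e, 'k) lpa_free set"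
  proof (cases "I \<inter> J = lpa_carrier E")
    case True
    then show ?thesis using lpa_ideal.I_closed(4)[OF I] by blast
  next
    case False
    have "lpa_ideal E (I \<inter> J)" using lpa_ideal_Inter[of "{I, J}" E] I J by auto
    then have "free_strongly_prime (I \<inter> J)" using prime False by blast
    \<comment> \<open>The intersection is itself strongly prime; tested on the family of the two
      ideals, it must contain one of them.\<close>
    then have "\<exists>A\<in>{I, J}. A \<subseteq> I \<inter> J"
      unfolding free_strongly_prime_def by (elim allE[of _ "{I, J}"]) (use I J in simp)
    then show ?thesis by blast
  qed
  show "strong_CSP (quotient_graph E (ideal_verts E P, ideal_breaking E P))"
    if P: "lpa_ideal E P" "ideal_verts E P \<noteq> verts E" for P :: "('v, 'e, 'k) lpa_free set"
  proof -
    interpret P: lpa_ideal E P by (rule P(1))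
    interpret quotient E "ideal_verts E P" "ideal_breaking E P"
      by unfold_locales (rule P.admissible_ideal_pair)
    have "P \<noteq> lpa_carrier E"
      using P(2) by (auto simp: ideal_verts_def carrier_monom)
    then have fp: "free_strongly_prime P" using prime P(1) by blast
    show ?thesis
    proof (rule strong_CSP_quotient[OF _ chain P(1) refl refl _ P(2)])
      show "condition_K E" using chain by (rule condition_K_if_chain[OF wf_digraph_axioms])
      show "\<exists>A\<in>\<A>. A \<subseteq> P" if "\<A> \<noteq> {}" "\<And>A. A \<in> \<A> \<Longrightarrow> lpa_ideal E A" "\<Inter>\<A> \<subseteq> P" for \<A>
        using fp[unfolded free_strongly_prime_def, THEN spec, THEN mp, OF that(1)] that(2,3) by simp
    qed
  qed
qed

lemma CSP_condition_if_strongly_primitive: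
  assumes primitive: "\<forall>P. proper_ideal P L \<longrightarrow> graded_ideal TYPE('k) E P \<and> strongly_primitive TYPE('k) E P"
    and chain: "\<forall>P Q. proper_ideal P L \<longrightarrow> proper_ideal Q L \<longrightarrow> P \<subseteq> Q \<or> Q \<subseteq> P"
  shows "CSP_condition E"
proof (rule CSP_condition_if_chain)
  show "I \<subseteq> J \<or> J \<subseteq> I" if I: "lpa_ideal E I" and J: "lpa_ideal E J" for I J :: "('v, 'e, 'k) lpa_free set"
  proof (cases "I = lpa_carrier E \<or> J = lpa_carrier E")
    case True
    then show ?thesis using lpa_ideal.I_closed(4)[OF I] lpa_ideal.I_closed(4)[OF J] by blast
  next
    case False
    then have "lpa_class E ` I \<subseteq> lpa_class E ` J \<or> lpa_class E ` J \<subseteq> lpa_class E ` I"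
      using chain proper_image I J by blast
    then show ?thesis
      using preimage_mono_iff image_ideal[OF I] image_ideal[OF J] by metis
  qed
  show "strong_CSP (quotient_graph E (ideal_verts E P, ideal_breaking E P))"
    if P: "lpa_ideal E P" "ideal_verts E P \<noteq> verts E" for P :: "('v, 'e, 'k) lpa_free set"
  proof -
    have "P \<noteq> lpa_carrier E" using P(2) by (auto simp: ideal_verts_def carrier_monom)
    then have "strongly_primitive TYPE('k) E (lpa_class E ` P)"
      using primitive proper_image[OF P(1)] by blast
    then show ?thesis
      by (simp add: strongly_primitive_def gr_pair_eq image_ideal(2)[OF P(1)])
  qed
qed

text \<open>The conclusions share two ingredients: the chain of ideals, which Condition (K)
  transfers from the chain of pairs, and for each proper P the idempotent of
  \<open>least\<close>.\<close>

lemma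
  assumes cond: "CSP_condition E"
  shows strongly_prime_if_CSP_condition: "\<forall>P. proper_ideal P L \<longrightarrow> strongly_prime P L"
    and strongly_primitive_if_CSP_condition:
      "\<forall>P. proper_ideal P L \<longrightarrow> graded_ideal TYPE('k) E P \<and> strongly_primitive TYPE('k) E P"
    and chain_if_CSP_condition: "\<forall>P Q. proper_ideal P L \<longrightarrow> proper_ideal Q L \<longrightarrow> P \<subseteq> Q \<or> Q \<subseteq> P"
proof -
  have K: "condition_K E" using cond by (simp add: CSP_condition_def)
  have chain: "I \<subseteq> J \<or> J \<subseteq> I" if I: "lpa_ideal E I" and J: "lpa_ideal E J" for I J :: "('v, 'e, 'k) lpa_free set"
    using ideal_subset_if_pair_le[OF K I J] ideal_subset_if_pair_le[OF K J I] cond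
      lpa_ideal.admissible_ideal_pair[OF I] lpa_ideal.admissible_ideal_pair[OF J]
    unfolding CSP_condition_def by blast
  show "\<forall>P Q. proper_ideal P L \<longrightarrow> proper_ideal Q L \<longrightarrow> P \<subseteq> Q \<or> Q \<subseteq> P"
    using chain preimage_ideal(1) preimage_mono_iff unfolding proper_ideal_def by metis
  have least: "strong_CSP (quotient_graph E (gr_pair TYPE('k) E P)) \<and>
    (\<exists>\<epsilon>. \<epsilon> \<in> lpa_carrier E \<and> \<epsilon> \<notin> class_preimage E P \<and> \<epsilon> * \<epsilon> - \<epsilon> \<in> class_preimage E P \<and>
      (\<forall>A. lpa_ideal E A \<longrightarrow> class_preimage E P \<subseteq> A \<longrightarrow> A \<noteq> class_preimage E P \<longrightarrow> \<epsilon> \<in> A))"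
    if P: "proper_ideal P L" for P
  proof -
    have PL: "rng_ideal P L" using P by (simp add: proper_ideal_def)
    let ?I = "class_preimage E P"
    interpret I: lpa_ideal E ?I by (rule preimage_ideal[OF PL])
    interpret quotient_ideal E "ideal_verts E ?I" "ideal_breaking E ?I" ?I
      by unfold_locales (simp_all add: I.admissible_ideal_pair)
    have "ideal_verts E ?I \<noteq> verts E"
      using I.carrier_if_all_verts proper_iff[OF PL] P by blast
    then have csp: "strong_CSP (quotient_graph E (ideal_verts E ?I, ideal_breaking E ?I))"
      using cond I.admissible_ideal_pair by (simp add: CSP_condition_def)
    show ?thesis
      using least_idempotent[OF K csp] csp unfolding gr_pair_eq by metis
  qed
  show "\<forall>P. proper_ideal P L \<longrightarrow> strongly_prime P L"
  proof (intro allI impI)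
    fix P assume P: "proper_ideal P L"
    have I: "lpa_ideal E (class_preimage E P)" using P preimage_ideal(1) by (simp add: proper_ideal_def)
    obtain \<epsilon> where \<epsilon>: "\<epsilon> \<notin> class_preimage E P"
      "\<And>A. lpa_ideal E A \<Longrightarrow> class_preimage E P \<subseteq> A \<Longrightarrow> A \<noteq> class_preimage E P \<Longrightarrow> \<epsilon> \<in> A"
      using least[OF P] by metis
    have "\<exists>A\<in>\<A>. A \<subseteq> class_preimage E P"
      if \<A>: "\<A> \<noteq> {}" "\<forall>A\<in>\<A>. lpa_ideal E A" "\<Inter>\<A> \<subseteq> class_preimage E P" for \<A>
    proof (rule ccontr)
      assume none: "\<not> (\<exists>A\<in>\<A>. A \<subseteq> class_preimage E P)"
      \<comment> \<open>By the chain condition an ideal not contained in P lies properly above P, so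
        every member of the family contains \<epsilon>, and so does their intersection.\<close>
      have "\<epsilon> \<in> A" if A: "A \<in> \<A>" for A
      proof (rule \<epsilon>(2))
        show "lpa_ideal E A" using A \<A>(2) by blast
        then show "class_preimage E P \<subseteq> A" using chain[OF I] none A by blast
        show "A \<noteq> class_preimage E P" using none A by blast
      qed
      then show False using \<A>(3) \<epsilon>(1) by blast
    qed
    then have "free_strongly_prime (class_preimage E P)"
      unfolding free_strongly_prime_def by (intro allI impI)
    then show "strongly_prime P L" using strongly_prime_iff[OF P] by blast
  qed
  show "\<forall>P. proper_ideal P L \<longrightarrow> graded_ideal TYPE('k) E P \<and> strongly_primitive TYPE('k) E P"
  proof (intro allI impI conjI)
    fix P assume P: "proper_ideal P L"
    then have PL: "rng_ideal P L" by (simp add: proper_ideal_def)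
    show "graded_ideal TYPE('k) E P" by (rule graded_if_condition_K[OF K PL])
    obtain \<epsilon> where "\<epsilon> \<in> lpa_carrier E" "\<epsilon> \<notin> class_preimage E P" "\<epsilon> * \<epsilon> - \<epsilon> \<in> class_preimage E P"
      "\<And>A. lpa_ideal E A \<Longrightarrow> class_preimage E P \<subseteq> A \<Longrightarrow> A \<noteq> class_preimage E P \<Longrightarrow> \<epsilon> \<in> A"
      using least[OF P] by metis
    then have "primitive_ideal P L" by (rule primitive_if_least_idempotent[OF PL])
    then show "strongly_primitive TYPE('k) E P"
      using least[OF P] by (simp add: strongly_primitive_def L_def)
  qed
qed

end

theorem theorem4p18:
  fixes E :: "('v, 'e) pre_digraph"
    and L :: "(('v, 'e, 'k::field) lpa_free set) ring"
  assumes "wf_digraph E"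
    and L_def: "L = lpa TYPE('k) E"
  shows "((\<forall>P. proper_ideal P L \<longrightarrow> strongly_prime P L) \<longleftrightarrow>
          (\<forall>P. proper_ideal P L \<longrightarrow> graded_ideal TYPE('k) E P \<and> strongly_primitive TYPE('k) E P) \<and>
          (\<forall>P Q. proper_ideal P L \<longrightarrow> proper_ideal Q L \<longrightarrow> P \<subseteq> Q \<or> Q \<subseteq> P))
       \<and> ((\<forall>P. proper_ideal P L \<longrightarrow> strongly_prime P L) \<longleftrightarrow>
          condition_K E \<and>
          (\<forall>p q. admissible_pair E p \<longrightarrow> admissible_pair E q \<longrightarrow>
             admissible_le p q \<or> admissible_le q p) \<and>
          (\<forall>H S. admissible_pair E (H, S) \<longrightarrow> H \<noteq> verts E \<longrightarrow>
             downward_directed (quotient_graph E (H, S)) \<and>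
             strong_CSP (quotient_graph E (H, S))))"
proof -
  interpret wf_digraph E by fact
  interpret leavitt E L by unfold_locales fact
  show ?thesis
    unfolding CSP_condition_def[symmetric]
    using CSP_condition_if_strongly_prime CSP_condition_if_strongly_primitive
      strongly_prime_if_CSP_condition strongly_primitive_if_CSP_condition chain_if_CSP_condition
    by blast
qed

end
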